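(* There exists a constant $K$ such that for all $n\ge1$, all inverse temperatures $\beta\ge\tfrac13$ and all vertices $v_1,v_2$ of $\Lambda_n$ (with free or zero boundary conditions), if $\theta$ is a Villain model on $\Lambda_n$ at inverse temperature $\beta$, then $$\mathbb E^{Vil}_\beta\big[\cos(\theta(v_1)-\theta(v_2))\big]\ \le\ K\,\mathbb E^{GFF}_\beta\big[e^{i(\phi(v_1)-\phi(v_2))}\big]^{1+\frac{M(\beta)}2}\ =\ K\,\mathbb E^{GFF}_{\beta/(1+\frac{M(\beta)}{2})}\big[e^{i(\phi(v_1)-\phi(v_2))}\big],$$ where $\phi$ is a Gaussian free field on the same graph $\Lambda_n$ (same boundary conditions), at the inverse temperature indicated in the subscript.
   Context: Graphs. $\Lambda_n$ is one of two graphs. Free boundary conditions: $[-n,n]^2\cap\mathbb Z^2$ with nearest-neighbour edges and marked vertex $v_0=(0,0)$. Zero (Dirichlet) boundary conditions: $([-n,n]^2\cap\mathbb Z^2)\cup\{\infty\}$ with nearest-neighbour edges and the vertices of $\partial[-n,n]^2$ connected to $\infty$ so that the graph is the planar dual of a square-grid box (one edge to $\infty$ for each non-corner boundary vertex, two parallel edges for each corner), with marked vertex $v_0=\infty$. $V,E$ are the sets of vertices and (arbitrarily oriented) edges. For a function $w$ on $V$ and an edge $e=\overrightarrow{xy}$, $\mathrm d w(e)=w(y)-w(x)$. Villain model at inverse temperature $\beta$: random $\theta:V\to[0,2\pi)$ with $\theta(v_0)=0$ and law $\mathbb P^{Vil}_\beta(d\theta)\propto\prod_{e\in E}\sum_{k\in\mathbb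 Z}\exp\big(-\tfrac\beta2(\mathrm d\theta(e)+2\pi k)^2\big)\,d\theta$ with respect to Lebesgue measure on $[0,2\pi)^{V\setminus\{v_0\}}$. Gaussian free field (GFF) at inverse temperature $\beta$: random $\phi:V\to\mathbb R$ with $\phi(v_0)=0$ and law $\mathbb P^{GFF}_\beta(d\phi)\propto\exp\big(-\tfrac\beta2\sum_{e\in E}(\mathrm d\phi(e))^2\big)\,d\phi$ on $\mathbb R^{V\setminus\{v_0\}}$. Error function. An integer-valued Gaussian with parameters $(a,\beta)$ is a $\mathbb Z$-valued $X$ with $\mathbb P^{IG}_{\beta,a}[X=k]\propto e^{-\frac\beta2(k-a)^2}$; $\operatorname{Var}^{IG}(a,\beta)$ is its variance. $M(\beta):=(2\pi)^2\beta\inf_{a\in[0,1/2]}\operatorname{Var}^{IG}(a,(2\pi)^2\beta)$. *)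

theory Defs
  imports "HOL-Probability.Probability" "HOL-Library.Complex_Order" "Graph_Theory.Digraph"
begin

section \<open>The graphs\<close>

datatype boundary = Free | Zero

text \<open>\<open>None\<close> is the extra vertex \<open>\<infinity>\<close> of the zero boundary graph.\<close>
type_synonym vertex = "(int \<times> int) option"

definition lattice_box :: "nat \<Rightarrow> (int \<times> int) set" where
  "lattice_box n = {- int n..int n} \<times> {- int n..int n}"

text \<open>Every nearest-neighbour edge of the square lattice once, oriented to the right or upwards.\<close>
definition nn_edges :: "((int \<times> int) \<times> (int \<times> int)) set" where
  "nn_edges = {(x, y). y = (fst x + 1, snd x) \<or> y = (fst x, snd x + 1)}"

text \<open>
  Collapses the complement of the box to \<open>\<infinity>\<close>.  A non-corner boundary vertex has one neighbour
  outside the box and a corner has two, so that keeping all lattice edges with at least one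
  endpoint in the box (labelled by the original lattice edge) yields one edge to \<open>\<infinity>\<close> in the
  former case and two parallel ones in the latter; see \<open>card_arcs_to_infinity\<close>.
\<close>
definition collapse :: "nat \<Rightarrow> int \<times> int \<Rightarrow> vertex" where
  "collapse n x = (if x \<in> lattice_box n then Some x else None)"

fun lattice_graph :: "boundary \<Rightarrow> nat \<Rightarrow> (vertex, (int \<times> int) \<times> (int \<times> int)) pre_digraph" where
  "lattice_graph Free n =
     \<lparr>verts = Some ` lattice_box n,
      arcs = {(x, y) \<in> nn_edges. x \<in> lattice_box n \<and> y \<in> lattice_box n},
      tail = (\<lambda>(x, y). Some x),
      head = (\<lambda>(x, y). Some y)\<rparr>"
| "lattice_graph Zero n =
     \<lparr>verts = insert None (Some ` lattice_box n),
      arcs = {(x, y) \<in> nn_edges. x \<in> lattice_box n \<or> y \<in> lattice_box n},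
      tail = (\<lambda>(x, y). collapse n x),
      head = (\<lambda>(x, y). collapse n y)\<rparr>"

fun marked_vertex :: "boundary \<Rightarrow> vertex" where
  "marked_vertex Free = Some (0, 0)"
| "marked_vertex Zero = None"

lemma marked_vertex_in_verts: "marked_vertex b \<in> verts (lattice_graph b n)"
  by (cases b) (auto simp: lattice_box_def)

lemma fin_digraph_lattice_graph: "fin_digraph (lattice_graph b n)"
proof -
  have fin: "finite (lattice_box n)"
    by (simp add: lattice_box_def)
  have sub: "{(x, y) \<in> nn_edges. x \<in> lattice_box n \<or> y \<in> lattice_box n} \<subseteq> lattice_box (Suc n) \<times> lattice_box (Suc n)"
    by (auto simp: nn_edges_def lattice_box_def)
  have fin2: "finite {(x, y) \<in> nn_edges. x \<in> lattice_box n \<or> y \<in> lattice_box n}"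
    by (rule finite_subset[OF sub]) (simp add: lattice_box_def)
  have fin3: "finite {(x, y) \<in> nn_edges. x \<in> lattice_box n \<and> y \<in> lattice_box n}"
    by (rule finite_subset[OF _ fin2]) auto
  show ?thesis
    by (cases b; unfold_locales)
       (use fin fin2 fin3 in \<open>auto simp: collapse_def\<close>)
qed

lemma card_arcs_to_infinity:
  assumes "n \<ge> 1" and "x \<in> lattice_box n"
  defines "G \<equiv> lattice_graph Zero n"
  shows "card {e \<in> arcs G. {tail G e, head G e} = {Some x, None}} =
         (if \<bar>fst x\<bar> = int n then 1 else 0) + (if \<bar>snd x\<bar> = int n then 1 else 0)"
proof -
  obtain a b where x: "x = (a, b)" by (cases x)
  have ab: "\<bar>a\<bar> \<le> int n" "\<bar>b\<bar> \<le> int n"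
    using assms(2) by (auto simp: lattice_box_def x)
  define A where "A = {e \<in> arcs G. {tail G e, head G e} = {Some x, None}}"
  have mem: "(y, z) \<in> A \<longleftrightarrow>
      (y = x \<and> z = (a + 1, b) \<and> a = int n) \<or> (y = x \<and> z = (a, b + 1) \<and> b = int n) \<or>
      (z = x \<and> y = (a - 1, b) \<and> a = - int n) \<or> (z = x \<and> y = (a, b - 1) \<and> b = - int n)" for y z
  proof -
    have "(y, z) \<in> A \<longleftrightarrow> (y, z) \<in> nn_edges \<and>
        (y = x \<and> z \<notin> lattice_box n \<or> z = x \<and> y \<notin> lattice_box n)"
      using assms(2) by (simp add: A_def G_def collapse_def doubleton_eq_iff) blast
    also have "\<dots> \<longleftrightarrow>
        (y = x \<and> z = (a + 1, b) \<and> z \<notin> lattice_box n) \<or> (y = x \<and> z = (a, b + 1) \<and> z \<notin> lattice_box n) \<or>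
        (z = x \<and> y = (a - 1, b) \<and> y \<notin> lattice_box n) \<or> (z = x \<and> y = (a, b - 1) \<and> y \<notin> lattice_box n)"
      unfolding nn_edges_def x by (cases y; cases z) (simp, smt (verit))
    also have "(z = (a + 1, b) \<and> z \<notin> lattice_box n) \<longleftrightarrow> (z = (a + 1, b) \<and> a = int n)"
      using ab by (auto simp: lattice_box_def)
    also have "(z = (a, b + 1) \<and> z \<notin> lattice_box n) \<longleftrightarrow> (z = (a, b + 1) \<and> b = int n)"
      using ab by (auto simp: lattice_box_def)
    also have "(y = (a - 1, b) \<and> y \<notin> lattice_box n) \<longleftrightarrow> (y = (a - 1, b) \<and> a = - int n)"
      using ab by (auto simp: lattice_box_def)
    also have "(y = (a, b - 1) \<and> y \<notin> lattice_box n) \<longleftrightarrow> (y = (a, b - 1) \<and> b = - int n)"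
      using ab by (auto simp: lattice_box_def)
    finally show ?thesis .
  qed
  let ?H = "if a = int n then {(x, (a + 1, b))} else if a = - int n then {((a - 1, b), x)} else {}"
  let ?V = "if b = int n then {(x, (a, b + 1))} else if b = - int n then {((a, b - 1), x)} else {}"
  have "A = ?H \<union> ?V"
  proof (rule set_eqI)
    fix e :: "(int \<times> int) \<times> (int \<times> int)"
    obtain y z where e: "e = (y, z)" by (cases e)
    show "e \<in> A \<longleftrightarrow> e \<in> ?H \<union> ?V"
      unfolding e mem using assms(1) by (cases "a = int n"; cases "b = int n") auto
  qed
  moreover have "?H \<inter> ?V = {}"
    by (simp add: x)
  moreover have "card ?H = (if \<bar>a\<bar> = int n then 1 else 0)"
    by (cases "a = int n"; cases "a = - int n") auto
  moreover have "card ?V = (if \<bar>b\<bar> = int n then 1 else 0)"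
    by (cases "b = int n"; cases "b = - int n") auto
  ultimately show ?thesis
    unfolding A_def[symmetric] by (simp add: card_Un_disjoint x)
qed

section \<open>Random fields pinned at the marked vertex\<close>

text \<open>The probability measure whose density with respect to \<open>\<mu>\<close> is proportional to \<open>w\<close>.\<close>
definition normalized_density :: "'a measure \<Rightarrow> ('a \<Rightarrow> real) \<Rightarrow> 'a measure" where
  "normalized_density \<mu> w = density \<mu> (\<lambda>x. ennreal (w x) / (\<integral>\<^sup>+ y. ennreal (w y) \<partial>\<mu>))"

lemma prob_space_normalized_density:
  assumes [measurable]: "w \<in> borel_measurable \<mu>"
    and "(\<integral>\<^sup>+ y. ennreal (w y) \<partial>\<mu>) \<noteq> 0" and "(\<integral>\<^sup>+ y. ennreal (w y) \<partial>\<mu>) \<noteq> \<infinity>"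
  shows "prob_space (normalized_density \<mu> w)"
proof
  show "emeasure (normalized_density \<mu> w) (space (normalized_density \<mu> w)) = 1"
    using assms(2,3)
    by (simp add: normalized_density_def emeasure_density nn_integral_divide ennreal_divide_self
        less_top cong: nn_integral_cong)
qed

text \<open>
  The product measure \<open>\<nu>\<^bsup>V \<setminus> {v0}\<^esup>\<close>, transported to fields on the whole vertex set \<open>V\<close> that
  vanish at \<open>v0\<close>.
\<close>
definition pinned_product ::
    "('v, 'e) pre_digraph \<Rightarrow> 'v \<Rightarrow> real measure \<Rightarrow> ('v \<Rightarrow> real) measure" where
  "pinned_product G v0 \<nu> =
     distr (PiM (verts G - {v0}) (\<lambda>_. \<nu>)) (PiM (verts G) (\<lambda>_. borel)) (\<lambda>\<theta>. \<theta>(v0 := 0))"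

definition gradient :: "('v, 'e) pre_digraph \<Rightarrow> ('v \<Rightarrow> real) \<Rightarrow> 'e \<Rightarrow> real" where
  "gradient G w e = w (head G e) - w (tail G e)"

definition villain_law :: "('v, 'e) pre_digraph \<Rightarrow> 'v \<Rightarrow> real \<Rightarrow> ('v \<Rightarrow> real) measure" where
  "villain_law G v0 \<beta> =
     normalized_density (pinned_product G v0 (restrict_space lborel {0..<2 * pi}))
       (\<lambda>\<theta>. \<Prod>e\<in>arcs G. \<Sum>\<^sub>\<infinity>k::int. exp (- \<beta> / 2 * (gradient G \<theta> e + 2 * pi * real_of_int k)\<^sup>2))"

definition gff_law :: "('v, 'e) pre_digraph \<Rightarrow> 'v \<Rightarrow> real \<Rightarrow> ('v \<Rightarrow> real) measure" where
  "gff_law G v0 \<beta> =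
     normalized_density (pinned_product G v0 lborel)
       (\<lambda>\<phi>. exp (- \<beta> / 2 * (\<Sum>e\<in>arcs G. (gradient G \<phi> e)\<^sup>2)))"

section \<open>The error function\<close>

definition integer_gaussian :: "real \<Rightarrow> real \<Rightarrow> int measure" where
  "integer_gaussian a \<beta> =
     normalized_density (count_space UNIV) (\<lambda>k. exp (- \<beta> / 2 * (real_of_int k - a)\<^sup>2))"

definition Var_IG :: "real \<Rightarrow> real \<Rightarrow> real" where
  "Var_IG a \<beta> = prob_space.variance (integer_gaussian a \<beta>) real_of_int"

definition error_M :: "real \<Rightarrow> real" where
  "error_M \<beta> = (2 * pi)\<^sup>2 * \<beta> * (INF a\<in>{0..1 / 2}. Var_IG a ((2 * pi)\<^sup>2 * \<beta>))"

end

theory Submission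
  imports Defs "HOL-Complex_Analysis.Cauchy_Integral_Formula"
begin

text \<open>
  Let \<open>f\<close> be the Green function of the pair \<open>v1, v2\<close>, and let \<open>R\<close> be its energy, the effective
  resistance.  The Gaussian field has characteristic function \<open>exp (- R / (2 * \<beta>))\<close>.  Translating the
  Villain integral by \<open>\<i> * f / \<beta>\<close>, which is permitted since the integrand is entire and periodic,
  produces the same factor and leaves, for every edge \<open>e\<close>, the characteristic function at frequency
  \<open>2 * pi * df e\<close> of an integer-valued Gaussian with parameter \<open>(2 * pi)\<^sup>2 * \<beta>\<close>.  If \<open>df e\<close> is small,
  this is at most \<open>exp (- pi\<^sup>2 * (df e)\<^sup>2 * V)\<close> with \<open>V\<close> the smallest variance of such a Gaussian: only
  half of the true Gaussian decay is claimed, and the slack absorbs the higher order terms.  The product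
  over all edges is the desired \<open>exp (- R / (2 * \<beta>) * M / 2)\<close>.  Edges where \<open>df e\<close> is not small
  cost a bounded factor each, and their number is bounded uniformly in \<open>n\<close>, \<open>v1\<close> and \<open>v2\<close>: by
  reciprocity \<open>df e\<close> is the difference between \<open>v1\<close> and \<open>v2\<close> of the dipole potential of \<open>e\<close>, which
  has energy at most one, so that by the Courant--Lebesgue lemma it is nearly constant on some ring of bounded
  radius around \<open>e\<close> and, by the maximum principle, outside that ring.
\<close>

section \<open>Dirichlet form, Green functions and effective resistance\<close>

text \<open>The parameter of the integer-valued Gaussian at an edge is the angle increment there
  divided by \<open>- 2 * pi\<close>. It varies over the torus, so the decay of the characteristic
  function must be uniform in the parameter. The infimum in \<open>error_M\<close> is not located:
  it is bounded above by the variance at parameter 0, at most \<open>21 / 10 * exp (- B / 2)\<close>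
  with \<open>B = (2 * pi)\<^sup>2 * \<beta>\<close>, and the decay is shown to match this number at
  every parameter. For \<open>\<beta> \<ge> 1 / 3\<close> one has \<open>B \<ge> 12\<close>, and few
  atoms near the centre decide both estimates. Uniformity of \<open>K\<close> in \<beta> holds
  because a steep edge gives up at most \<open>exp (pi\<^sup>2)\<close>: gradients of Green
  functions of pairs and the smallest variance are both at most 1. The count of steep edges needs no
  asymptotics of lattice Green functions, only bounded energy and the divergence of the harmonic
  series. The boundary is what complicates it: for zero boundary conditions potentials are extended
  to the whole lattice by their value at infinity; for free ones the box may cut a ring, which is
  used when one of its corners stays inside.\<close>

locale pinned_network = fin_digraph G for G :: "('v, 'e) pre_digraph" +
  fixes v0 :: 'v
  assumes v0_in_verts: "v0 \<in> verts G"
    and connected: "\<lbrakk>\<And>e. e \<in> arcs G \<Longrightarrow> gradient G u e = 0; v \<in> verts G\<rbrakk> \<Longrightarrow> u v = u v0"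
begin

definition dirichlet :: "('v \<Rightarrow> real) \<Rightarrow> ('v \<Rightarrow> real) \<Rightarrow> real" where
  "dirichlet u w = (\<Sum>e\<in>arcs G. gradient G u e * gradient G w e)"

lemma dirichlet_commute: "dirichlet u w = dirichlet w u"
  by (simp add: dirichlet_def mult.commute)

lemma dirichlet_add: "dirichlet u (\<lambda>v. w v + c * w' v) = dirichlet u w + c * dirichlet u w'"
  by (simp add: dirichlet_def gradient_def sum.distrib[symmetric] sum_distrib_left algebra_simps)

lemma dirichlet_cong:
  assumes "\<And>v. v \<in> verts G \<Longrightarrow> u v = u' v" "\<And>v. v \<in> verts G \<Longrightarrow> w v = w' v"
  shows "dirichlet u w = dirichlet u' w'"
  using assms by (auto simp: dirichlet_def gradient_def intro!: sum.cong)

lemma dirichlet_self: "dirichlet u u = (\<Sum>e\<in>arcs G. (gradient G u e)\<^sup>2)"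
  by (simp add: dirichlet_def power2_eq_square)

lemma dirichlet_nonneg: "0 \<le> dirichlet u u"
  by (simp add: dirichlet_self sum_nonneg)

lemma gradient_square_le: "e \<in> arcs G \<Longrightarrow> (gradient G u e)\<^sup>2 \<le> dirichlet u u"
  unfolding dirichlet_self by (rule member_le_sum) auto

lemma dirichlet_zero_imp_const:
  assumes "dirichlet u u = 0" "v \<in> verts G"
  shows "u v = u v0"
proof (rule connected[OF _ assms(2)])
  fix e assume "e \<in> arcs G"
  with assms(1) gradient_square_le[of e u] show "gradient G u e = 0" by simp
qed

text \<open>
  Riesz representation, by Gram--Schmidt on the Dirac functions: \<open>p\<close> is the projection of the new
  Dirac function onto the span of the earlier ones.
\<close>
lemma riesz_supported:
  assumes "finite S" "S \<subseteq> verts G - {v0}"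
    and "\<And>u w c. L (\<lambda>v. u v + c * w v) = L u + c * L w"
  shows "\<exists>f. (\<forall>v. v \<notin> S \<longrightarrow> f v = 0) \<and>
    (\<forall>u. (\<forall>v. v \<notin> S \<longrightarrow> u v = 0) \<longrightarrow> dirichlet f u = L u)"
  using assms
proof (induction S arbitrary: L rule: finite_induct)
  case empty
  have L0: "L (\<lambda>_. 0) = 0"
    using empty.prems(2)[of "\<lambda>_. 0" "- 1" "\<lambda>_. 0"] by simp
  show ?case
  proof (intro exI[of _ "\<lambda>_. 0"] conjI allI impI)
    fix u :: "'v \<Rightarrow> real" assume "\<forall>v. v \<notin> {} \<longrightarrow> u v = 0"
    then have "u = (\<lambda>_. 0)" by auto
    with L0 show "dirichlet (\<lambda>_. 0) u = L u" by (simp add: dirichlet_def gradient_def)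
  qed simp
next
  case (insert x S)
  let ?d = "(\<lambda>v. if v = x then 1 else 0) :: 'v \<Rightarrow> real"
  have sub: "S \<subseteq> verts G - {v0}" "x \<in> verts G" "x \<noteq> v0" using insert.prems(1) by auto
  obtain f where f: "\<And>v. v \<notin> S \<Longrightarrow> f v = 0"
    "\<And>u. (\<And>v. v \<notin> S \<Longrightarrow> u v = 0) \<Longrightarrow> dirichlet f u = L u"
    using insert.IH[OF sub(1), of L] insert.prems(2) by blast
  obtain p where p: "\<And>v. v \<notin> S \<Longrightarrow> p v = 0"
    "\<And>u. (\<And>v. v \<notin> S \<Longrightarrow> u v = 0) \<Longrightarrow> dirichlet p u = dirichlet ?d u"
    using insert.IH[OF sub(1), of "dirichlet ?d"] dirichlet_add by blast
  define w where "w = (\<lambda>v. ?d v + (- 1) * p v)"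
  have wS: "w v = 0" if "v \<notin> insert x S" for v using p(1) that by (auto simp: w_def)
  have wx: "w x = 1" using p(1)[of x] insert.hyps(2) by (simp add: w_def)
  have wv0: "w v0 = 0" using wS[of v0] sub by auto
  have orth: "dirichlet w u = 0" if "\<And>v. v \<notin> S \<Longrightarrow> u v = 0" for u
    using p(2)[OF that] dirichlet_add[of u ?d "- 1" p]
    by (simp add: w_def dirichlet_commute)
  \<comment> \<open>\<open>w\<close> is 1 at \<open>x\<close> and 0 at \<open>v0\<close>, so
    connectedness excludes zero energy.\<close>
  have pos: "dirichlet w w \<noteq> 0"
    using dirichlet_zero_imp_const[of w x] wx wv0 sub(2) by auto
  define c where "c = L w / dirichlet w w"
  show ?case
  proof (intro exI[of _ "\<lambda>v. f v + c * w v"] conjI allI impI)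
    fix v assume "v \<notin> insert x S"
    then show "f v + c * w v = 0" using f(1)[of v] wS[of v] by auto
  next
    fix u :: "'v \<Rightarrow> real" assume u: "\<forall>v. v \<notin> insert x S \<longrightarrow> u v = 0"
    \<comment> \<open>Since \<open>w x = 1\<close>, subtracting \<open>u x * w\<close> leaves a
      function supported on \<open>S\<close>, to which the induction hypothesis applies.\<close>
    define r where "r = (\<lambda>v. u v + (- u x) * w v)"
    have r: "r v = 0" if "v \<notin> S" for v
      using u wS[of v] wx that by (cases "v = x") (auto simp: r_def)
    have u_eq: "u = (\<lambda>v. r v + u x * w v)" by (auto simp: r_def)
    have fw: "dirichlet f w = 0" using orth[of f] f(1) by (simp add: dirichlet_commute)
    have "dirichlet u (\<lambda>v. f v + c * w v) = dirichlet u f + c * dirichlet u w"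
      by (rule dirichlet_add)
    moreover have "dirichlet f u = L r + u x * dirichlet f w"
      using dirichlet_add[of f r "u x" w] f(2)[OF r] u_eq by simp
    moreover have "dirichlet w u = u x * dirichlet w w"
      using dirichlet_add[of w r "u x" w] orth[OF r] u_eq by simp
    moreover have "L u = L r + u x * L w"
      using insert.prems(2)[of r "u x" w] u_eq by simp
    ultimately show "dirichlet (\<lambda>v. f v + c * w v) u = L u"
      using pos fw by (simp add: c_def dirichlet_commute)
  qed
qed

text \<open>Riesz representation covers only test functions that vanish at \<open>v0\<close> and off
  the graph. Both sides are unchanged when a constant is subtracted from \<open>u\<close> or its
  values off the graph are altered, which removes this restriction.\<close>

lemma ex_green:
  assumes "a \<in> verts G" "b \<in> verts G"
  shows "\<exists>f. f v0 = 0 \<and> (\<forall>u. dirichlet f u = u a - u b)"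
proof -
  obtain f where f: "\<And>v. v \<notin> verts G - {v0} \<Longrightarrow> f v = 0"
    "\<And>u. (\<And>v. v \<notin> verts G - {v0} \<Longrightarrow> u v = 0) \<Longrightarrow> dirichlet f u = u a - u b"
    using riesz_supported[of "verts G - {v0}" "\<lambda>u. u a - u b"] by (auto simp: algebra_simps)
  have "dirichlet f u = u a - u b" for u
  proof -
    define u' where "u' v = (if v \<in> verts G then u v - u v0 else 0)" for v
    have "dirichlet f u = dirichlet f u'"
      by (auto simp: dirichlet_def gradient_def u'_def intro!: sum.cong)
    also have "\<dots> = u' a - u' b" by (rule f(2)) (auto simp: u'_def)
    finally show ?thesis using assms by (simp add: u'_def)
  qed
  with f(1)[of v0] show ?thesis by auto
qed

text \<open>The voltage of a unit current between \<open>a\<close> and \<open>b\<close>, grounded at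
  \<open>v0\<close>; the condition is the weak form of the Poisson equation with a source at
  \<open>a\<close> and a sink at \<open>b\<close>.\<close>

definition green :: "'v \<Rightarrow> 'v \<Rightarrow> 'v \<Rightarrow> real" where
  "green a b = (SOME f. f v0 = 0 \<and> (\<forall>u. dirichlet f u = u a - u b))"

definition resistance :: "'v \<Rightarrow> 'v \<Rightarrow> real" where
  "resistance a b = dirichlet (green a b) (green a b)"

context
  fixes a b assumes ab: "a \<in> verts G" "b \<in> verts G"
begin

lemma green_pinned: "green a b v0 = 0"
  and dirichlet_green: "dirichlet (green a b) u = u a - u b"
  using someI_ex[OF ex_green[OF ab]] unfolding green_def by auto

lemma resistance_eq: "resistance a b = green a b a - green a b b"
  by (simp add: resistance_def dirichlet_green)

lemma resistance_nonneg: "0 \<le> resistance a b"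
  by (simp add: resistance_def dirichlet_nonneg)

text \<open>With zero energy every gradient vanishes, so pairing with the indicator of
  \<open>a\<close> would give 0, whereas the Poisson equation gives 1.\<close>

lemma resistance_pos: "a \<noteq> b \<Longrightarrow> 0 < resistance a b"
proof (rule ccontr)
  assume "a \<noteq> b" "\<not> 0 < resistance a b"
  then have 0: "dirichlet (green a b) (green a b) = 0"
    using resistance_nonneg by (simp add: resistance_def)
  then have "gradient G (green a b) e = 0" if "e \<in> arcs G" for e
    using gradient_square_le[OF that, of "green a b"] by simp
  then have "dirichlet (green a b) (\<lambda>v. if v = a then 1 else 0) = 0"
    by (simp add: dirichlet_def)
  with \<open>a \<noteq> b\<close> show False by (simp add: dirichlet_green)
qed

end

text \<open>Cauchy--Schwarz against the Green function of \<open>v\<close> and \<open>v0\<close>.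
  This pointwise control makes the Gaussian weight integrable.\<close>

lemma coercive:
  assumes "v \<in> verts G"
  shows "(u v - u v0)\<^sup>2 \<le> resistance v v0 * dirichlet u u"
proof -
  have "u v - u v0 = (\<Sum>e\<in>arcs G. gradient G (green v v0) e * gradient G u e)"
    using dirichlet_green[OF assms v0_in_verts, of u] by (simp add: dirichlet_def)
  then show ?thesis
    using Cauchy_Schwarz_ineq_sum[of "gradient G (green v v0)" "gradient G u" "arcs G"]
    by (simp add: resistance_def dirichlet_self)
qed

text \<open>
  \<open>W\<close> lies on the far side of the set on which \<open>g \<le> M\<close> is known: testing the equation of \<open>g\<close>
  with the positive part of \<open>g - M\<close> on \<open>W\<close> shows that this positive part has zero energy.
\<close>
lemma maximum_principle:
  assumes ab: "a \<in> verts G" "b \<in> verts G"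
    and weak: "\<And>u. dirichlet g u = u a - u b"
    and bdry: "\<And>e. e \<in> arcs G \<Longrightarrow> head G e \<in> W \<Longrightarrow> tail G e \<notin> W \<Longrightarrow> g (head G e) \<le> M"
      "\<And>e. e \<in> arcs G \<Longrightarrow> tail G e \<in> W \<Longrightarrow> head G e \<notin> W \<Longrightarrow> g (tail G e) \<le> M"
    and pole: "a \<in> W \<Longrightarrow> g a \<le> M" "b \<in> W \<Longrightarrow> g b \<le> M"
    and v: "v \<in> verts G" "v \<in> W"
  shows "g v \<le> M"
proof -
  define u where "u x = (if x \<in> W then max 0 (g x - M) else 0)" for x
  \<comment> \<open>Inside \<open>W\<close> this holds because the positive part is monotone and
    1-Lipschitz. On an edge leaving \<open>W\<close> the boundary hypothesis makes \<open>u\<close>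
    vanish at both ends.\<close>
  have ge: "(gradient G u e)\<^sup>2 \<le> gradient G g e * gradient G u e" if e: "e \<in> arcs G" for e
  proof -
    have *: "(max 0 s - max 0 t)\<^sup>2 \<le> (s - t) * (max 0 s - max 0 t)" for s t :: real
      by (cases "0 \<le> s"; cases "0 \<le> t")
        (auto simp: max_def power2_eq_square algebra_simps mult_nonneg_nonpos mult_nonneg_nonpos2)
    show ?thesis
      using *[of "g (head G e) - M" "g (tail G e) - M"] bdry(1)[OF e] bdry(2)[OF e]
      by (cases "head G e \<in> W"; cases "tail G e \<in> W") (auto simp: gradient_def u_def)
  qed
  have "dirichlet u u \<le> dirichlet g u"
    unfolding dirichlet_self dirichlet_def by (rule sum_mono) (rule ge)
  also have "\<dots> = 0" using pole by (auto simp: weak u_def)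
  finally have 0: "dirichlet u u = 0" using dirichlet_nonneg[of u] by simp
  have u0: "u x = u v0" if "x \<in> verts G" for x
    by (rule dirichlet_zero_imp_const[OF 0 that])
  \<comment> \<open>Zero energy makes \<open>u\<close> constant, and its value at the pole
    \<open>a\<close> is 0 whether or not \<open>a\<close> lies in \<open>W\<close>.\<close>
  have "u v = u a" using u0[OF v(1)] u0[OF ab(1)] by simp
  also have "u a = 0" using pole(1) by (auto simp: u_def)
  finally show ?thesis using v(2) by (auto simp: u_def max_def split: if_splits)
qed

end

section \<open>Characteristic function of the Gaussian free field\<close>

lemma distr_PiM_lborel_shift:
  fixes c :: "'i \<Rightarrow> real"
  assumes "finite I"
  shows "distr (PiM I (\<lambda>_. lborel)) (PiM I (\<lambda>_. lborel)) (\<lambda>x. \<lambda>i\<in>I. x i + c i) = PiM I (\<lambda>_. lborel)"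
    (is "distr ?P ?P ?T = _")
proof -
  interpret product_sigma_finite "\<lambda>_::'i. lborel :: real measure" ..
  show ?thesis
  proof (rule PiM_eqI[OF assms])
    fix A :: "'i \<Rightarrow> real set" assume A: "\<And>i. i \<in> I \<Longrightarrow> A i \<in> sets lborel"
    have T: "?T \<in> measurable ?P ?P" by measurable
    have pre: "?T -` Pi\<^sub>E I A \<inter> space ?P = Pi\<^sub>E I (\<lambda>i. (\<lambda>x. c i + x) -` A i)"
      by (auto simp: space_PiM PiE_iff add.commute)
    have eq: "emeasure lborel ((\<lambda>x. c i + x) -` A i) = emeasure lborel (A i)" if "i \<in> I" for i
    proof -
      have "emeasure (distr lborel borel ((+) (c i))) (A i) = emeasure lborel ((+) (c i) -` A i)"
        using A[OF that] by (subst emeasure_distr) auto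
      then show ?thesis by (simp add: lborel_distr_plus)
    qed
    have "emeasure (distr ?P ?P ?T) (Pi\<^sub>E I A) = emeasure ?P (Pi\<^sub>E I (\<lambda>i. (\<lambda>x. c i + x) -` A i))"
      using A assms by (subst emeasure_distr[OF T]) (auto simp: pre intro!: sets_PiM_I_finite)
    also have "\<dots> = (\<Prod>i\<in>I. emeasure lborel ((\<lambda>x. c i + x) -` A i))"
      using A assms by (intro emeasure_PiM) (auto intro!: measurable_sets_borel[of "(+) (c _)" borel])
    also have "\<dots> = (\<Prod>i\<in>I. emeasure lborel (A i))" using eq by (rule prod.cong[OF refl])
    finally show "emeasure (distr ?P ?P ?T) (Pi\<^sub>E I A) = (\<Prod>i\<in>I. emeasure lborel (A i))" .
  qed simp
qed

lemma nn_integral_lborel_affine: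
  fixes c t :: real
  assumes [measurable]: "h \<in> borel_measurable borel" and "c \<noteq> 0"
  shows "(\<integral>\<^sup>+s. h (t + c * s) \<partial>lborel) = ennreal (1 / \<bar>c\<bar>) * (\<integral>\<^sup>+x. h x \<partial>lborel)"
proof -
  have "ennreal (1 / \<bar>c\<bar>) * (\<integral>\<^sup>+x. h x \<partial>lborel)
      = (ennreal (1 / \<bar>c\<bar>) * ennreal \<bar>c\<bar>) * (\<integral>\<^sup>+s. h (t + c * s) \<partial>lborel)"
    by (subst nn_integral_real_affine[OF assms, of t]) (simp add: mult.assoc)
  then show ?thesis using assms(2) by (simp add: ennreal_mult''[symmetric])
qed

lemma nn_integral_pos_neq_0:
  fixes w :: "'a \<Rightarrow> real"
  assumes [measurable]: "w \<in> borel_measurable M" and "\<And>x. x \<in> space M \<Longrightarrow> 0 < w x"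
    and "emeasure M (space M) \<noteq> 0"
  shows "(\<integral>\<^sup>+x. ennreal (w x) \<partial>M) \<noteq> 0"
proof
  assume "(\<integral>\<^sup>+x. ennreal (w x) \<partial>M) = 0"
  then have "AE x in M. ennreal (w x) = 0" by (subst (asm) nn_integral_0_iff_AE) auto
  then have "AE x in M. False" using AE_space by eventually_elim (use assms(2) in force)
  with assms(3) show False by (simp add: AE_iff_measurable[OF sets.top])
qed

lemma nn_integral_gaussian_finite:
  fixes \<kappa> :: real
  assumes "0 < \<kappa>"
  shows "(\<integral>\<^sup>+x. ennreal (exp (- \<kappa> * x\<^sup>2)) \<partial>lborel) < \<infinity>"
proof -
  define \<sigma> where "\<sigma> = sqrt (1 / (2 * \<kappa>))"
  have \<sigma>: "0 < \<sigma>" using assms by (auto simp: \<sigma>_def)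
  have "\<sigma>\<^sup>2 = 1 / (2 * \<kappa>)" using assms by (simp add: \<sigma>_def)
  then have nd: "normal_density 0 \<sigma> x = 1 / sqrt (pi / \<kappa>) * exp (- \<kappa> * x\<^sup>2)" for x
    by (simp add: normal_density_def)
  have eq: "exp (- \<kappa> * x\<^sup>2) = sqrt (pi / \<kappa>) * normal_density 0 \<sigma> x" for x
    unfolding nd using assms by simp
  interpret prob_space "density lborel (normal_density 0 \<sigma>)" by (rule prob_space_normal_density[OF \<sigma>])
  have "(\<integral>\<^sup>+x. ennreal (normal_density 0 \<sigma> x) \<partial>lborel) = 1"
    using emeasure_space_1 by (simp add: emeasure_density)
  then have "(\<integral>\<^sup>+x. ennreal (sqrt (pi / \<kappa>)) * ennreal (normal_density 0 \<sigma> x) \<partial>lborel) = ennreal (sqrt (pi / \<kappa>))"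
    by (subst nn_integral_cmult) auto
  moreover have "ennreal (exp (- \<kappa> * x\<^sup>2)) = ennreal (sqrt (pi / \<kappa>)) * ennreal (normal_density 0 \<sigma> x)" for x
    by (subst eq) (simp add: ennreal_mult' assms less_imp_le)
  ultimately have "(\<integral>\<^sup>+x. ennreal (exp (- \<kappa> * x\<^sup>2)) \<partial>lborel) = ennreal (sqrt (pi / \<kappa>))"
    by simp
  then show ?thesis by simp
qed

lemma char_normal_density:
  assumes "0 < \<sigma>"
  shows "(\<integral>x. exp (\<i> * complex_of_real x) \<partial>density lborel (normal_density 0 \<sigma>))
    = complex_of_real (exp (- \<sigma>\<^sup>2 / 2))"
proof -
  have "(\<integral>x. exp (\<i> * complex_of_real x) \<partial>density lborel (normal_density 0 \<sigma>))
      = (\<integral>x. normal_density 0 \<sigma> x *\<^sub>R exp (\<i> * complex_of_real x) \<partial>lborel)"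
    by (subst integral_density) (auto simp: less_imp_le)
  also have "\<dots> = \<sigma> *\<^sub>R (\<integral>x. normal_density 0 \<sigma> (0 + \<sigma> * x) *\<^sub>R exp (\<i> * complex_of_real (0 + \<sigma> * x)) \<partial>lborel)"
    using lborel_integral_real_affine[of \<sigma> "\<lambda>x. normal_density 0 \<sigma> x *\<^sub>R exp (\<i> * complex_of_real x)" 0] assms
    by simp
  also have "\<dots> = (\<integral>x. \<sigma> *\<^sub>R (normal_density 0 \<sigma> (0 + \<sigma> * x) *\<^sub>R exp (\<i> * complex_of_real (0 + \<sigma> * x))) \<partial>lborel)"
    by (rule integral_scaleR_right[symmetric])
  also have "\<dots> = (\<integral>x. std_normal_density x *\<^sub>R iexp (\<sigma> * x) \<partial>lborel)"
    using assms
    by (intro Bochner_Integration.integral_cong) (auto simp: normal_density_def real_sqrt_mult field_simps)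
  also have "\<dots> = char std_normal_distribution \<sigma>"
    unfolding char_def by (subst integral_density) (auto simp: less_imp_le)
  also have "\<dots> = complex_of_real (exp (- \<sigma>\<^sup>2 / 2))"
    by (simp add: char_std_normal_distribution)
  finally show ?thesis .
qed

lemma sets_normalized_density: "sets (normalized_density M w) = sets M"
  by (simp add: normalized_density_def)

lemma nn_integral_normalized_density:
  assumes [measurable]: "w \<in> borel_measurable M" "h \<in> borel_measurable M"
  shows "(\<integral>\<^sup>+x. h x \<partial>normalized_density M w) = (\<integral>\<^sup>+x. h x * ennreal (w x) \<partial>M) / (\<integral>\<^sup>+x. ennreal (w x) \<partial>M)"
proof -
  have "(\<integral>\<^sup>+x. h x \<partial>normalized_density M w)
      = (\<integral>\<^sup>+x. (h x * ennreal (w x)) / (\<integral>\<^sup>+y. ennreal (w y) \<partial>M) \<partial>M)"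
    unfolding normalized_density_def
    by (subst nn_integral_density) (auto simp: ennreal_divide_times mult.commute[of "h _"] ennreal_times_divide)
  also have "\<dots> = (\<integral>\<^sup>+x. h x * ennreal (w x) \<partial>M) / (\<integral>\<^sup>+x. ennreal (w x) \<partial>M)"
    by (rule nn_integral_divide) measurable
  finally show ?thesis .
qed

lemma (in fin_digraph) borel_measurable_gradient:
  "e \<in> arcs G \<Longrightarrow> (\<lambda>\<theta>. gradient G \<theta> e) \<in> borel_measurable (PiM (verts G) (\<lambda>_. borel))"
  unfolding gradient_def
  by (intro borel_measurable_diff measurable_component_singleton) auto

section \<open>The Gaussian free field on a pinned network\<close>

context pinned_network
begin

abbreviation free_verts :: "'v set" where "free_verts \<equiv> verts G - {v0}"

lemma dirichlet_measurable [measurable]: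
  "(\<lambda>\<phi>. dirichlet \<phi> \<phi>) \<in> borel_measurable (PiM (verts G) (\<lambda>_. borel))"
  unfolding dirichlet_def by (intro borel_measurable_sum borel_measurable_times borel_measurable_gradient)

lemma pin_measurable:
  assumes "(\<lambda>x. x) \<in> measurable \<nu> borel"
  shows "(\<lambda>\<theta>. \<theta>(v0 := 0)) \<in> measurable (PiM free_verts (\<lambda>_. \<nu>)) (PiM (verts G) (\<lambda>_. borel))"
proof (rule measurable_PiM_single')
  fix i assume i: "i \<in> verts G"
  show "(\<lambda>\<theta>. (\<theta>(v0 := 0)) i) \<in> borel_measurable (PiM free_verts (\<lambda>_. \<nu>))"
  proof (cases "i = v0")
    case False
    with i have "(\<lambda>\<theta>. \<theta> i) \<in> measurable (PiM free_verts (\<lambda>_. \<nu>)) \<nu>"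
      by (intro measurable_component_singleton) simp
    from measurable_compose[OF this assms] False show ?thesis by simp
  qed simp
qed (use v0_in_verts in \<open>auto simp: space_PiM PiE_iff extensional_def\<close>)

abbreviation flat :: "('v \<Rightarrow> real) measure" where
  "flat \<equiv> PiM free_verts (\<lambda>_. lborel)"

definition gff_weight :: "real \<Rightarrow> ('v \<Rightarrow> real) \<Rightarrow> real" where
  "gff_weight \<beta> \<theta> = exp (- \<beta> / 2 * dirichlet (\<theta>(v0 := 0)) (\<theta>(v0 := 0)))"

lemma pin_flat [measurable]:
  "(\<lambda>\<theta>. \<theta>(v0 := 0)) \<in> measurable flat (PiM (verts G) (\<lambda>_. borel))"
  by (rule pin_measurable) simp

lemma gff_weight_measurable [measurable]: "gff_weight \<beta> \<in> borel_measurable flat"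
proof -
  have "(\<lambda>\<theta>. dirichlet (\<theta>(v0 := 0)) (\<theta>(v0 := 0))) \<in> borel_measurable flat"
    by (rule measurable_compose[OF pin_flat dirichlet_measurable])
  then show ?thesis unfolding gff_weight_def by measurable
qed

lemma component_measurable [measurable]:
  "v \<in> verts G \<Longrightarrow> (\<lambda>\<theta>. (\<theta>(v0 := 0)) v) \<in> borel_measurable flat"
  by (rule measurable_compose[OF pin_flat measurable_component_singleton])

lemma nn_integral_flat_shift:
  assumes "h \<in> borel_measurable flat"
  shows "(\<integral>\<^sup>+\<theta>. h (\<lambda>v\<in>free_verts. \<theta> v + c v) \<partial>flat) = (\<integral>\<^sup>+\<theta>. h \<theta> \<partial>flat)"
proof -
  have T: "(\<lambda>x. \<lambda>i\<in>free_verts. x i + c i) \<in> measurable flat flat" by measurable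
  show ?thesis
    using nn_integral_distr[OF T, of h] assms distr_PiM_lborel_shift[of free_verts c] by simp
qed

definition height :: "'v \<Rightarrow> 'v \<Rightarrow> ('v \<Rightarrow> real) \<Rightarrow> real" where
  "height a b \<theta> = (\<theta>(v0 := 0)) a - (\<theta>(v0 := 0)) b"

lemma gff_weight_pos: "0 < gff_weight \<beta> \<theta>"
  by (simp add: gff_weight_def)

text \<open>Cameron--Martin: by the Poisson equation the cross term of the quadratic form is the
  height difference, so the weight changes by a factor that depends on \<theta> only through
  \<open>height a b \<theta>\<close>.\<close>

lemma gff_weight_shift:
  assumes "a \<in> verts G" "b \<in> verts G"
  defines "f \<equiv> green a b"
  shows "gff_weight \<beta> (\<lambda>v\<in>free_verts. \<theta> v + s * f v)
    = gff_weight \<beta> \<theta> * exp (- \<beta> * s * height a b \<theta> - \<beta> / 2 * s\<^sup>2 * resistance a b)"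
proof -
  define \<eta> where "\<eta> = \<theta>(v0 := 0)"
  define \<zeta> where "\<zeta> = (\<lambda>v\<in>free_verts. \<theta> v + s * f v)(v0 := 0)"
  let ?u = "\<lambda>v. \<eta> v + s * f v"
  have f0: "f v0 = 0" unfolding f_def by (rule green_pinned[OF assms(1,2)])
  have "dirichlet \<zeta> \<zeta> = dirichlet ?u ?u"
    by (rule dirichlet_cong) (auto simp: f0 \<zeta>_def \<eta>_def)
  also have "\<dots> = dirichlet ?u \<eta> + s * dirichlet ?u f" by (rule dirichlet_add)
  also have "dirichlet ?u \<eta> = dirichlet \<eta> \<eta> + s * dirichlet f \<eta>"
    by (subst dirichlet_commute) (simp add: dirichlet_add dirichlet_commute)
  also have "dirichlet ?u f = dirichlet f \<eta> + s * dirichlet f f"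
    by (subst dirichlet_commute) (rule dirichlet_add)
  also have "dirichlet f \<eta> = \<eta> a - \<eta> b" unfolding f_def by (rule dirichlet_green[OF assms(1,2)])
  also have "dirichlet f f = resistance a b" by (simp add: f_def resistance_def)
  finally have *: "dirichlet \<zeta> \<zeta> = dirichlet \<eta> \<eta> + 2 * s * (\<eta> a - \<eta> b) + s\<^sup>2 * resistance a b"
    by (simp add: algebra_simps power2_eq_square)
  show ?thesis
    unfolding gff_weight_def height_def \<zeta>_def[symmetric] \<eta>_def[symmetric] * exp_add[symmetric]
    by (simp add: algebra_simps)
qed

text \<open>Summing \<open>coercive\<close> over all free vertices dominates the weight by a product
  of one-dimensional Gaussians.\<close>

lemma gff_partition_finite:
  assumes "0 < \<beta>"
  shows "(\<integral>\<^sup>+\<theta>. ennreal (gff_weight \<beta> \<theta>) \<partial>flat) < \<infinity>"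
proof -
  interpret product_sigma_finite "\<lambda>_::'v. lborel :: real measure" ..
  \<comment> \<open>The summand 1 keeps \<open>C\<close> positive when \<open>v0\<close> is the only
    vertex.\<close>
  define C where "C = (\<Sum>v\<in>free_verts. resistance v v0) + 1"
  have R: "0 \<le> (\<Sum>v\<in>free_verts. resistance v v0)"
    by (intro sum_nonneg resistance_nonneg) (auto simp: v0_in_verts)
  then have C: "0 < C" by (simp add: C_def)
  define \<kappa> where "\<kappa> = \<beta> / (2 * C)"
  have \<kappa>: "0 < \<kappa>" using assms C by (simp add: \<kappa>_def)
  have le: "gff_weight \<beta> \<theta> \<le> (\<Prod>v\<in>free_verts. exp (- \<kappa> * (\<theta> v)\<^sup>2))" for \<theta>
  proof -
    let ?D = "dirichlet (\<theta>(v0 := 0)) (\<theta>(v0 := 0))"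
    have "(\<Sum>v\<in>free_verts. (\<theta> v)\<^sup>2) \<le> (\<Sum>v\<in>free_verts. resistance v v0 * ?D)"
    proof (rule sum_mono)
      fix v assume v: "v \<in> free_verts"
      then have "((\<theta>(v0 := 0)) v - (\<theta>(v0 := 0)) v0)\<^sup>2 \<le> resistance v v0 * ?D"
        by (intro coercive) auto
      with v show "(\<theta> v)\<^sup>2 \<le> resistance v v0 * ?D" by simp
    qed
    also have "\<dots> \<le> C * ?D"
      using dirichlet_nonneg[of "\<theta>(v0 := 0)"] by (simp add: sum_distrib_right[symmetric] C_def algebra_simps)
    finally have "\<kappa> * (\<Sum>v\<in>free_verts. (\<theta> v)\<^sup>2) \<le> \<kappa> * (C * ?D)"
      using \<kappa> by (intro mult_left_mono) auto
    also have "\<dots> = \<beta> / 2 * ?D" using C by (simp add: \<kappa>_def)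
    finally show ?thesis
      by (simp add: gff_weight_def exp_sum[symmetric] sum_negf sum_distrib_left)
  qed
  have "(\<integral>\<^sup>+\<theta>. ennreal (gff_weight \<beta> \<theta>) \<partial>flat)
      \<le> (\<integral>\<^sup>+\<theta>. (\<Prod>v\<in>free_verts. ennreal (exp (- \<kappa> * (\<theta> v)\<^sup>2))) \<partial>flat)"
  proof (rule nn_integral_mono)
    fix \<theta>
    show "ennreal (gff_weight \<beta> \<theta>) \<le> (\<Prod>v\<in>free_verts. ennreal (exp (- \<kappa> * (\<theta> v)\<^sup>2)))"
      using ennreal_leI[OF le[of \<theta>]] by (simp add: prod_ennreal)
  qed
  also have "\<dots> = (\<Prod>v\<in>free_verts. \<integral>\<^sup>+x. ennreal (exp (- \<kappa> * x\<^sup>2)) \<partial>lborel)"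
    by (rule product_nn_integral_prod) auto
  also have "\<dots> < \<infinity>"
    using nn_integral_gaussian_finite[OF \<kappa>] by (simp add: power_less_top_ennreal)
  finally show ?thesis .
qed

lemma gff_partition_pos: "(\<integral>\<^sup>+\<theta>. ennreal (gff_weight \<beta> \<theta>) \<partial>flat) \<noteq> 0"
proof (rule nn_integral_pos_neq_0)
  interpret product_sigma_finite "\<lambda>_::'v. lborel :: real measure" ..
  have "emeasure flat (space flat) = (\<Prod>v\<in>free_verts. emeasure lborel (UNIV :: real set))"
    using emeasure_PiM[of free_verts "\<lambda>_. UNIV"] by (simp add: space_PiM)
  then show "emeasure flat (space flat) \<noteq> 0" by simp
qed (auto simp: gff_weight_def gff_weight_measurable[unfolded gff_weight_def])



lemma height_measurable:
  "a \<in> verts G \<Longrightarrow> b \<in> verts G \<Longrightarrow> height a b \<in> borel_measurable flat"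
  unfolding height_def by (intro borel_measurable_diff component_measurable)

text \<open>
  Averaging over the shifts \<open>\<theta> \<mapsto> \<theta> + s f\<close> along the Green function \<open>f\<close> disintegrates the Gaussian
  weight with respect to \<open>\<theta> a - \<theta> b\<close>: the weight along each orbit is a one-dimensional Gaussian, and
  the factor \<open>c\<close> selects orbit points with total mass one.
\<close>
lemma gff_disintegration:
  assumes ab: "a \<in> verts G" "b \<in> verts G" "a \<noteq> b"
  defines "E \<equiv> resistance a b"
  obtains D where "\<And>h. h \<in> borel_measurable borel \<Longrightarrow>
    (\<integral>\<^sup>+\<theta>. h (height a b \<theta>) * ennreal (gff_weight \<beta> \<theta>) \<partial>flat) =
    D * (\<integral>\<^sup>+y. h y * ennreal (exp (- \<beta> / (2 * E) * y\<^sup>2)) \<partial>lborel)"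
proof
  have E: "0 < E" unfolding E_def by (rule resistance_pos[OF ab])
  let ?X = "height a b"
  \<comment> \<open>A unit step in \<open>s\<close> raises the height by \<open>E\<close>; the total
    mass \<open>E\<close> of \<open>c\<close> compensates the Jacobian \<open>1 / E\<close>.\<close>
  define c :: "real \<Rightarrow> ennreal" where "c x = ennreal E * indicator {0..<1} x" for x
  have [measurable]: "c \<in> borel_measurable borel" unfolding c_def by measurable
  note [measurable] = height_measurable[OF ab(1,2)]
  interpret product_sigma_finite "\<lambda>_::'v. lborel :: real measure" ..
  interpret flat: finite_product_sigma_finite "\<lambda>_::'v. lborel :: real measure" free_verts by standard simp
  interpret pair_sigma_finite flat "lborel :: real measure" ..
  let ?D = "\<integral>\<^sup>+\<theta>. c (?X \<theta>) * ennreal (gff_weight \<beta> \<theta> * exp (\<beta> / (2 * E) * (?X \<theta>)\<^sup>2)) * ennreal (1 / E) \<partial>flat"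
  fix h :: "real \<Rightarrow> ennreal" assume [measurable]: "h \<in> borel_measurable borel"
  have c1: "(\<integral>\<^sup>+s. c (x - s * E) \<partial>lborel) = 1" for x
  proof -
    have "(\<integral>\<^sup>+s. c (x + (- E) * s) \<partial>lborel) = ennreal (1 / E) * (\<integral>\<^sup>+x. c x \<partial>lborel)"
      using nn_integral_lborel_affine[of c "- E" x] E by simp
    also have "(\<integral>\<^sup>+x. c x \<partial>lborel) = ennreal E"
      unfolding c_def by (subst nn_integral_cmult_indicator) auto
    finally show ?thesis using E by (simp add: ennreal_mult''[symmetric] mult.commute)
  qed
  have Xs: "?X (\<lambda>v\<in>free_verts. \<theta> v + s * green a b v) = ?X \<theta> + s * E" for \<theta> s
  proof -
    have "?X (\<lambda>v\<in>free_verts. \<theta> v + s * green a b v) = ?X \<theta> + s * (green a b a - green a b b)"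
      using ab(1,2) green_pinned[OF ab(1,2)] by (auto simp: height_def algebra_simps)
    then show ?thesis by (simp add: E_def resistance_eq[OF ab(1,2)])
  qed
  \<comment> \<open>Completing the square in \<open>s\<close>: along an orbit the weight is a
    Gaussian in the shifted height, and the other factors depend on the base point alone.\<close>
  have w: "gff_weight \<beta> (\<lambda>v\<in>free_verts. \<theta> v + s * green a b v)
      = gff_weight \<beta> \<theta> * exp (\<beta> / (2 * E) * (?X \<theta>)\<^sup>2) * exp (- \<beta> / (2 * E) * (?X \<theta> + s * E)\<^sup>2)" for \<theta> s
  proof -
    have "- \<beta> * s * ?X \<theta> - \<beta> / 2 * s\<^sup>2 * E
        = \<beta> / (2 * E) * (?X \<theta>)\<^sup>2 + - \<beta> / (2 * E) * (?X \<theta> + s * E)\<^sup>2"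
      using E by (simp add: field_simps power2_eq_square)
    then show ?thesis
      using gff_weight_shift[OF ab(1,2), of \<beta> \<theta> s]
      by (simp only: E_def[symmetric] exp_add mult.assoc)
  qed
  have "(\<integral>\<^sup>+\<theta>. h (?X \<theta>) * ennreal (gff_weight \<beta> \<theta>) \<partial>flat)
      = (\<integral>\<^sup>+\<theta>. \<integral>\<^sup>+s. h (?X \<theta>) * ennreal (gff_weight \<beta> \<theta>) * c (?X \<theta> - s * E) \<partial>lborel \<partial>flat)"
    by (subst nn_integral_cmult) (auto simp: c1)
  also have "\<dots> = (\<integral>\<^sup>+s. \<integral>\<^sup>+\<theta>. h (?X \<theta>) * ennreal (gff_weight \<beta> \<theta>) * c (?X \<theta> - s * E) \<partial>flat \<partial>lborel)"
    by (subst Fubini') auto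
  also have "\<dots> = (\<integral>\<^sup>+s. \<integral>\<^sup>+\<theta>. (c (?X \<theta>) * ennreal (gff_weight \<beta> \<theta> * exp (\<beta> / (2 * E) * (?X \<theta>)\<^sup>2)))
      * (h (?X \<theta> + s * E) * ennreal (exp (- \<beta> / (2 * E) * (?X \<theta> + s * E)\<^sup>2))) \<partial>flat \<partial>lborel)"
  \<comment> \<open>For fixed \<open>s\<close>, translation invariance moves the dependence on
    \<open>s\<close> from \<open>c\<close> to \<open>h\<close> and the Gaussian factor, so that the
    integral over \<open>s\<close> can be carried out next.\<close>
  proof (rule nn_integral_cong)
    fix s :: real
    have "(\<integral>\<^sup>+\<theta>. h (?X \<theta>) * ennreal (gff_weight \<beta> \<theta>) * c (?X \<theta> - s * E) \<partial>flat)
      = (\<integral>\<^sup>+\<theta>. (\<lambda>\<theta>. h (?X \<theta>) * ennreal (gff_weight \<beta> \<theta>) * c (?X \<theta> - s * E))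
          (\<lambda>v\<in>free_verts. \<theta> v + s * green a b v) \<partial>flat)"
      by (rule nn_integral_flat_shift[symmetric]) measurable
    then show "(\<integral>\<^sup>+\<theta>. h (?X \<theta>) * ennreal (gff_weight \<beta> \<theta>) * c (?X \<theta> - s * E) \<partial>flat)
      = (\<integral>\<^sup>+\<theta>. (c (?X \<theta>) * ennreal (gff_weight \<beta> \<theta> * exp (\<beta> / (2 * E) * (?X \<theta>)\<^sup>2)))
      * (h (?X \<theta> + s * E) * ennreal (exp (- \<beta> / (2 * E) * (?X \<theta> + s * E)\<^sup>2))) \<partial>flat)"
      by (simp only: Xs w ennreal_mult' less_imp_le[OF gff_weight_pos] exp_ge_zero mult_nonneg_nonneg add_diff_cancel_right' mult_ac)
  qed
  also have "\<dots> = (\<integral>\<^sup>+\<theta>. \<integral>\<^sup>+s. (c (?X \<theta>) * ennreal (gff_weight \<beta> \<theta> * exp (\<beta> / (2 * E) * (?X \<theta>)\<^sup>2)))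
      * (h (?X \<theta> + s * E) * ennreal (exp (- \<beta> / (2 * E) * (?X \<theta> + s * E)\<^sup>2))) \<partial>lborel \<partial>flat)"
    by (subst Fubini') auto
  also have "\<dots> = (\<integral>\<^sup>+\<theta>. (c (?X \<theta>) * ennreal (gff_weight \<beta> \<theta> * exp (\<beta> / (2 * E) * (?X \<theta>)\<^sup>2)) * ennreal (1 / E))
      * (\<integral>\<^sup>+y. h y * ennreal (exp (- \<beta> / (2 * E) * y\<^sup>2)) \<partial>lborel) \<partial>flat)"
  proof (rule nn_integral_cong)
    fix \<theta>
    have "(\<integral>\<^sup>+s. h (?X \<theta> + s * E) * ennreal (exp (- \<beta> / (2 * E) * (?X \<theta> + s * E)\<^sup>2)) \<partial>lborel)
      = ennreal (1 / E) * (\<integral>\<^sup>+y. h y * ennreal (exp (- \<beta> / (2 * E) * y\<^sup>2)) \<partial>lborel)"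
      using nn_integral_lborel_affine[of "\<lambda>y. h y * ennreal (exp (- \<beta> / (2 * E) * y\<^sup>2))" E "?X \<theta>"] E
      by (simp add: mult.commute[of E])
    then show "(\<integral>\<^sup>+s. (c (?X \<theta>) * ennreal (gff_weight \<beta> \<theta> * exp (\<beta> / (2 * E) * (?X \<theta>)\<^sup>2)))
      * (h (?X \<theta> + s * E) * ennreal (exp (- \<beta> / (2 * E) * (?X \<theta> + s * E)\<^sup>2))) \<partial>lborel)
      = (c (?X \<theta>) * ennreal (gff_weight \<beta> \<theta> * exp (\<beta> / (2 * E) * (?X \<theta>)\<^sup>2)) * ennreal (1 / E))
      * (\<integral>\<^sup>+y. h y * ennreal (exp (- \<beta> / (2 * E) * y\<^sup>2)) \<partial>lborel)"
      by (subst nn_integral_cmult) (auto simp: mult.assoc)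
  qed
  also have "\<dots> = ?D * (\<integral>\<^sup>+y. h y * ennreal (exp (- \<beta> / (2 * E) * y\<^sup>2)) \<partial>lborel)"
    by (rule nn_integral_multc) measurable
  finally show "(\<integral>\<^sup>+\<theta>. h (?X \<theta>) * ennreal (gff_weight \<beta> \<theta>) \<partial>flat) =
    ?D * (\<integral>\<^sup>+y. h y * ennreal (exp (- \<beta> / (2 * E) * y\<^sup>2)) \<partial>lborel)" .
qed

lemma gff_law_eq: "gff_law G v0 \<beta> = normalized_density (distr flat (PiM (verts G) (\<lambda>_. borel)) (\<lambda>\<theta>. \<theta>(v0 := 0)))
    (\<lambda>\<phi>. exp (- \<beta> / 2 * dirichlet \<phi> \<phi>))"
  by (simp add: gff_law_def pinned_product_def dirichlet_self)

text \<open>The factor \<open>D\<close> of the disintegration is the same for an indicator and for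
  the constant 1, hence cancels against the partition function. The case \<open>a = b\<close> is a
  point mass and has no density.\<close>

lemma distr_gff_law_difference:
  assumes ab: "a \<in> verts G" "b \<in> verts G" "a \<noteq> b" and \<beta>: "0 < \<beta>"
  shows "distr (gff_law G v0 \<beta>) borel (\<lambda>\<phi>. \<phi> a - \<phi> b)
    = density lborel (normal_density 0 (sqrt (resistance a b / \<beta>)))"
proof (rule measure_eqI)
  define E where "E = resistance a b"
  have E: "0 < E" unfolding E_def by (rule resistance_pos[OF ab])
  define \<sigma> where "\<sigma> = sqrt (E / \<beta>)"
  have \<sigma>: "0 < \<sigma>" "\<sigma>\<^sup>2 = E / \<beta>" using E \<beta> by (auto simp: \<sigma>_def)
  let ?k = "sqrt (2 * pi * \<sigma>\<^sup>2)"
  have k: "0 < ?k" using \<sigma> E \<beta> by simp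
  have nd: "exp (- \<beta> / (2 * E) * y\<^sup>2) = ?k * normal_density 0 \<sigma> y" for y
    using k \<sigma> E \<beta> by (auto simp: normal_density_def field_simps)
  interpret N: prob_space "density lborel (normal_density 0 \<sigma>)" by (rule prob_space_normal_density[OF \<sigma>(1)])
  have N1: "(\<integral>\<^sup>+x. ennreal (normal_density 0 \<sigma> x) \<partial>lborel) = 1"
    using N.emeasure_space_1 by (simp add: emeasure_density)
  have H: "(\<integral>\<^sup>+y. h y * ennreal (exp (- \<beta> / (2 * E) * y\<^sup>2)) \<partial>lborel)
      = ennreal ?k * (\<integral>\<^sup>+y. h y * ennreal (normal_density 0 \<sigma> y) \<partial>lborel)"
    if [measurable]: "h \<in> borel_measurable borel" for h
    unfolding nd using k
    by (subst nn_integral_cmult[symmetric])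
      (auto simp: ennreal_mult' less_imp_le mult_ac intro!: nn_integral_cong)
  obtain D where D: "\<And>h. h \<in> borel_measurable borel \<Longrightarrow>
    (\<integral>\<^sup>+\<theta>. h (height a b \<theta>) * ennreal (gff_weight \<beta> \<theta>) \<partial>flat) =
    D * (\<integral>\<^sup>+y. h y * ennreal (exp (- \<beta> / (2 * E) * y\<^sup>2)) \<partial>lborel)"
    using gff_disintegration[OF ab, of \<beta>] unfolding E_def by blast
  let ?Z = "\<integral>\<^sup>+\<theta>. ennreal (gff_weight \<beta> \<theta>) \<partial>flat"
  have Z: "?Z = D * ennreal ?k"
    using D[of "\<lambda>_. 1"] H[of "\<lambda>_. 1"] N1 by simp
  note [measurable] = gff_weight_measurable
  have meas_diff [measurable]: "(\<lambda>\<phi>. \<phi> a - \<phi> b :: real) \<in> borel_measurable (PiM (verts G) (\<lambda>_. borel))"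
    using ab by (intro borel_measurable_diff measurable_component_singleton) auto
  have meas_diff': "(\<lambda>\<phi>. \<phi> a - \<phi> b) \<in> borel_measurable (gff_law G v0 \<beta>)"
    using meas_diff by (simp add: gff_law_eq measurable_cong_sets[OF sets_normalized_density refl])
  fix A assume "A \<in> sets (distr (gff_law G v0 \<beta>) borel (\<lambda>\<phi>. \<phi> a - \<phi> b))"
  then have [measurable]: "A \<in> sets borel" by simp
  have "emeasure (distr (gff_law G v0 \<beta>) borel (\<lambda>\<phi>. \<phi> a - \<phi> b)) A
      = (\<integral>\<^sup>+\<phi>. indicator A (\<phi> a - \<phi> b) \<partial>gff_law G v0 \<beta>)"
    using nn_integral_distr[OF meas_diff', of "indicator A"] by simp
  also have "\<dots> = (\<integral>\<^sup>+\<theta>. indicator A (height a b \<theta>) * ennreal (gff_weight \<beta> \<theta>) \<partial>flat) / ?Z"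
    unfolding gff_law_eq
    by (subst nn_integral_normalized_density)
      (simp_all add: nn_integral_distr[OF pin_flat] height_def gff_weight_def del: fun_upd_apply)
  also have "\<dots> = (D * ennreal ?k) * (\<integral>\<^sup>+y. indicator A y * ennreal (normal_density 0 \<sigma> y) \<partial>lborel) / ?Z"
    by (subst D, simp, subst H) (simp_all add: mult.assoc)
  also have "\<dots> = (\<integral>\<^sup>+y. indicator A y * ennreal (normal_density 0 \<sigma> y) \<partial>lborel)"
    unfolding Z[symmetric]
    using gff_partition_finite[OF \<beta>] gff_partition_pos[of \<beta>]
    by (simp add: ennreal_mult_divide_eq mult.commute[of ?Z] less_top)
  also have "\<dots> = emeasure (density lborel (normal_density 0 \<sigma>)) A"
    by (simp add: emeasure_density mult.commute)
  finally show "emeasure (distr (gff_law G v0 \<beta>) borel (\<lambda>\<phi>. \<phi> a - \<phi> b)) A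
    = emeasure (density lborel (normal_density 0 (sqrt (resistance a b / \<beta>)))) A"
    by (simp add: \<sigma>_def E_def)
qed simp

lemma prob_space_gff_law:
  assumes "0 < \<beta>"
  shows "prob_space (gff_law G v0 \<beta>)"
  unfolding gff_law_eq
proof (rule prob_space_normalized_density)
  have *: "(\<integral>\<^sup>+\<phi>. ennreal (exp (- \<beta> / 2 * dirichlet \<phi> \<phi>)) \<partial>distr flat (PiM (verts G) (\<lambda>_. borel)) (\<lambda>\<theta>. \<theta>(v0 := 0)))
    = (\<integral>\<^sup>+\<theta>. ennreal (gff_weight \<beta> \<theta>) \<partial>flat)"
    by (subst nn_integral_distr[OF pin_flat]) (simp_all add: gff_weight_def)
  show "(\<integral>\<^sup>+\<phi>. ennreal (exp (- \<beta> / 2 * dirichlet \<phi> \<phi>)) \<partial>distr flat (PiM (verts G) (\<lambda>_. borel)) (\<lambda>\<theta>. \<theta>(v0 := 0))) \<noteq> 0"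
    unfolding * by (rule gff_partition_pos)
  show "(\<integral>\<^sup>+\<phi>. ennreal (exp (- \<beta> / 2 * dirichlet \<phi> \<phi>)) \<partial>distr flat (PiM (verts G) (\<lambda>_. borel)) (\<lambda>\<theta>. \<theta>(v0 := 0))) \<noteq> \<infinity>"
    unfolding * using gff_partition_finite[OF assms] by simp
qed simp

lemma gff_characteristic:
  assumes ab: "a \<in> verts G" "b \<in> verts G" and \<beta>: "0 < \<beta>"
  shows "prob_space.expectation (gff_law G v0 \<beta>) (\<lambda>\<phi>. exp (\<i> * complex_of_real (\<phi> a - \<phi> b)))
    = complex_of_real (exp (- resistance a b / (2 * \<beta>)))"
proof (cases "a = b")
  case True
  interpret prob_space "gff_law G v0 \<beta>" by (rule prob_space_gff_law[OF \<beta>])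
  from True show ?thesis using ab prob_space by (simp add: resistance_eq)
next
  case False
  let ?\<sigma> = "sqrt (resistance a b / \<beta>)"
  have "0 < resistance a b" by (rule resistance_pos[OF ab False])
  then have \<sigma>: "0 < ?\<sigma>" "?\<sigma>\<^sup>2 = resistance a b / \<beta>" using \<beta> by auto
  have m: "(\<lambda>\<phi>. \<phi> a - \<phi> b) \<in> borel_measurable (gff_law G v0 \<beta>)"
    using ab by (simp add: gff_law_eq measurable_cong_sets[OF sets_normalized_density refl]
      borel_measurable_diff measurable_component_singleton)
  have "prob_space.expectation (gff_law G v0 \<beta>) (\<lambda>\<phi>. exp (\<i> * complex_of_real (\<phi> a - \<phi> b)))
    = (\<integral>x. exp (\<i> * complex_of_real x) \<partial>distr (gff_law G v0 \<beta>) borel (\<lambda>\<phi>. \<phi> a - \<phi> b))"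
    by (subst integral_distr[OF m]) auto
  also have "\<dots> = complex_of_real (exp (- ?\<sigma>\<^sup>2 / 2))"
    unfolding distr_gff_law_difference[OF ab False \<beta>] by (rule char_normal_density[OF \<sigma>(1)])
  finally show ?thesis unfolding \<sigma>(2) by (simp add: mult.commute)
qed

end

section \<open>The integer-valued Gaussian\<close>

lemma has_sum_geometric_atLeast:
  fixes r :: real
  assumes "0 \<le> r" "r < 1"
  shows "((\<lambda>k::int. r ^ nat \<bar>k\<bar>) has_sum (r ^ m / (1 - r))) {int m..}"
    and "((\<lambda>k::int. r ^ nat \<bar>k\<bar>) has_sum (r ^ m / (1 - r))) {..- int m}"
proof -
  have "(\<lambda>n. r ^ m * r ^ n) sums (r ^ m * (1 / (1 - r)))"
    using assms by (intro sums_mult geometric_sums) auto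
  then have *: "((\<lambda>n. r ^ (n + m)) has_sum (r ^ m / (1 - r))) UNIV"
    using assms by (intro sums_nonneg_imp_has_sum) (auto simp: power_add mult.commute)
  have "(\<lambda>n. int (n + m)) ` UNIV = {int m..}" "(\<lambda>n. - int (n + m)) ` UNIV = {..- int m}"
    by (auto simp: image_iff) presburger+
  then show "((\<lambda>k::int. r ^ nat \<bar>k\<bar>) has_sum (r ^ m / (1 - r))) {int m..}"
    "((\<lambda>k::int. r ^ nat \<bar>k\<bar>) has_sum (r ^ m / (1 - r))) {..- int m}"
    using has_sum_reindex[of "\<lambda>n. int (n + m)" UNIV "\<lambda>k. r ^ nat \<bar>k\<bar>" "r ^ m / (1 - r)"]
      has_sum_reindex[of "\<lambda>n. - int (n + m)" UNIV "\<lambda>k. r ^ nat \<bar>k\<bar>" "r ^ m / (1 - r)"] *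
    by (simp_all add: inj_on_def o_def nat_add_distrib add.commute)
qed

lemma has_sum_geometric_tail:
  fixes r :: real
  assumes "0 \<le> r" "r < 1" "0 < m"
  shows "((\<lambda>k::int. r ^ nat \<bar>k\<bar>) has_sum (2 * r ^ m / (1 - r))) {k. int m \<le> \<bar>k\<bar>}"
proof -
  have "{k. int m \<le> \<bar>k\<bar>} = {int m..} \<union> {..- int m}" by auto
  with has_sum_Un_disjoint[OF has_sum_geometric_atLeast(1)[OF assms(1,2), of m]
      has_sum_geometric_atLeast(2)[OF assms(1,2), of m]] assms(3)
  show ?thesis by (auto simp: disjoint_iff add_divide_distrib[symmetric])
qed

lemma summable_geometric_int:
  fixes r :: real
  assumes "0 \<le> r" "r < 1"
  shows "(\<lambda>k::int. r ^ nat \<bar>k\<bar>) summable_on UNIV"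
proof -
  have "UNIV = {int 0..} \<union> {..- int 0}" by auto
  then show ?thesis
    using summable_on_union[OF has_sum_imp_summable has_sum_imp_summable] has_sum_geometric_atLeast[OF assms]
    by metis
qed

definition gauss :: "real \<Rightarrow> real \<Rightarrow> int \<Rightarrow> real" where
  "gauss B a k = exp (- B / 2 * (real_of_int k - a)\<^sup>2)"

lemma gauss_pos: "0 < gauss B a k"
  by (simp add: gauss_def)

lemma abs_le_square_int: "\<bar>real_of_int k\<bar> \<le> (real_of_int k)\<^sup>2"
proof -
  have "\<bar>k\<bar> \<le> k\<^sup>2"
  proof (cases "k = 0")
    case False
    then have "\<bar>k\<bar> * 1 \<le> \<bar>k\<bar> * \<bar>k\<bar>" by (intro mult_left_mono) auto
    then show ?thesis by (simp add: power2_eq_square)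
  qed simp
  then have "real_of_int \<bar>k\<bar> \<le> real_of_int (k\<^sup>2)" by (rule of_int_le_iff[THEN iffD2])
  then show ?thesis by simp
qed

lemma power_nat_abs_eq_exp: "(exp (- c)) ^ nat \<bar>k\<bar> = exp (- c * \<bar>real_of_int k\<bar>)"
  by (simp add: exp_of_nat_mult[symmetric] mult.commute)

text \<open>Combines \<open>(k - a)\<^sup>2 \<ge> k\<^sup>2 / 2 - a\<^sup>2\<close> with
  \<open>k\<^sup>2 \<ge> \<bar>k\<bar>\<close> for integers. The bound is locally uniform in
  \<open>a\<close>, as the Weierstrass test for \<open>villain_fun\<close> requires.\<close>

lemma gauss_le_geometric:
  assumes "0 \<le> B"
  shows "gauss B a k \<le> exp (B / 2 * a\<^sup>2) * exp (- (B / 4)) ^ nat \<bar>k\<bar>"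
proof -
  have "0 \<le> (real_of_int k - 2 * a)\<^sup>2" by simp
  then have "(real_of_int k)\<^sup>2 / 2 - a\<^sup>2 \<le> (real_of_int k - a)\<^sup>2"
    by (simp add: power2_eq_square algebra_simps)
  with abs_le_square_int[of k] have "\<bar>real_of_int k\<bar> / 2 - a\<^sup>2 \<le> (real_of_int k - a)\<^sup>2" by linarith
  from mult_left_mono[OF this, of "B / 2"] assms
  show ?thesis
    unfolding gauss_def power_nat_abs_eq_exp exp_add[symmetric] by (simp add: algebra_simps)
qed

lemma gauss_summable:
  assumes "0 < B"
  shows "gauss B a summable_on UNIV"
proof (rule summable_on_comparison_test)
  show "(\<lambda>k::int. exp (B / 2 * a\<^sup>2) * exp (- (B / 4)) ^ nat \<bar>k\<bar>) summable_on UNIV"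
    using assms by (intro summable_on_cmult_right summable_geometric_int) auto
qed (use assms gauss_le_geometric[of B a] gauss_pos[of B a] in \<open>auto simp: less_imp_le\<close>)

text \<open>The squared modulus is exactly
  \<open>(p + r)\<^sup>2 - 4 * p * r * (sin (t / 2))\<^sup>2\<close>; the bound is the tangent
  estimate \<open>sqrt (S\<^sup>2 - x) \<le> S - x / (2 * S)\<close> with
  \<open>S = p + r\<close>.\<close>

lemma cmod_two_atoms:
  assumes "0 < p" "0 < r"
  shows "cmod (of_real p + of_real r * cis t) \<le> p + r - 2 * (p * r / (p + r)) * (sin (t / 2))\<^sup>2"
proof (rule power2_le_imp_le)
  let ?d = "2 * (p * r / (p + r)) * (sin (t / 2))\<^sup>2"
  have c: "cos t = 1 - 2 * (sin (t / 2))\<^sup>2" using cos_double_sin[of "t / 2"] by simp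
  have "(cmod (of_real p + of_real r * cis t))\<^sup>2 = (p + r * cos t)\<^sup>2 + (r * sin t)\<^sup>2"
    by (simp add: cmod_power2)
  also have "\<dots> = p\<^sup>2 + r\<^sup>2 * ((sin t)\<^sup>2 + (cos t)\<^sup>2) + 2 * p * r * cos t"
    by (simp only: power2_eq_square) (simp only: algebra_simps)
  also have "\<dots> = p\<^sup>2 + r\<^sup>2 + 2 * p * r * cos t" by simp
  also have "\<dots> = (p + r)\<^sup>2 - 2 * (p + r) * ?d"
    using assms unfolding c by (simp add: power2_eq_square field_simps)
  also have "\<dots> \<le> (p + r - ?d)\<^sup>2"
    using zero_le_power2[of ?d] by (simp only: power2_diff)
  finally show "(cmod (of_real p + of_real r * cis t))\<^sup>2 \<le> (p + r - ?d)\<^sup>2" .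
  have "p * r / (p + r) \<le> (p + r) / 4"
  proof -
    have "4 * (p * r) \<le> (p + r) * (p + r)" using zero_le_power2[of "p - r"] by (simp add: power2_eq_square algebra_simps)
    then show ?thesis using assms by (simp add: field_simps)
  qed
  moreover have "(sin (t / 2))\<^sup>2 \<le> 1" by (simp add: abs_square_le_1)
  ultimately have "(p * r / (p + r)) * (sin (t / 2))\<^sup>2 \<le> ((p + r) / 4) * 1"
    using assms by (intro mult_mono) auto
  then have "?d \<le> (p + r) / 2" by linarith
  then show "0 \<le> p + r - ?d" using assms by simp
qed

text \<open>
  The central atom is split between its two neighbours in proportion to their weights, which
  loses nothing to first order when the two neighbours have equal weight.
\<close>
lemma cmod_three_atoms:
  assumes "0 < p" "0 < r" "0 < s"
  shows "cmod (of_real p + of_real r * cis t + of_real s * cis (- t))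
    \<le> p + (r + s) - 2 * (p * (r + s) / (p + (r + s))) * (sin (t / 2))\<^sup>2"
proof -
  define q where "q = r + s"
  have q: "0 < q" using assms by (simp add: q_def)
  have pq: "p = p * (r / q) + p * (s / q)"
    using q by (simp only: distrib_left[symmetric] add_divide_distrib[symmetric] q_def) simp
  have "of_real p + of_real r * cis t + of_real s * cis (- t)
     = (of_real (p * (r / q)) + of_real r * cis t) + (of_real (p * (s / q)) + of_real s * cis (- t))"
  proof -
    have "complex_of_real p = of_real (p * (r / q)) + of_real (p * (s / q))"
      by (subst pq) (simp only: of_real_add)
    then show ?thesis by simp
  qed
  then have "cmod (of_real p + of_real r * cis t + of_real s * cis (- t))
    \<le> cmod (of_real (p * (r / q)) + of_real r * cis t) + cmod (of_real (p * (s / q)) + of_real s * cis (- t))"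
    using norm_triangle_ineq by metis
  also have "\<dots> \<le> (p * (r / q) + r - 2 * (p * (r / q) * r / (p * (r / q) + r)) * (sin (t / 2))\<^sup>2)
     + (p * (s / q) + s - 2 * (p * (s / q) * s / (p * (s / q) + s)) * (sin (- t / 2))\<^sup>2)"
    using assms q by (intro add_mono cmod_two_atoms) auto
  also have "\<dots> = p * (r / q) + p * (s / q) + (r + s) - 2 * (p * (r / q) * r / (p * (r / q) + r) + p * (s / q) * s / (p * (s / q) + s)) * (sin (t / 2))\<^sup>2"
    by (simp add: algebra_simps)
  also have "p * (r / q) * r / (p * (r / q) + r) = p * r / (p + q)"
  proof -
    have "p * (r / q) * r / (p * (r / q) + r) = (p * r) * (r / q) / ((p + q) * (r / q))"
      using q by (simp add: algebra_simps)
    then show ?thesis using assms q by simp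
  qed
  also have "p * (s / q) * s / (p * (s / q) + s) = p * s / (p + q)"
  proof -
    have "p * (s / q) * s / (p * (s / q) + s) = (p * s) * (s / q) / ((p + q) * (s / q))"
      using q by (simp add: algebra_simps)
    then show ?thesis using assms q by simp
  qed
  also have "p * (r / q) + p * (s / q) = p" by (rule pq[symmetric])
  finally show ?thesis by (simp add: q_def[symmetric] add_divide_distrib[symmetric] distrib_left[symmetric])
qed

text \<open>The range \<open>2 / 5\<close> covers \<open>pi * s\<close> for
  \<open>\<bar>s\<bar> \<le> 1 / 10\<close>, because \<open>pi < 4\<close>. The cubic Taylor
  polynomial gives \<open>sin y \<ge> 19 / 20 * y\<close> there for nonnegative \<open>y\<close>,
  and \<open>(19 / 20)\<^sup>2 \<ge> 9 / 10\<close>.\<close>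

lemma sin_square_ge:
  fixes y :: real
  assumes "\<bar>y\<bar> \<le> 2 / 5"
  shows "9 / 10 * y\<^sup>2 \<le> (sin y)\<^sup>2"
proof -
  have *: "9 / 10 * y\<^sup>2 \<le> (sin y)\<^sup>2" if "0 \<le> y" "y \<le> 2 / 5" for y :: real
  proof -
    have "y\<^sup>2 \<le> (2 / 5)\<^sup>2" using that by (intro power_mono) auto
    then have "y * y\<^sup>2 \<le> y * (2 / 5)\<^sup>2" using that by (intro mult_left_mono) auto
    moreover have "y - y ^ 3 / 6 \<le> sin y"
    proof -
      have "\<bar>sin y - y\<bar> \<le> y ^ 3 / 6"
        using Maclaurin_sin_bound[of y 3] that
        by (simp add: sin_coeff_def numeral_3_eq_3 fact_numeral field_simps)
      then show ?thesis by linarith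
    qed
    ultimately have "19 / 20 * y \<le> sin y" using that by (simp add: power3_eq_cube power2_eq_square)
    then have "(19 / 20 * y)\<^sup>2 \<le> (sin y)\<^sup>2" using that by (intro power_mono) auto
    moreover have "9 / 10 * y\<^sup>2 \<le> (19 / 20 * y)\<^sup>2" by (simp add: power_mult_distrib power2_eq_square)
    ultimately show ?thesis by linarith
  qed
  show ?thesis using *[of y] *[of "- y"] assms by (cases "0 \<le> y") auto
qed

definition gauss_total :: "real \<Rightarrow> real \<Rightarrow> real" where
  "gauss_total B a = (\<Sum>\<^sub>\<infinity>k. gauss B a k)"

lemma gauss_total_eq:
  assumes "0 < B"
  shows "gauss_total B a = gauss B a 0 + (gauss B a 1 + gauss B a (- 1)) + (\<Sum>\<^sub>\<infinity>k\<in>{k. 2 \<le> \<bar>k\<bar>}. gauss B a k)"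
proof -
  have U: "UNIV = {0, 1, - 1} \<union> {k::int. 2 \<le> \<bar>k\<bar>}" by auto
  have "gauss_total B a = infsum (gauss B a) {0, 1, - 1} + infsum (gauss B a) {k. 2 \<le> \<bar>k\<bar>}"
    unfolding gauss_total_def
    by (subst U, rule infsum_Un_disjoint) (auto intro: summable_on_subset_banach[OF gauss_summable[OF assms]])
  then show ?thesis by simp
qed

lemma gauss_center_le: "0 < B \<Longrightarrow> gauss B a 0 \<le> gauss_total B a"
  using gauss_total_eq[of B a] gauss_pos[of B a 1] gauss_pos[of B a "- 1"]
    infsum_nonneg[of "{k. 2 \<le> \<bar>k\<bar>}" "gauss B a"]
  by (simp add: gauss_pos less_imp_le)

lemma gauss_total_pos: "0 < B \<Longrightarrow> 0 < gauss_total B a"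
  using gauss_center_le[of B a] gauss_pos[of B a 0] by simp

lemma gauss_cis_summable:
  assumes "0 < B"
  shows "(\<lambda>k. norm (complex_of_real (gauss B a k) * cis (t * real_of_int k))) summable_on A"
  using summable_on_subset_banach[OF gauss_summable[OF assms, of a]]
  by (simp add: norm_mult gauss_pos less_imp_le)

text \<open>Only the cancellation among the atoms -1, 0 and 1 is exploited; all others enter by
  their absolute values. Keeping both neighbours covers parameters near 0, where the two have
  comparable weight, as well as parameters near 1/2 or -1/2, where one of them rivals the atom
  0.\<close>

lemma gauss_char_le_three:
  assumes "0 < B"
  shows "cmod (\<Sum>\<^sub>\<infinity>k. complex_of_real (gauss B a k) * cis (t * real_of_int k))
    \<le> gauss_total B a - 2 * (gauss B a 0 * (gauss B a 1 + gauss B a (- 1)) / (gauss B a 0 + (gauss B a 1 + gauss B a (- 1)))) * (sin (t / 2))\<^sup>2"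
proof -
  let ?f = "\<lambda>k. complex_of_real (gauss B a k) * cis (t * real_of_int k)"
  let ?T = "{k::int. 2 \<le> \<bar>k\<bar>}"
  have U: "UNIV = {0, 1, - 1} \<union> ?T" by auto
  have sum: "?f summable_on A" for A by (rule abs_summable_summable[OF gauss_cis_summable[OF assms]])
  have "infsum ?f UNIV = infsum ?f {0, 1, - 1} + infsum ?f ?T"
    by (subst U, rule infsum_Un_disjoint) (auto intro: sum)
  also have "infsum ?f {0, 1, - 1} = of_real (gauss B a 0) + of_real (gauss B a 1) * cis t + of_real (gauss B a (- 1)) * cis (- t)"
    by (simp add: add.assoc)
  finally have "cmod (infsum ?f UNIV) \<le> cmod (of_real (gauss B a 0) + of_real (gauss B a 1) * cis t + of_real (gauss B a (- 1)) * cis (- t)) + cmod (infsum ?f ?T)"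
    by (simp add: norm_triangle_ineq)
  also have "\<dots> \<le> (gauss B a 0 + (gauss B a 1 + gauss B a (- 1)) - 2 * (gauss B a 0 * (gauss B a 1 + gauss B a (- 1)) / (gauss B a 0 + (gauss B a 1 + gauss B a (- 1)))) * (sin (t / 2))\<^sup>2)
      + infsum (gauss B a) ?T"
  proof (intro add_mono cmod_three_atoms gauss_pos)
    show "cmod (infsum ?f ?T) \<le> infsum (gauss B a) ?T"
      using norm_infsum_bound[OF gauss_cis_summable[OF assms, of a t ?T]]
      by (simp add: norm_mult gauss_pos less_imp_le)
  qed
  finally show ?thesis unfolding gauss_total_eq[OF assms] by simp
qed

lemma exp_minus_6_le: "exp (- 6 :: real) \<le> 1 / 100"
proof -
  have "5 / 2 \<le> exp (1::real)" using exp_lower_Taylor_quadratic[of 1] by simp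
  then have "(5 / 2) ^ 6 \<le> exp (1::real) ^ 6" by (intro power_mono) auto
  then have "100 \<le> exp (6::real)" by (simp add: exp_of_nat_mult[symmetric] power_divide)
  then show ?thesis by (simp add: exp_minus field_simps)
qed

lemma nat_square_le_four_power: "n\<^sup>2 \<le> (4::nat) ^ n"
proof (induction n)
  case (Suc n)
  have "(Suc n)\<^sup>2 \<le> 4 * n\<^sup>2" if "1 \<le> n"
  proof -
    have "(Suc n)\<^sup>2 \<le> (2 * n)\<^sup>2" using that by (intro power_mono) auto
    then show ?thesis by (simp add: power_mult_distrib)
  qed
  with Suc show ?case by (cases "n = 0") auto
qed simp

section \<open>Decay of the characteristic function for large \<open>B\<close>\<close>

context
  fixes B :: real
  assumes B: "12 \<le> B"
begin

lemma exp_half_le: "exp (- B / 2) \<le> 1 / 100"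
proof -
  have "exp (- B / 2) \<le> exp (- 6)" using B by simp
  with exp_minus_6_le show ?thesis by linarith
qed

text \<open>For \<open>\<bar>k\<bar> \<ge> 2\<close> and \<open>\<bar>a\<bar> \<le> 1 / 2\<close>
  one has \<open>(k - a)\<^sup>2 \<ge> a\<^sup>2 + \<bar>k\<bar>\<close>. Relative to the central
  atom the tail is therefore dominated by a geometric series with ratio
  \<open>exp (- B / 2)\<close>, starting at the second power.\<close>

lemma gauss_tail_le:
  assumes "\<bar>a\<bar> \<le> 1 / 2"
  shows "(\<Sum>\<^sub>\<infinity>k\<in>{k. 2 \<le> \<bar>k\<bar>}. gauss B a k) \<le> gauss B a 0 / 100"
proof -
  define q where "q = exp (- B / 2)"
  have q: "0 < q" "q \<le> 1 / 100" using exp_half_le by (auto simp: q_def)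
  have le: "gauss B a k \<le> gauss B a 0 * q ^ nat \<bar>k\<bar>" if "2 \<le> \<bar>k\<bar>" for k
  proof -
    let ?k = "\<bar>real_of_int k\<bar>"
    have k2: "2 \<le> ?k" using that by linarith
    have "2 * a * real_of_int k \<le> 1 * ?k"
    proof -
      have "2 * a * real_of_int k \<le> \<bar>2 * a\<bar> * ?k" by (simp add: abs_mult[symmetric])
      also have "\<dots> \<le> 1 * ?k" using assms by (intro mult_right_mono) auto
      finally show ?thesis .
    qed
    moreover have "2 * ?k \<le> ?k * ?k" using k2 by (intro mult_right_mono) auto
    ultimately have "a\<^sup>2 + ?k \<le> (real_of_int k - a)\<^sup>2"
      by (simp add: power2_eq_square algebra_simps abs_mult_self_eq)
    from mult_left_mono[OF this, of "B / 2"] B show ?thesis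
      unfolding gauss_def q_def minus_divide_left[symmetric] power_nat_abs_eq_exp exp_add[symmetric]
      by (simp add: algebra_simps)
  qed
  have hs: "((\<lambda>k::int. gauss B a 0 * q ^ nat \<bar>k\<bar>) has_sum (gauss B a 0 * (2 * q ^ 2 / (1 - q)))) {k. int 2 \<le> \<bar>k\<bar>}"
    using q by (intro has_sum_cmult_right has_sum_geometric_tail) auto
  have "(\<Sum>\<^sub>\<infinity>k\<in>{k. 2 \<le> \<bar>k\<bar>}. gauss B a k) \<le> (\<Sum>\<^sub>\<infinity>k\<in>{k. 2 \<le> \<bar>k\<bar>}. gauss B a 0 * q ^ nat \<bar>k\<bar>)"
    using hs B le
    by (intro infsum_mono summable_on_subset_banach[OF gauss_summable]) (auto dest: has_sum_imp_summable)
  also have "\<dots> = gauss B a 0 * (2 * q ^ 2 / (1 - q))" using infsumI[OF hs] by simp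
  also have "\<dots> \<le> gauss B a 0 * (1 / 100)"
  proof (intro mult_left_mono)
    have "q * q \<le> (1 / 100) * (1 / 100)" using q by (intro mult_mono) auto
    then show "2 * q ^ 2 / (1 - q) \<le> 1 / 100" using q by (simp add: power2_eq_square field_simps)
  qed (simp add: gauss_pos less_imp_le)
  finally show ?thesis by simp
qed

text \<open>The ratio \<open>x\<close> equals \<open>2 * exp (- B / 2) * cosh (B * a)\<close>. The
  lower bound is its value at \<open>a = 0\<close>; the upper one uses
  \<open>\<bar>B * a\<bar> \<le> B / 2\<close>.\<close>

lemma gauss_neighbours:
  assumes "\<bar>a\<bar> \<le> 1 / 2"
  defines "x \<equiv> (gauss B a 1 + gauss B a (- 1)) / gauss B a 0"
  shows "2 * exp (- B / 2) \<le> x" "x \<le> 2"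
proof -
  have x: "x = exp (- B / 2) * exp (B * a) + exp (- B / 2) * exp (- (B * a))"
    unfolding x_def gauss_def add_divide_distrib exp_diff[symmetric] exp_add[symmetric]
    by (simp add: power2_eq_square algebra_simps)
  have "2 \<le> exp (B * a) + exp (- (B * a))"
    using cosh_real_ge_1[of "B * a"] by (simp add: cosh_def)
  from mult_left_mono[OF this, of "exp (- B / 2)"] show "2 * exp (- B / 2) \<le> x"
    unfolding x by (simp add: algebra_simps)
  have "\<bar>B * a\<bar> \<le> B / 2" using assms(1) B by (simp add: abs_mult)
  then have "- B / 2 + B * a \<le> 0" "- B / 2 + - (B * a) \<le> 0" by auto
  then show "x \<le> 2" unfolding x exp_add[symmetric] by (smt (verit) exp_le_one_iff)
qed

text \<open>The right side carries the loss in \<open>gauss_char_le_three\<close> after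
  \<open>sin_square_ge\<close> (\<open>18 / 10\<close> is twice \<open>9 / 10\<close>);
  \<open>21 / 10 * exp (- B / 2)\<close> on the left is the bound for the variance at parameter 0.
  After division by \<open>p\<close>, the leading term is controlled by \<open>2 * q \<le> x\<close>
  and the products by \<open>q \<le> 1 / 100\<close> and \<open>x \<le> 2\<close>.\<close>

lemma gauss_defect:
  assumes "\<bar>a\<bar> \<le> 1 / 2"
  defines "p \<equiv> gauss B a 0" and "w \<equiv> gauss B a 1 + gauss B a (- 1)"
  shows "21 / 10 * exp (- B / 2) * gauss_total B a \<le> 18 / 10 * (p * w / (p + w))"
proof -
  define q where "q = exp (- B / 2)"
  define x where "x = w / p"
  have p: "0 < p" by (simp add: p_def gauss_pos)
  have w: "w = p * x" using p by (simp add: x_def)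
  have x: "2 * q \<le> x" "x \<le> 2" using gauss_neighbours[OF assms(1)] by (auto simp: q_def x_def w_def p_def)
  have q: "0 < q" "q \<le> 1 / 100" using exp_half_le by (auto simp: q_def)
  have "gauss_total B a \<le> p + w + p / 100"
    using gauss_total_eq[of B a] gauss_tail_le[OF assms(1)] B by (simp add: p_def w_def)
  also have "\<dots> = p * (101 / 100 + x)" by (simp add: w algebra_simps)
  finally have "21 / 10 * q * gauss_total B a \<le> 21 / 10 * q * (p * (101 / 100 + x))"
    using q by (intro mult_left_mono) auto
  also have "\<dots> \<le> 18 / 10 * (p * (x / (1 + x)))"
  proof -
    have "q * x \<le> 1 / 100 * x" using q x by (intro mult_right_mono) auto
    moreover have "q * x * x \<le> (1 / 100 * x) * 2" using q x by (intro mult_mono) auto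
    moreover have "21 / 10 * (101 / 100 * q + 201 / 100 * y + z) \<le> 18 / 10 * x"
      if "y \<le> 1 / 100 * x" "z \<le> 1 / 100 * x * 2" for y z
      using that x q by simp
    moreover have "21 / 10 * q * ((101 / 100 + x) * (1 + x)) = 21 / 10 * (101 / 100 * q + 201 / 100 * (q * x) + q * x * x)"
      by (simp add: field_simps)
    ultimately have "21 / 10 * q * ((101 / 100 + x) * (1 + x)) \<le> 18 / 10 * x"
      by metis
    then have "21 / 10 * q * (101 / 100 + x) \<le> 18 / 10 * (x / (1 + x))"
      using x q by (simp add: field_simps)
    from mult_left_mono[OF this, of p] p show ?thesis by (simp add: mult_ac)
  qed
  also have "p * (x / (1 + x)) = p * w / (p + w)"
  proof -
    have "p * w / (p + w) = p * (p * x) / (p * (1 + x))" by (simp add: w algebra_simps)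
    then show ?thesis using p by simp
  qed
  finally show ?thesis by (simp add: q_def)
qed

text \<open>The bound on \<open>v\<close> is the one available for the variance at parameter 0. It
  serves every centred \<open>a\<close> at once because \<open>gauss_defect\<close> is uniform in
  \<open>a\<close>; the passage to the exponential is \<open>1 - x \<le> exp (- x)\<close>.\<close>

lemma gauss_char_le_centered:
  assumes "\<bar>a\<bar> \<le> 1 / 2" "\<bar>s\<bar> \<le> 1 / 10" and v: "v \<le> 21 / 10 * exp (- B / 2)"
  shows "cmod (\<Sum>\<^sub>\<infinity>k. complex_of_real (gauss B a k) * cis (2 * pi * s * real_of_int k))
    \<le> exp (- pi\<^sup>2 * s\<^sup>2 * v) * gauss_total B a"
proof -
  let ?Z = "gauss_total B a"
  define D where "D = gauss B a 0 * (gauss B a 1 + gauss B a (- 1)) / (gauss B a 0 + (gauss B a 1 + gauss B a (- 1)))"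
  have Z: "0 < ?Z" using gauss_total_pos B by simp
  have D: "v * ?Z \<le> 18 / 10 * D"
    using gauss_defect[OF assms(1), folded D_def] mult_right_mono[OF v, of ?Z] Z by linarith
  have D0: "0 \<le> D" by (simp add: D_def gauss_pos less_imp_le)
  have "\<bar>pi * s\<bar> \<le> 4 * (1 / 10)"
    unfolding abs_mult using assms(2) pi_less_4 by (intro mult_mono) auto
  then have "9 / 10 * (pi * s)\<^sup>2 \<le> (sin (pi * s))\<^sup>2" by (intro sin_square_ge) simp
  from mult_left_mono[OF this, of "2 * D"] D0
  have "(pi * s)\<^sup>2 * (18 / 10 * D) \<le> 2 * D * (sin (pi * s))\<^sup>2" by (simp add: mult_ac)
  moreover have "(pi * s)\<^sup>2 * (v * ?Z) \<le> (pi * s)\<^sup>2 * (18 / 10 * D)"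
    using D by (intro mult_left_mono) auto
  ultimately have "(pi * s)\<^sup>2 * v * ?Z \<le> 2 * D * (sin (2 * pi * s / 2))\<^sup>2" by (simp add: mult_ac)
  moreover have "0 < B" using B by simp
  ultimately have "cmod (\<Sum>\<^sub>\<infinity>k. complex_of_real (gauss B a k) * cis (2 * pi * s * real_of_int k))
    \<le> ?Z - (pi * s)\<^sup>2 * v * ?Z"
    using gauss_char_le_three[of B a "2 * pi * s", folded D_def] by linarith
  also have "\<dots> = (1 + (- pi\<^sup>2 * s\<^sup>2 * v)) * ?Z" by (simp add: algebra_simps power_mult_distrib)
  also have "\<dots> \<le> exp (- pi\<^sup>2 * s\<^sup>2 * v) * ?Z"
    using Z by (intro mult_right_mono exp_ge_add_one_self) auto
  finally show ?thesis .
qed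

lemma gauss_shift: "gauss B (a + real_of_int m) (k + m) = gauss B a k"
  by (simp add: gauss_def)

text \<open>Moving the parameter by an integer multiplies the sum by a phase, so subtracting the
  nearest integer reduces to the centred case.\<close>

lemma gauss_char_le:
  assumes "\<bar>s\<bar> \<le> 1 / 10" and v: "v \<le> 21 / 10 * exp (- B / 2)"
  shows "cmod (\<Sum>\<^sub>\<infinity>k. complex_of_real (gauss B a k) * cis (2 * pi * s * real_of_int k))
    \<le> exp (- pi\<^sup>2 * s\<^sup>2 * v) * gauss_total B a"
proof -
  define m where "m = round a"
  define a' where "a' = a - real_of_int m"
  have a': "\<bar>a'\<bar> \<le> 1 / 2" "a = a' + real_of_int m"
    using of_int_round_abs_le[of a] by (auto simp: a'_def m_def abs_minus_commute)
  have bij: "bij_betw (\<lambda>k::int. k + m) UNIV UNIV"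
    by (rule bij_betwI[of _ _ _ "\<lambda>k. k - m"]) auto
  have "gauss_total B a = gauss_total B a'"
    unfolding gauss_total_def a'(2)
    by (subst infsum_reindex_bij_betw[OF bij, symmetric]) (simp add: gauss_shift)
  moreover have "(\<Sum>\<^sub>\<infinity>k. complex_of_real (gauss B a k) * cis (2 * pi * s * real_of_int k))
    = (\<Sum>\<^sub>\<infinity>k. cis (2 * pi * s * real_of_int m) * (complex_of_real (gauss B a' k) * cis (2 * pi * s * real_of_int k)))"
    unfolding a'(2)
    by (subst infsum_reindex_bij_betw[OF bij, symmetric])
      (simp add: gauss_shift distrib_left cis_mult[symmetric] mult_ac)
  moreover have "\<dots> = cis (2 * pi * s * real_of_int m) * (\<Sum>\<^sub>\<infinity>k. complex_of_real (gauss B a' k) * cis (2 * pi * s * real_of_int k))"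
    by (rule infsum_cmult_right')
  ultimately show ?thesis
    using gauss_char_le_centered[OF a'(1) assms] by (simp add: norm_mult)
qed

end

section \<open>The smallest variance of an integer-valued Gaussian\<close>

lemma integral_count_space_infsum:
  fixes f :: "'a \<Rightarrow> real"
  assumes "(\<lambda>x. norm (f x)) summable_on A"
  shows "integrable (count_space A) f" "integral\<^sup>L (count_space A) f = infsum f A"
proof -
  have "Infinite_Set_Sum.abs_summable_on f A" using assms abs_summable_equivalent by blast
  then show "integrable (count_space A) f" "integral\<^sup>L (count_space A) f = infsum f A"
    using infsetsum_infsum[of f A] by (auto simp: Infinite_Set_Sum.abs_summable_on_def infsetsum_def)
qed

lemma integer_gaussian_eq:
  assumes "0 < B"
  shows "integer_gaussian a B = density (count_space UNIV) (\<lambda>k. ennreal (gauss B a k / gauss_total B a))"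
proof -
  have *: "(\<lambda>k. norm (gauss B a k)) summable_on UNIV"
    using gauss_summable[OF assms, of a] by (simp add: gauss_pos less_imp_le)
  have "(\<integral>\<^sup>+k. ennreal (gauss B a k) \<partial>count_space UNIV) = ennreal (gauss_total B a)"
    using integral_count_space_infsum[OF *]
    by (subst nn_integral_eq_integral) (auto simp: gauss_pos less_imp_le gauss_total_def)
  then show ?thesis
    unfolding integer_gaussian_def normalized_density_def gauss_def[symmetric]
    by (simp add: divide_ennreal gauss_total_pos[OF assms] gauss_pos less_imp_le)
qed

lemma integral_integer_gaussian:
  fixes h :: "int \<Rightarrow> real"
  assumes "0 < B"
  shows "(\<integral>k. h k \<partial>integer_gaussian a B) = (\<integral>k. gauss B a k / gauss_total B a * h k \<partial>count_space UNIV)"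
  unfolding integer_gaussian_eq[OF assms]
  by (subst integral_density) (auto simp: gauss_pos gauss_total_pos[OF assms] less_imp_le)

lemma Var_IG_nonneg: "0 \<le> Var_IG a B"
  unfolding Var_IG_def by (rule Bochner_Integration.integral_nonneg) simp

text \<open>For \<open>n \<ge> 2\<close> one has \<open>q ^ (n * n) \<le> q ^ n * q ^ n\<close>, and
  one of the two factors absorbs \<open>n\<^sup>2 \<le> 4 ^ n\<close>.\<close>

lemma square_power_le:
  fixes q :: real
  assumes "0 \<le> q" "q \<le> 1 / 4"
  shows "(real n)\<^sup>2 * q ^ (n * n) \<le> q ^ n"
proof (cases "n \<le> 1")
  case True
  then have "n = 0 \<or> n = 1" by auto
  then show ?thesis by auto
next
  case False
  then have "n + n \<le> n * n" by (cases n) auto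
  then have "q ^ (n * n) \<le> q ^ (n + n)" using assms by (intro power_decreasing) auto
  also have "\<dots> = q ^ n * q ^ n" by (rule power_add)
  also have "\<dots> \<le> (1 / 4) ^ n * q ^ n" using assms by (intro mult_right_mono power_mono) auto
  finally have "(real n)\<^sup>2 * q ^ (n * n) \<le> real (n\<^sup>2) * ((1 / 4) ^ n * q ^ n)"
    by (simp add: mult_left_mono)
  also have "\<dots> \<le> real (4 ^ n) * ((1 / 4) ^ n * q ^ n)"
    using assms by (intro mult_right_mono of_nat_mono nat_square_le_four_power) auto
  also have "\<dots> = q ^ n" by (simp add: power_divide)
  finally show ?thesis .
qed

text \<open>At parameter 0 the mean vanishes by symmetry, the normalization is at least 1, and the
  second moment is at most the sum of \<open>q ^ \<bar>k\<bar>\<close> over nonzero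
  \<open>k\<close>, which is \<open>2 * q / (1 - q)\<close>. Since \<open>q \<le> 1 / 100\<close>,
  this is below \<open>21 / 10 * q\<close>.\<close>

lemma Var_IG_zero_le:
  assumes B: "12 \<le> B"
  shows "Var_IG 0 B \<le> 21 / 10 * exp (- B / 2)"
proof -
  define q where "q = exp (- B / 2)"
  have q: "0 < q" "q \<le> 1 / 100" using exp_half_le[OF B] by (auto simp: q_def)
  have B0: "0 < B" using B by simp
  let ?Z = "gauss_total B 0"
  have Z: "1 \<le> ?Z" using gauss_center_le[OF B0, of 0] by (simp add: gauss_def)
  let ?f = "\<lambda>k. gauss B 0 k / ?Z * (real_of_int k)\<^sup>2"
  have mean: "(\<integral>k. real_of_int k \<partial>integer_gaussian 0 B) = 0"
  proof -
    have bij: "bij_betw uminus (UNIV :: int set) UNIV"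
      by (rule bij_betwI[of _ _ _ uminus]) auto
    let ?h = "\<lambda>k. gauss B 0 k / ?Z * real_of_int k"
    have "infsetsum (\<lambda>k. ?h (- k)) UNIV = infsetsum ?h UNIV"
      by (rule infsetsum_reindex_bij_betw[OF bij])
    moreover have "infsetsum (\<lambda>k. ?h (- k)) UNIV = - infsetsum ?h UNIV"
      by (simp add: gauss_def infsetsum_uminus)
    ultimately show ?thesis
      unfolding integral_integer_gaussian[OF B0] by (simp add: infsetsum_def)
  qed
  have le: "?f k \<le> q ^ nat \<bar>k\<bar>" for k
  proof -
    have "gauss B 0 k = q ^ (nat \<bar>k\<bar> * nat \<bar>k\<bar>)"
      by (simp add: gauss_def q_def exp_of_nat_mult[symmetric] power2_eq_square mult.commute)
    then have "gauss B 0 k * (real_of_int k)\<^sup>2 \<le> q ^ nat \<bar>k\<bar>"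
      using square_power_le[of q "nat \<bar>k\<bar>"] q by (simp add: mult.commute)
    moreover have "?f k \<le> gauss B 0 k * (real_of_int k)\<^sup>2"
      using Z gauss_pos[of B 0 k] mult_right_mono[OF Z, of "(real_of_int k)\<^sup>2"] by (simp add: field_simps)
    ultimately show ?thesis by linarith
  qed
  have f0: "0 \<le> ?f k" for k using Z by (simp add: gauss_pos less_imp_le)
  have sumg: "(\<lambda>k::int. q ^ nat \<bar>k\<bar>) summable_on UNIV" using q by (intro summable_geometric_int) auto
  have sumf: "?f summable_on UNIV"
    by (rule summable_on_comparison_test[OF sumg]) (use le f0 in auto)
  have hs: "((\<lambda>k::int. q ^ nat \<bar>k\<bar>) has_sum (2 * q ^ 1 / (1 - q))) {k. int 1 \<le> \<bar>k\<bar>}"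
    using q by (intro has_sum_geometric_tail) auto
  have "Var_IG 0 B = (\<integral>k. ?f k \<partial>count_space UNIV)"
    by (simp only: Var_IG_def mean) (simp add: integral_integer_gaussian[OF B0])
  also have "\<dots> = infsum ?f UNIV"
  proof (rule integral_count_space_infsum(2))
    have "(\<lambda>k. norm (?f k)) = ?f" using f0 by (intro ext) (simp only: real_norm_def abs_of_nonneg)
    then show "(\<lambda>k. norm (?f k)) summable_on UNIV" using sumf by (simp only:)
  qed
  also have "\<dots> = infsum ?f {k. 1 \<le> \<bar>k\<bar>}"
    by (rule infsum_cong_neutral) auto
  also have "\<dots> \<le> infsum (\<lambda>k. q ^ nat \<bar>k\<bar>) {k. 1 \<le> \<bar>k\<bar>}"
    using le by (intro infsum_mono summable_on_subset_banach[OF sumf] summable_on_subset_banach[OF sumg]) auto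
  also have "\<dots> = 2 * q / (1 - q)" using infsumI[OF hs] by simp
  also have "\<dots> \<le> 21 / 10 * q"
  proof -
    have "q * q \<le> 1 / 100 * q" using q by (intro mult_right_mono) auto
    then show ?thesis using q by (simp add: field_simps)
  qed
  finally show ?thesis by (simp add: q_def)
qed

definition min_variance :: "real \<Rightarrow> real" where
  "min_variance \<beta> = (INF a\<in>{0..1 / 2}. Var_IG a ((2 * pi)\<^sup>2 * \<beta>))"

lemma min_variance_nonneg: "0 \<le> min_variance \<beta>"
  unfolding min_variance_def by (rule cINF_greatest) (auto simp: Var_IG_nonneg)

text \<open>Here the threshold \<open>1 / 3\<close> for \<beta> acts: with \<open>pi > 3\<close> the
  coupling reaches 12, and \<open>exp (- 6) \<le> 1 / 100\<close> drives the numerical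
  estimates.\<close>

lemma coupling_ge:
  assumes "1 / 3 \<le> \<beta>"
  shows "12 \<le> (2 * pi)\<^sup>2 * \<beta>"
proof -
  have "3 * 3 \<le> pi * pi" using pi_gt3 by (intro mult_mono) auto
  then have "36 * (1 / 3) \<le> (2 * pi)\<^sup>2 * \<beta>"
    using assms by (intro mult_mono) (auto simp: power2_eq_square)
  then show ?thesis by simp
qed

lemma min_variance_le:
  assumes "1 / 3 \<le> \<beta>"
  shows "min_variance \<beta> \<le> 21 / 10 * exp (- ((2 * pi)\<^sup>2 * \<beta>) / 2)"
proof -
  have "min_variance \<beta> \<le> Var_IG 0 ((2 * pi)\<^sup>2 * \<beta>)"
    unfolding min_variance_def by (rule cINF_lower) (auto intro!: bdd_belowI2 Var_IG_nonneg)
  with Var_IG_zero_le[OF coupling_ge[OF assms]] show ?thesis by linarith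
qed

text \<open>Keeps the loss at a steep edge bounded uniformly in \<beta>.\<close>

lemma min_variance_le_1:
  assumes "1 / 3 \<le> \<beta>"
  shows "min_variance \<beta> \<le> 1"
  using min_variance_le[OF assms] exp_half_le[OF coupling_ge[OF assms]] by linarith

section \<open>Complex translation on the torus\<close>

text \<open>The Villain edge weight continued to complex angles, a Jacobi theta function.\<close>

definition villain_fun :: "real \<Rightarrow> complex \<Rightarrow> complex" where
  "villain_fun \<beta> z = (\<Sum>\<^sub>\<infinity>k::int. exp (- of_real (\<beta> / 2) * (z + of_real (2 * pi * real_of_int k))\<^sup>2))"

text \<open>Expanding the square separates the growth in \<open>y\<close>, a phase common to all
  \<open>k\<close>, and a summand of the characteristic function of an integer-valued Gaussian. For
  \<open>y = s / \<beta>\<close> the frequency is \<open>- 2 * pi * s\<close>.\<close>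

lemma villain_term:
  fixes x y \<beta> :: real and k :: int
  shows "exp (- of_real (\<beta> / 2) * (Complex x y + of_real (2 * pi * real_of_int k))\<^sup>2)
    = of_real (exp (\<beta> / 2 * y\<^sup>2)) * cis (- \<beta> * y * x) *
      (of_real (gauss ((2 * pi)\<^sup>2 * \<beta>) (- x / (2 * pi)) k) * cis (2 * pi * (- \<beta> * y) * real_of_int k))"
proof -
  let ?u = "x + 2 * pi * real_of_int k"
  have "real_of_int k - (- x / (2 * pi)) = ?u / (2 * pi)" by (simp add: field_simps)
  then have g: "gauss ((2 * pi)\<^sup>2 * \<beta>) (- x / (2 * pi)) k = exp (- \<beta> / 2 * ?u\<^sup>2)"
    by (simp add: gauss_def power_divide power_mult_distrib)
  have "exp (- of_real (\<beta> / 2) * (Complex x y + of_real (2 * pi * real_of_int k))\<^sup>2)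
      = exp (Complex (\<beta> / 2 * y\<^sup>2 + - \<beta> / 2 * ?u\<^sup>2) (- \<beta> * y * x + 2 * pi * (- \<beta> * y) * real_of_int k))"
    by (intro arg_cong[where f = exp] complex_eqI) (simp_all add: power2_eq_square algebra_simps add_divide_distrib diff_divide_distrib)
  also have "\<dots> = of_real (exp (\<beta> / 2 * y\<^sup>2)) * cis (- \<beta> * y * x) *
      (of_real (exp (- \<beta> / 2 * ?u\<^sup>2)) * cis (2 * pi * (- \<beta> * y) * real_of_int k))"
    by (simp only: exp_eq_polar complex.sel exp_add cis_mult[symmetric] of_real_mult mult_ac)
  finally show ?thesis unfolding g .
qed

lemma villain_fun_eq:
  "villain_fun \<beta> (Complex x y) = of_real (exp (\<beta> / 2 * y\<^sup>2)) * cis (- \<beta> * y * x) *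
    (\<Sum>\<^sub>\<infinity>k. of_real (gauss ((2 * pi)\<^sup>2 * \<beta>) (- x / (2 * pi)) k) * cis (2 * pi * (- \<beta> * y) * real_of_int k))"
  unfolding villain_fun_def villain_term by (rule infsum_cmult_right')

lemma villain_fun_periodic: "villain_fun \<beta> (z + of_real (2 * pi * of_int m)) = villain_fun \<beta> z"
proof -
  have bij: "bij_betw (\<lambda>k::int. k + m) UNIV UNIV"
    by (rule bij_betwI[of _ _ _ "\<lambda>k. k - m"]) auto
  show ?thesis
    unfolding villain_fun_def
    by (subst (2) infsum_reindex_bij_betw[OF bij, symmetric]) (simp add: algebra_simps)
qed

context
  fixes \<beta> :: real
  assumes \<beta>: "0 < \<beta>"
begin

private lemma B_pos: "0 < (2 * pi)\<^sup>2 * \<beta>"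
  using \<beta> by simp

lemma villain_fun_real:
  "villain_fun \<beta> (of_real x) = of_real (gauss_total ((2 * pi)\<^sup>2 * \<beta>) (- x / (2 * pi)))"
proof -
  have "(\<Sum>\<^sub>\<infinity>k. complex_of_real (gauss ((2 * pi)\<^sup>2 * \<beta>) (- x / (2 * pi)) k)) = of_real (gauss_total ((2 * pi)\<^sup>2 * \<beta>) (- x / (2 * pi)))"
    unfolding gauss_total_def by (intro infsumI has_sum_of_real has_sum_infsum gauss_summable B_pos)
  then show ?thesis
    using villain_fun_eq[of \<beta> x 0] by (simp add: complex_of_real_def complex_eq_iff)
qed

lemma norm_villain_fun_le:
  "cmod (villain_fun \<beta> (Complex x y)) \<le> exp (\<beta> / 2 * y\<^sup>2) * gauss_total ((2 * pi)\<^sup>2 * \<beta>) (- x / (2 * pi))"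
proof -
  have "cmod (\<Sum>\<^sub>\<infinity>k. of_real (gauss ((2 * pi)\<^sup>2 * \<beta>) (- x / (2 * pi)) k) * cis (2 * pi * (- \<beta> * y) * real_of_int k))
    \<le> gauss_total ((2 * pi)\<^sup>2 * \<beta>) (- x / (2 * pi))"
    using norm_infsum_bound[OF gauss_cis_summable[OF B_pos], of "- x / (2 * pi)" "2 * pi * (- \<beta> * y)" UNIV]
    by (simp only: norm_mult norm_of_real norm_cis mult_1_right abs_of_pos[OF gauss_pos] gauss_total_def)
  then show ?thesis unfolding villain_fun_eq by (simp add: norm_mult)
qed

lemma villain_fun_holomorphic: "villain_fun \<beta> holomorphic_on UNIV"
proof -
  define B where "B = (2 * pi)\<^sup>2 * \<beta>"
  have B_pos: "0 < B" unfolding B_def by (rule B_pos)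
  let ?f = "\<lambda>k (z::complex). exp (- of_real (\<beta> / 2) * (z + of_real (2 * pi * real_of_int k))\<^sup>2)"
  have "villain_fun \<beta> holomorphic_on ball 0 R" for R
  proof (rule holomorphic_uniform_limit)
    let ?M = "\<lambda>k::int. exp (\<beta> / 2 * R\<^sup>2) * (exp (B / 2 * (R / (2 * pi))\<^sup>2) * exp (- (B / 4)) ^ nat \<bar>k\<bar>)"
    have M: "?M summable_on UNIV"
      using B_pos by (intro summable_on_cmult_right summable_geometric_int) auto
    have le: "cmod (?f k z) \<le> ?M k" if "z \<in> cball 0 R" for k z
    proof -
      obtain x y where z: "z = Complex x y" by (cases z)
      have "\<bar>x\<bar> \<le> R" "\<bar>y\<bar> \<le> R"
        using that abs_Re_le_cmod[of z] abs_Im_le_cmod[of z] by (auto simp: z)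
      then have xy: "x\<^sup>2 \<le> R\<^sup>2" "y\<^sup>2 \<le> R\<^sup>2" using power_mono[of "\<bar>x\<bar>" R 2] power_mono[of "\<bar>y\<bar>" R 2] by auto
      have "(- x / (2 * pi))\<^sup>2 \<le> (R / (2 * pi))\<^sup>2"
        unfolding power_divide by (intro divide_right_mono) (use xy in auto)
      then have "exp (B / 2 * (- x / (2 * pi))\<^sup>2) * exp (- (B / 4)) ^ nat \<bar>k\<bar> \<le> exp (B / 2 * (R / (2 * pi))\<^sup>2) * exp (- (B / 4)) ^ nat \<bar>k\<bar>"
        using B_pos by (intro mult_right_mono) auto
      then have g: "gauss B (- x / (2 * pi)) k \<le> exp (B / 2 * (R / (2 * pi))\<^sup>2) * exp (- (B / 4)) ^ nat \<bar>k\<bar>"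
        using gauss_le_geometric[of B "- x / (2 * pi)" k] B_pos by linarith
      have "cmod (?f k z) = exp (\<beta> / 2 * y\<^sup>2) * gauss B (- x / (2 * pi)) k"
        unfolding z villain_term B_def[symmetric] by (simp add: norm_mult gauss_pos less_imp_le)
      also have "\<dots> \<le> ?M k"
        using xy \<beta> g by (intro mult_mono) (auto simp: gauss_pos less_imp_le)
      finally show ?thesis .
    qed
    show "uniform_limit (cball 0 R) (\<lambda>X z. \<Sum>k\<in>X. ?f k z) (villain_fun \<beta>) (finite_subsets_at_top UNIV)"
      unfolding villain_fun_def by (rule Weierstrass_m_test_general[OF _ M]) (use le in auto)
    show "\<forall>\<^sub>F X in finite_subsets_at_top UNIV. continuous_on (cball 0 R) (\<lambda>z. \<Sum>k\<in>X. ?f k z)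
        \<and> (\<lambda>z. \<Sum>k\<in>X. ?f k z) holomorphic_on ball 0 R"
      by (intro always_eventually allI conjI continuous_intros holomorphic_intros)
  qed auto
  then have "villain_fun \<beta> holomorphic_on (\<Union>R. ball 0 R)"
    by (intro holomorphic_on_UN_open) auto
  moreover have "(\<Union>R. ball (0::complex) R) = UNIV"
  proof -
    have "z \<in> ball 0 (cmod z + 1)" for z :: complex by simp
    then show ?thesis by blast
  qed
  ultimately show ?thesis by simp
qed

text \<open>Obtained through \<open>villain_fun\<close>: continuity bounds it on one closed period,
  and periodicity carries the bound to all \<open>a\<close>.\<close>

lemma gauss_total_bounded: "\<exists>C. \<forall>a. gauss_total ((2 * pi)\<^sup>2 * \<beta>) a \<le> C"
proof -
  let ?B = "(2 * pi)\<^sup>2 * \<beta>"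
  have cont: "continuous_on {0..2 * pi} (\<lambda>x. villain_fun \<beta> (of_real x))"
    by (intro continuous_on_compose2[OF holomorphic_on_imp_continuous_on[OF villain_fun_holomorphic]] continuous_intros) auto
  have "bounded ((\<lambda>x. villain_fun \<beta> (of_real x)) ` {0..2 * pi})"
    by (intro compact_imp_bounded compact_continuous_image[OF cont]) auto
  then obtain C where C: "\<And>x. x \<in> {0..2 * pi} \<Longrightarrow> cmod (villain_fun \<beta> (of_real x)) \<le> C"
    unfolding bounded_iff by blast
  have "gauss_total ?B a \<le> C" for a
  proof -
    define x where "x = 2 * pi * frac (- a)"
    have "x \<in> {0..2 * pi}" using frac_ge_0[of "- a"] frac_lt_1[of "- a"] by (auto simp: x_def)
    moreover have "villain_fun \<beta> (of_real x) = villain_fun \<beta> (of_real (- 2 * pi * a))"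
      using villain_fun_periodic[of \<beta> "of_real (- 2 * pi * a)" "- \<lfloor>- a\<rfloor>"]
      unfolding of_real_add[symmetric] by (simp add: x_def frac_def algebra_simps)
    moreover have "villain_fun \<beta> (of_real (- 2 * pi * a)) = of_real (gauss_total ?B a)"
      unfolding villain_fun_real by simp
    ultimately show ?thesis using C[of x] gauss_total_pos[OF B_pos, of a] by simp
  qed
  then show ?thesis by blast
qed

end

text \<open>
  The increment over one period of a primitive of \<open>F\<close> does not depend on the base point, since its
  derivative vanishes.
\<close>
lemma integral_period_shift:
  assumes hol: "F holomorphic_on UNIV" and per: "\<And>z. F (z + of_real (2 * pi)) = F z"
  shows "(\<integral>x. F (of_real x + \<i> * of_real y) \<partial>restrict_space lborel {0..<2 * pi})
    = (\<integral>x. F (of_real x) \<partial>restrict_space lborel {0..<2 * pi})"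
proof -
  obtain P where P: "\<And>z. (P has_field_derivative F z) (at z)"
    using holomorphic_convex_primitive'[of UNIV F] hol by auto
  have "(\<lambda>z. P (z + of_real (2 * pi)) - P z) constant_on UNIV"
  proof (rule has_field_derivative_0_imp_constant_on)
    fix z
    show "((\<lambda>z. P (z + of_real (2 * pi)) - P z) has_field_derivative 0) (at z)"
      using DERIV_diff[OF DERIV_shift[THEN iffD1, OF P[of "z + of_real (2 * pi)"]] P[of z]]
      by (simp only: per diff_self)
  qed auto
  then obtain d where d: "\<And>z. P (z + of_real (2 * pi)) - P z = d"
    unfolding constant_on_def by blast
  have const: "P (z + of_real (2 * pi)) - P z = P (of_real (2 * pi)) - P 0" for z
    using d[of z] d[of 0] by (simp only: add_0)
  have cont: "continuous_on A F" for A
    using holomorphic_on_imp_continuous_on[OF hol] continuous_on_subset by blast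
  have "(\<integral>x. F (of_real x + c) \<partial>restrict_space lborel {0..<2 * pi}) = P (of_real (2 * pi)) - P 0" for c
  proof -
    have "(\<integral>x. F (of_real x + c) \<partial>restrict_space lborel {0..<2 * pi})
      = (\<integral>x. indicator {0..<2 * pi} x *\<^sub>R F (of_real x + c) \<partial>lborel)"
      by (subst integral_restrict_space) auto
    also have "\<dots> = (\<integral>x. indicator {0..2 * pi} x *\<^sub>R F (of_real x + c) \<partial>lborel)"
    \<comment> \<open>The fundamental theorem of calculus wants the closed interval; the added
      endpoint is a null set.\<close>
    proof (rule integral_cong_AE)
      have [measurable]: "(\<lambda>x::real. F (of_real x + c)) \<in> borel_measurable borel"
        by (intro borel_measurable_continuous_onI continuous_on_compose2[OF cont] continuous_intros) auto
      show "(\<lambda>x. indicator {0..<2 * pi} x *\<^sub>R F (of_real x + c)) \<in> borel_measurable lborel"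
        "(\<lambda>x. indicator {0..2 * pi} x *\<^sub>R F (of_real x + c)) \<in> borel_measurable lborel"
        by measurable
      show "AE x in lborel. indicator {0..<2 * pi} x *\<^sub>R F (of_real x + c) = indicator {0..2 * pi} x *\<^sub>R F (of_real x + c)"
        using AE_lborel_singleton[of "2 * pi"] by eventually_elim (auto simp: indicator_def)
    qed
    also have "\<dots> = P (of_real (2 * pi) + c) - P (of_real 0 + c)"
    proof (rule integral_FTC_Icc)
      fix x :: real
      have "((\<lambda>z. P (z + c)) has_field_derivative F (of_real x + c)) (at (of_real x))"
        using P[of "of_real x + c"] by (simp add: DERIV_shift)
      then show "((\<lambda>x. P (of_real x + c)) has_vector_derivative F (of_real x + c)) (at x within {0..2 * pi})"
        by (rule has_vector_derivative_real_field)
    qed (auto intro!: continuous_on_compose2[OF cont] continuous_intros)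
    also have "\<dots> = P (of_real (2 * pi)) - P 0" using const[of c] by (simp add: add.commute)
    finally show ?thesis .
  qed
  from this[of "\<i> * of_real y"] this[of 0] show ?thesis by simp
qed

abbreviation circle_measure :: "real measure" where
  "circle_measure \<equiv> restrict_space lborel {0..<2 * pi}"

lemma finite_measure_circle: "finite_measure circle_measure"
  by (rule finite_measureI) (simp add: emeasure_restrict_space space_restrict_space)

lemma product_sigma_finite_circle: "product_sigma_finite (\<lambda>_. circle_measure)"
  by (intro product_sigma_finite.intro finite_measure.sigma_finite_measure finite_measure_circle)

lemma emeasure_torus:
  assumes "finite I"
  shows "emeasure (PiM I (\<lambda>_. circle_measure)) (space (PiM I (\<lambda>_. circle_measure))) = ennreal (2 * pi) ^ card I"
proof -
  interpret product_sigma_finite "\<lambda>_. circle_measure" by (rule product_sigma_finite_circle)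
  show ?thesis
    using emeasure_PiM[OF assms, of "\<lambda>_. {0..<2 * pi}"]
    by (simp add: space_PiM space_restrict_space emeasure_restrict_space sets_restrict_space_iff)
qed

lemma finite_measure_torus: "finite I \<Longrightarrow> finite_measure (PiM I (\<lambda>_. circle_measure))"
  by (rule finite_measureI) (simp add: emeasure_torus ennreal_power)

text \<open>Coordinates are moved into the complex plane one at a time: the induction runs over the
  set \<open>S\<close> of those already moved, Fubini isolates the next one, and
  \<open>integral_period_shift\<close> moves it. Boundedness on each translated torus gives the
  integrability that Fubini needs.\<close>

lemma torus_imaginary_shift:
  fixes F :: "('i \<Rightarrow> complex) \<Rightarrow> complex"
  assumes "finite I"
    and hol: "\<And>\<zeta> v. v \<in> I \<Longrightarrow> (\<lambda>z. F (\<zeta>(v := z))) holomorphic_on UNIV"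
    and per: "\<And>\<zeta> v. v \<in> I \<Longrightarrow> F (\<zeta>(v := \<zeta> v + of_real (2 * pi))) = F \<zeta>"
    and meas: "\<And>y. (\<lambda>\<theta>. F (\<lambda>v. of_real (\<theta> v) + \<i> * of_real (y v))) \<in> borel_measurable (PiM I (\<lambda>_. circle_measure))"
    and bdd: "\<And>y. \<exists>C. \<forall>\<theta>. cmod (F (\<lambda>v. of_real (\<theta> v) + \<i> * of_real (y v))) \<le> C"
  shows "(\<integral>\<theta>. F (\<lambda>v. of_real (\<theta> v) + \<i> * of_real (if v \<in> I then y v else 0)) \<partial>PiM I (\<lambda>_. circle_measure))
    = (\<integral>\<theta>. F (\<lambda>v. of_real (\<theta> v)) \<partial>PiM I (\<lambda>_. circle_measure))"
proof -
  interpret product_sigma_finite "\<lambda>_. circle_measure" by (rule product_sigma_finite_circle)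
  let ?P = "\<lambda>J::'i set. PiM J (\<lambda>_. circle_measure)"
  interpret torus: finite_measure "?P I" by (rule finite_measure_torus[OF assms(1)])
  have int: "integrable (?P I) (\<lambda>\<theta>. F (\<lambda>v. of_real (\<theta> v) + \<i> * of_real (y v)))" for y
  proof -
    obtain C where "\<And>\<theta>. cmod (F (\<lambda>v. of_real (\<theta> v) + \<i> * of_real (y v))) \<le> C" using bdd[of y] by blast
    then show ?thesis by (intro torus.integrable_const_bound[where B = C] meas) auto
  qed
  have "(\<integral>\<theta>. F (\<lambda>v. of_real (\<theta> v) + \<i> * of_real (if v \<in> S then y v else 0)) \<partial>?P I)
    = (\<integral>\<theta>. F (\<lambda>v. of_real (\<theta> v)) \<partial>?P I)" if "finite S" "S \<subseteq> I" for S
    using that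
  proof (induction S rule: finite_induct)
    case (insert v S)
    let ?y = "\<lambda>T w. if w \<in> T then y w else 0"
    have v: "v \<in> I" "v \<notin> S" using insert by auto
    have I: "insert v (I - {v}) = I" "finite (I - {v})" "v \<notin> I - {v}" using v assms(1) by auto
    have split: "(\<integral>\<theta>. F (\<lambda>w. of_real (\<theta> w) + \<i> * of_real (z w)) \<partial>?P I)
      = (\<integral>\<theta>. (\<integral>x. F (\<lambda>w. of_real ((\<theta>(v := x)) w) + \<i> * of_real (z w)) \<partial>circle_measure) \<partial>?P (I - {v}))" for z
      using product_integral_insert[OF I(2,3), unfolded I(1), OF int[of z]] .
    have inner: "(\<integral>x. F (\<lambda>w. of_real ((\<theta>(v := x)) w) + \<i> * of_real (?y (insert v S) w)) \<partial>circle_measure)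
      = (\<integral>x. F (\<lambda>w. of_real ((\<theta>(v := x)) w) + \<i> * of_real (?y S w)) \<partial>circle_measure)" for \<theta>
    proof -
      define \<zeta> where "\<zeta> w = complex_of_real (\<theta> w) + \<i> * of_real (?y S w)" for w
      have 1: "(\<lambda>w. of_real ((\<theta>(v := x)) w) + \<i> * of_real (?y (insert v S) w)) = \<zeta>(v := of_real x + \<i> * of_real (y v))" for x
        by (auto simp: \<zeta>_def)
      have 2: "(\<lambda>w. of_real ((\<theta>(v := x)) w) + \<i> * of_real (?y S w)) = \<zeta>(v := of_real x)" for x
        using v by (auto simp: \<zeta>_def)
      have per': "F (\<zeta>(v := z + of_real (2 * pi))) = F (\<zeta>(v := z))" for z
        using per[OF v(1), of "\<zeta>(v := z)"] by simp
      show ?thesis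
        unfolding 1 2 by (rule integral_period_shift[OF hol[OF v(1)] per'])
    qed
    have "(\<integral>\<theta>. F (\<lambda>w. of_real (\<theta> w) + \<i> * of_real (?y (insert v S) w)) \<partial>?P I)
      = (\<integral>\<theta>. F (\<lambda>w. of_real (\<theta> w) + \<i> * of_real (?y S w)) \<partial>?P I)"
      unfolding split inner ..
    also have "\<dots> = (\<integral>\<theta>. F (\<lambda>v. of_real (\<theta> v)) \<partial>?P I)" using insert by auto
    finally show ?case .
  qed simp
  from this[OF assms(1) subset_refl] show ?thesis .
qed

section \<open>The complexified Villain integrand\<close>

context pinned_network
begin

abbreviation torus :: "('v \<Rightarrow> real) measure" where
  "torus \<equiv> PiM free_verts (\<lambda>_. circle_measure)"

lemma id_circle_measurable: "(\<lambda>x. x) \<in> borel_measurable circle_measure"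
  by (rule measurable_restrict_space1) simp

lemma pin_torus: "(\<lambda>\<theta>. \<theta>(v0 := 0)) \<in> measurable torus (PiM (verts G) (\<lambda>_. borel))"
  by (rule pin_measurable[OF id_circle_measurable])

lemma torus_component:
  "v \<in> verts G \<Longrightarrow> (\<lambda>\<theta>. (\<theta>(v0 := 0)) v) \<in> borel_measurable torus"
  by (rule measurable_compose[OF pin_torus measurable_component_singleton])

definition villain_integrand :: "real \<Rightarrow> 'v \<Rightarrow> 'v \<Rightarrow> ('v \<Rightarrow> complex) \<Rightarrow> complex" where
  "villain_integrand \<beta> a b \<zeta> = exp (\<i> * ((\<zeta>(v0 := 0)) a - (\<zeta>(v0 := 0)) b)) *
    (\<Prod>e\<in>arcs G. villain_fun \<beta> ((\<zeta>(v0 := 0)) (head G e) - (\<zeta>(v0 := 0)) (tail G e)))"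

context
  fixes \<beta> :: real and a b :: 'v
  assumes \<beta>: "0 < \<beta>" and ab: "a \<in> verts G" "b \<in> verts G"
begin

private abbreviation B :: real where "B \<equiv> (2 * pi)\<^sup>2 * \<beta>"

lemma villain_integrand_holomorphic:
  assumes "v \<in> free_verts"
  shows "(\<lambda>z. villain_integrand \<beta> a b (\<zeta>(v := z))) holomorphic_on UNIV"
proof -
  have coord: "(\<lambda>z. ((\<zeta>(v := z))(v0 := 0)) w) holomorphic_on UNIV" for w
    by (cases "w = v0"; cases "w = v") (auto intro: holomorphic_intros)
  have comp: "(\<lambda>z. villain_fun \<beta> (g z)) holomorphic_on UNIV" if "g holomorphic_on UNIV" for g
    using holomorphic_on_compose_gen[OF that villain_fun_holomorphic[OF \<beta>]] by (simp add: o_def)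
  show ?thesis
    unfolding villain_integrand_def by (intro holomorphic_intros comp coord)
qed

lemma villain_integrand_periodic:
  assumes "v \<in> free_verts"
  shows "villain_integrand \<beta> a b (\<zeta>(v := \<zeta> v + of_real (2 * pi))) = villain_integrand \<beta> a b \<zeta>"
proof -
  \<comment> \<open>Shifting one angle by a full period changes each difference by an integer
    multiple of \<open>2 * pi\<close>; \<open>\<delta>\<close> records that integer.\<close>
  define \<delta> :: "'v \<Rightarrow> int" where "\<delta> w = (if w = v then 1 else 0)" for w
  let ?\<zeta> = "\<zeta>(v0 := 0)"
  have coord: "((\<zeta>(v := \<zeta> v + of_real (2 * pi)))(v0 := 0)) w = ?\<zeta> w + of_real (2 * pi * of_int (\<delta> w))" for w
    using assms by (auto simp: \<delta>_def)
  have diff: "(?\<zeta> w + of_real (2 * pi * of_int (\<delta> w))) - (?\<zeta> u + of_real (2 * pi * of_int (\<delta> u)))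
    = (?\<zeta> w - ?\<zeta> u) + of_real (2 * pi * of_int (\<delta> w - \<delta> u))" for w u
    by (simp add: algebra_simps)
  have phase: "exp (\<i> * (z + of_real (2 * pi * of_int m))) = exp (\<i> * z)" for z m
  proof -
    have "\<i> * (z + of_real (2 * pi * of_int m)) = \<i> * z + of_int (2 * m) * (of_real pi * \<i>)"
      by (simp add: algebra_simps)
    then show ?thesis unfolding exp_eq by (intro exI[of _ m]) simp
  qed
  show ?thesis
    unfolding villain_integrand_def coord diff villain_fun_periodic phase ..
qed

lemma villain_integrand_shifted:
  "villain_integrand \<beta> a b (\<lambda>v. of_real (\<theta> v) + \<i> * of_real (y v)) =
    exp (\<i> * Complex ((\<theta>(v0 := 0)) a - (\<theta>(v0 := 0)) b) ((y(v0 := 0)) a - (y(v0 := 0)) b)) *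
    (\<Prod>e\<in>arcs G. villain_fun \<beta> (Complex (gradient G (\<theta>(v0 := 0)) e) (gradient G (y(v0 := 0)) e)))"
proof -
  have "((\<lambda>v. of_real (\<theta> v) + \<i> * of_real (y v))(v0 := 0)) w - ((\<lambda>v. of_real (\<theta> v) + \<i> * of_real (y v))(v0 := 0)) u
    = Complex ((\<theta>(v0 := 0)) w - (\<theta>(v0 := 0)) u) ((y(v0 := 0)) w - (y(v0 := 0)) u)" for w u
    by (auto simp: complex_eq_iff)
  then show ?thesis by (simp only: villain_integrand_def gradient_def)
qed

lemma villain_integrand_measurable:
  "(\<lambda>\<theta>. villain_integrand \<beta> a b (\<lambda>v. of_real (\<theta> v) + \<i> * of_real (y v))) \<in> borel_measurable torus"
proof -
  have V: "(\<lambda>x. villain_fun \<beta> (Complex x c)) \<in> borel_measurable borel" for c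
    unfolding Complex_eq
    by (intro borel_measurable_continuous_onI
        continuous_on_compose2[OF holomorphic_on_imp_continuous_on[OF villain_fun_holomorphic[OF \<beta>]]]
        continuous_intros) auto
  have E: "(\<lambda>x. exp (\<i> * Complex x c)) \<in> borel_measurable borel" for c
    unfolding Complex_eq by (intro borel_measurable_continuous_onI continuous_intros)
  have grad: "(\<lambda>\<theta>. gradient G (\<theta>(v0 := 0)) e) \<in> borel_measurable torus" if "e \<in> arcs G" for e
    using that by (rule measurable_compose[OF pin_torus borel_measurable_gradient])
  show ?thesis
    unfolding villain_integrand_shifted
    by (intro borel_measurable_times borel_measurable_prod measurable_compose[OF grad V]
        measurable_compose[OF _ E] borel_measurable_diff torus_component ab)
qed

definition villain_weight :: "('v \<Rightarrow> real) \<Rightarrow> real" where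
  "villain_weight \<theta> = (\<Prod>e\<in>arcs G. gauss_total B (- gradient G (\<theta>(v0 := 0)) e / (2 * pi)))"

lemma villain_weight_pos: "0 < villain_weight \<theta>"
  unfolding villain_weight_def using \<beta> by (intro prod_pos gauss_total_pos ballI) simp

text \<open>A crude bound without any cancellation at the edges, meant for boundedness and
  integrability.\<close>

lemma norm_villain_integrand_le:
  "cmod (villain_integrand \<beta> a b (\<lambda>v. of_real (\<theta> v) + \<i> * of_real (y v)))
    \<le> exp (- ((y(v0 := 0)) a - (y(v0 := 0)) b)) * exp (\<beta> / 2 * dirichlet (y(v0 := 0)) (y(v0 := 0))) * villain_weight \<theta>"
proof -
  have "cmod (\<Prod>e\<in>arcs G. villain_fun \<beta> (Complex (gradient G (\<theta>(v0 := 0)) e) (gradient G (y(v0 := 0)) e)))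
    \<le> (\<Prod>e\<in>arcs G. exp (\<beta> / 2 * (gradient G (y(v0 := 0)) e)\<^sup>2) * gauss_total B (- gradient G (\<theta>(v0 := 0)) e / (2 * pi)))"
    unfolding prod_norm[symmetric] by (intro prod_mono conjI norm_ge_zero norm_villain_fun_le[OF \<beta>])
  also have "\<dots> = exp (\<beta> / 2 * dirichlet (y(v0 := 0)) (y(v0 := 0))) * villain_weight \<theta>"
    by (simp only: prod.distrib exp_sum[OF finite_arcs, symmetric] sum_distrib_left[symmetric] dirichlet_self villain_weight_def)
  finally show ?thesis
    unfolding villain_integrand_shifted norm_mult norm_exp_eq_Re mult.assoc
    by (intro mult_mono) auto
qed

lemma villain_weight_bounded: "\<exists>C. \<forall>\<theta>. villain_weight \<theta> \<le> C"
proof -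
  obtain C where C: "\<And>a. gauss_total B a \<le> C" using gauss_total_bounded[OF \<beta>] by blast
  have "villain_weight \<theta> \<le> (\<Prod>e\<in>arcs G. C)" for \<theta>
    unfolding villain_weight_def using \<beta> C by (intro prod_mono conjI less_imp_le[OF gauss_total_pos]) auto
  then show ?thesis by blast
qed

lemma villain_integrand_bounded:
  "\<exists>C. \<forall>\<theta>. cmod (villain_integrand \<beta> a b (\<lambda>v. of_real (\<theta> v) + \<i> * of_real (y v))) \<le> C"
proof -
  obtain C where C: "\<And>\<theta>. villain_weight \<theta> \<le> C" using villain_weight_bounded by blast
  let ?k = "exp (- ((y(v0 := 0)) a - (y(v0 := 0)) b)) * exp (\<beta> / 2 * dirichlet (y(v0 := 0)) (y(v0 := 0)))"
  have "?k * villain_weight \<theta> \<le> ?k * C" for \<theta> by (intro mult_left_mono C) auto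
  then show ?thesis using norm_villain_integrand_le by (meson order_trans)
qed

end

text \<open>Both sides are the Dirichlet pairing of the two Green functions, evaluated by the
  Poisson equation of one or of the other.\<close>

lemma reciprocity:
  assumes "a \<in> verts G" "b \<in> verts G" "e \<in> arcs G"
  shows "gradient G (green a b) e = green (head G e) (tail G e) a - green (head G e) (tail G e) b"
  using dirichlet_green[OF assms(1,2), of "green (head G e) (tail G e)"]
    dirichlet_green[of "head G e" "tail G e" "green a b"] assms(3)
  by (simp add: dirichlet_commute gradient_def)

text \<open>The edge alone contributes the square of the resistance to an energy that equals the
  resistance.\<close>

lemma arc_resistance_le_1:
  assumes "e \<in> arcs G"
  shows "resistance (head G e) (tail G e) \<le> 1"
proof -
  let ?r = "resistance (head G e) (tail G e)"
  have "gradient G (green (head G e) (tail G e)) e = ?r"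
    using assms by (simp add: resistance_eq gradient_def)
  with gradient_square_le[OF assms, of "green (head G e) (tail G e)"] have "?r * ?r \<le> 1 * ?r"
    by (simp add: resistance_def power2_eq_square)
  moreover have "0 \<le> ?r" using assms by (intro resistance_nonneg) auto
  ultimately show ?thesis by (cases "?r = 0") (auto simp: mult_le_cancel_right)
qed

text \<open>The maximum principle with \<open>W = UNIV\<close>, where no edge leaves
  \<open>W\<close> and only the poles have to be checked; for the lower bound it is applied to the
  negative.\<close>

lemma green_between:
  assumes "a \<in> verts G" "b \<in> verts G" "v \<in> verts G"
  shows "green a b b \<le> green a b v" "green a b v \<le> green a b a"
proof -
  have le: "green a b b \<le> green a b a"
    using resistance_eq[OF assms(1,2)] resistance_nonneg[OF assms(1,2)] by linarith
  show "green a b v \<le> green a b a"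
    by (rule maximum_principle[OF assms(1,2) dirichlet_green[OF assms(1,2)], where W = UNIV])
      (use le assms in auto)
  have "dirichlet (\<lambda>x. - green a b x) u = u b - u a" for u
  proof -
    have "dirichlet (\<lambda>x. - green a b x) u = - dirichlet (green a b) u"
      by (simp add: dirichlet_def gradient_def sum_negf[symmetric] algebra_simps)
    then show ?thesis by (simp add: dirichlet_green[OF assms(1,2)])
  qed
  then have "- green a b v \<le> - green a b b"
    by (rule maximum_principle[OF assms(2,1), where W = UNIV]) (use le assms in auto)
  then show "green a b b \<le> green a b v" by simp
qed

text \<open>By \<open>reciprocity\<close> this is a difference of two values of the dipole potential
  of \<open>e\<close>, whose range is the resistance across \<open>e\<close>.\<close>

lemma abs_gradient_green_le_1:
  assumes "a \<in> verts G" "b \<in> verts G" "e \<in> arcs G"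
  shows "\<bar>gradient G (green a b) e\<bar> \<le> 1"
proof -
  have ht: "head G e \<in> verts G" "tail G e \<in> verts G" using assms(3) by auto
  from green_between[OF ht assms(1)] green_between[OF ht assms(2)]
    arc_resistance_le_1[OF assms(3)] resistance_eq[OF ht] show ?thesis
    unfolding reciprocity[OF assms] by linarith
qed

end

section \<open>The Villain two-point function and the effective resistance\<close>

lemma integral_normalized_density:
  fixes w h :: "'a \<Rightarrow> real"
  assumes [measurable]: "h \<in> borel_measurable M" and w: "integrable M w" "\<And>x. 0 \<le> w x"
    and Z: "0 < (\<integral>x. w x \<partial>M)"
  shows "(\<integral>x. h x \<partial>normalized_density M w) = (\<integral>x. w x * h x \<partial>M) / (\<integral>x. w x \<partial>M)"
proof -
  have [measurable]: "w \<in> borel_measurable M" using w by auto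
  have "(\<integral>\<^sup>+x. ennreal (w x) \<partial>M) = ennreal (\<integral>x. w x \<partial>M)"
    using w by (intro nn_integral_eq_integral) auto
  then have "normalized_density M w = density M (\<lambda>x. ennreal (w x / (\<integral>x. w x \<partial>M)))"
    unfolding normalized_density_def using w Z by (simp add: divide_ennreal)
  then show ?thesis
    using w Z by (simp add: integral_density)
qed

text \<open>The gain over the plain modulus bound at an edge with gradient \<open>s\<close>; on
  steep edges, beyond the reach of \<open>gauss_char_le\<close>, no gain is claimed.\<close>

definition edge_factor :: "real \<Rightarrow> real \<Rightarrow> real" where
  "edge_factor \<beta> s = (if \<bar>s\<bar> \<le> 1 / 10 then exp (- pi\<^sup>2 * s\<^sup>2 * min_variance \<beta>) else 1)"

lemma norm_villain_fun_le_edge_factor: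
  assumes \<beta>: "1 / 3 \<le> \<beta>"
  shows "cmod (villain_fun \<beta> (Complex x (s / \<beta>)))
    \<le> exp (s\<^sup>2 / (2 * \<beta>)) * edge_factor \<beta> s * gauss_total ((2 * pi)\<^sup>2 * \<beta>) (- x / (2 * pi))"
proof -
  have \<beta>0: "0 < \<beta>" using \<beta> by simp
  have e: "\<beta> / 2 * (s / \<beta>)\<^sup>2 = s\<^sup>2 / (2 * \<beta>)" "- \<beta> * (s / \<beta>) = - s"
    using \<beta>0 by (auto simp: power2_eq_square)
  let ?S = "\<Sum>\<^sub>\<infinity>k. complex_of_real (gauss ((2 * pi)\<^sup>2 * \<beta>) (- x / (2 * pi)) k) * cis (2 * pi * (- s) * real_of_int k)"
  have N: "cmod (villain_fun \<beta> (Complex x (s / \<beta>))) = exp (s\<^sup>2 / (2 * \<beta>)) * cmod ?S"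
    by (simp only: villain_fun_eq e norm_mult norm_of_real norm_cis abs_exp_cancel mult_1_right)
  show ?thesis
  proof (cases "\<bar>s\<bar> \<le> 1 / 10")
    case True
    have "cmod ?S \<le> exp (- pi\<^sup>2 * (- s)\<^sup>2 * min_variance \<beta>) * gauss_total ((2 * pi)\<^sup>2 * \<beta>) (- x / (2 * pi))"
      by (rule gauss_char_le[OF coupling_ge[OF \<beta>] _ min_variance_le[OF \<beta>, unfolded minus_divide_left]])
        (use True in auto)
    from mult_left_mono[OF this, of "exp (s\<^sup>2 / (2 * \<beta>))"] True show ?thesis
      unfolding N by (simp add: edge_factor_def mult.assoc)
  next
    case False
    then show ?thesis using norm_villain_fun_le[OF \<beta>0, of x "s / \<beta>", unfolded e] by (simp add: edge_factor_def)
  qed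
qed

text \<open>The Gaussian factor is inserted on steep edges as well, so that the exponent collects
  the whole energy. Paying it back costs at most \<open>exp (pi\<^sup>2)\<close> per steep edge, as
  the gradient and the variance there are at most 1.\<close>

lemma (in pinned_network) prod_edge_factor_le:
  assumes \<beta>: "1 / 3 \<le> \<beta>" and ab: "a \<in> verts G" "b \<in> verts G"
  defines "f \<equiv> green a b"
  shows "(\<Prod>e\<in>arcs G. edge_factor \<beta> (gradient G f e))
    \<le> exp (pi\<^sup>2 * real (card {e \<in> arcs G. 1 / 10 < \<bar>gradient G f e\<bar>})) * exp (- pi\<^sup>2 * min_variance \<beta> * resistance a b)"
proof -
  let ?v = "min_variance \<beta>"
  define bad where "bad = {e \<in> arcs G. 1 / 10 < \<bar>gradient G f e\<bar>}"
  have "(\<Prod>e\<in>arcs G. edge_factor \<beta> (gradient G f e))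
    = (\<Prod>e\<in>arcs G. exp (- pi\<^sup>2 * ?v * (gradient G f e)\<^sup>2 + pi\<^sup>2 * ?v * (if e \<in> bad then (gradient G f e)\<^sup>2 else 0)))"
    by (intro prod.cong refl) (auto simp: edge_factor_def bad_def)
  also have "\<dots> = exp (- pi\<^sup>2 * ?v * resistance a b + pi\<^sup>2 * ?v * (\<Sum>e\<in>bad. (gradient G f e)\<^sup>2))"
  proof -
    have "(\<Sum>e\<in>bad. (gradient G f e)\<^sup>2) = (\<Sum>e\<in>arcs G. if e \<in> bad then (gradient G f e)\<^sup>2 else 0)"
      by (subst sum.inter_restrict[symmetric]) (auto simp: bad_def intro!: sum.cong)
    then show ?thesis
      by (simp only: exp_sum[OF finite_arcs, symmetric] sum.distrib sum_distrib_left[symmetric] resistance_def f_def[symmetric] dirichlet_self)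
  qed
  also have "\<dots> \<le> exp (- pi\<^sup>2 * ?v * resistance a b + pi\<^sup>2 * real (card bad))"
  proof -
    have "(\<Sum>e\<in>bad. (gradient G f e)\<^sup>2) \<le> (\<Sum>e\<in>bad. 1)"
      using abs_gradient_green_le_1[OF ab] by (intro sum_mono) (auto simp: bad_def f_def abs_square_le_1)
    then have "?v * (\<Sum>e\<in>bad. (gradient G f e)\<^sup>2) \<le> 1 * real (card bad)"
      using min_variance_nonneg[of \<beta>] min_variance_le_1[OF \<beta>] by (intro mult_mono) (auto intro: sum_nonneg)
    from mult_left_mono[OF this, of "pi\<^sup>2"] show ?thesis by (simp add: mult.assoc)
  qed
  finally show ?thesis by (simp add: exp_add[symmetric] bad_def add.commute)
qed

lemma (in pinned_network) villain_law_eq: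
  assumes "0 < \<beta>"
  shows "villain_law G v0 \<beta> = normalized_density (distr torus (PiM (verts G) (\<lambda>_. borel)) (\<lambda>\<theta>. \<theta>(v0 := 0)))
    (\<lambda>\<theta>. \<Prod>e\<in>arcs G. gauss_total ((2 * pi)\<^sup>2 * \<beta>) (- gradient G \<theta> e / (2 * pi)))"
proof -
  have "(\<Sum>\<^sub>\<infinity>k::int. exp (- \<beta> / 2 * (x + 2 * pi * real_of_int k)\<^sup>2)) = gauss_total ((2 * pi)\<^sup>2 * \<beta>) (- x / (2 * pi))" for x
  proof -
    have "gauss ((2 * pi)\<^sup>2 * \<beta>) (- x / (2 * pi)) k = exp (- \<beta> / 2 * (x + 2 * pi * real_of_int k)\<^sup>2)" for k
    proof -
      have "real_of_int k - (- x / (2 * pi)) = (x + 2 * pi * real_of_int k) / (2 * pi)" by (simp add: field_simps)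
      then show ?thesis by (simp add: gauss_def power_divide power_mult_distrib)
    qed
    then show ?thesis by (simp add: gauss_total_def)
  qed
  then show ?thesis by (simp only: villain_law_def pinned_product_def)
qed

lemma (in pinned_network) villain_correlation_le:
  assumes \<beta>: "1 / 3 \<le> \<beta>" and ab: "a \<in> verts G" "b \<in> verts G"
  shows "prob_space.expectation (villain_law G v0 \<beta>) (\<lambda>\<theta>. cos (\<theta> a - \<theta> b))
    \<le> exp (pi\<^sup>2 * real (card {e \<in> arcs G. 1 / 10 < \<bar>gradient G (green a b) e\<bar>}))
      * exp (- pi\<^sup>2 * min_variance \<beta> * resistance a b) * exp (- resistance a b / (2 * \<beta>))"
proof -
  have \<beta>0: "0 < \<beta>" using \<beta> by simp
  define f where "f = green a b"
  define E where "E = resistance a b"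
  define R where "R = (\<Prod>e\<in>arcs G. edge_factor \<beta> (gradient G f e))"
  let ?w = "villain_weight \<beta>"
  let ?F = "villain_integrand \<beta> a b"
  interpret torus: finite_measure torus by (rule finite_measure_torus) simp
  have F_real: "?F (\<lambda>v. of_real (\<theta> v)) = cis (height a b \<theta>) * of_real (?w \<theta>)" for \<theta>
  proof -
    have c: "Complex x 0 = of_real x" for x by (simp add: complex_of_real_def)
    have p: "(\<lambda>v. 0)(v0 := 0) = (\<lambda>v. 0::real)" by auto
    show ?thesis
      using villain_integrand_shifted[OF \<beta>0 ab, of \<theta> "\<lambda>_. 0"]
      unfolding p
      by (simp add: c gradient_def[where w = "\<lambda>_. 0"] villain_fun_real[OF \<beta>0] villain_weight_def[OF \<beta>0 ab] height_def cis_conv_exp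
        del: fun_upd_apply)
  qed
  have F_meas: "(\<lambda>\<theta>. ?F (\<lambda>v. of_real (\<theta> v))) \<in> borel_measurable torus"
    using villain_integrand_measurable[OF \<beta>0 ab, of "\<lambda>_. 0"] by simp
  have w_eq: "?w \<theta> = cmod (?F (\<lambda>v. of_real (\<theta> v)))" for \<theta>
    unfolding F_real using villain_weight_pos[OF \<beta>0 ab, of \<theta>] by (simp add: norm_mult)
  have w_meas: "?w \<in> borel_measurable torus"
    unfolding w_eq using F_meas by measurable
  obtain C where C: "\<And>\<theta>. ?w \<theta> \<le> C" using villain_weight_bounded[OF \<beta>0 ab] by blast
  have w_int: "integrable torus ?w"
    by (rule torus.integrable_const_bound[where B = C])
      (use C villain_weight_pos[OF \<beta>0 ab] w_meas in \<open>auto simp: abs_of_pos\<close>)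
  have F_int: "integrable torus (\<lambda>\<theta>. ?F (\<lambda>v. of_real (\<theta> v)))"
    by (rule Bochner_Integration.integrable_bound[OF w_int F_meas]) (simp add: w_eq)
  define Z where "Z = (\<integral>\<theta>. ?w \<theta> \<partial>torus)"
  have "0 \<noteq> (\<integral>\<^sup>+\<theta>. ennreal (?w \<theta>) \<partial>torus)"
    using nn_integral_pos_neq_0[OF w_meas villain_weight_pos[OF \<beta>0 ab]] by (simp add: emeasure_torus)
  also have "(\<integral>\<^sup>+\<theta>. ennreal (?w \<theta>) \<partial>torus) = ennreal Z"
    unfolding Z_def using w_int villain_weight_pos[OF \<beta>0 ab] by (intro nn_integral_eq_integral) (auto simp: less_imp_le)
  finally have Z: "0 < Z" by (metis ennreal_neg linorder_not_le)
  let ?W = "\<lambda>\<theta>. \<Prod>e\<in>arcs G. gauss_total ((2 * pi)\<^sup>2 * \<beta>) (- gradient G \<theta> e / (2 * pi))"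
  have "villain_fun \<beta> (of_real x) = of_real (gauss_total ((2 * pi)\<^sup>2 * \<beta>) (- x / (2 * pi)))" for x
    by (rule villain_fun_real[OF \<beta>0])
  then have gt: "gauss_total ((2 * pi)\<^sup>2 * \<beta>) (- x / (2 * pi)) = Re (villain_fun \<beta> (of_real x))" for x by simp
  have "(\<lambda>x. Re (villain_fun \<beta> (of_real x))) \<in> borel_measurable borel"
    by (intro borel_measurable_continuous_onI continuous_intros
        continuous_on_compose2[OF holomorphic_on_imp_continuous_on[OF villain_fun_holomorphic[OF \<beta>0]]]) auto
  then have W_meas: "?W \<in> borel_measurable (PiM (verts G) (\<lambda>_. borel))"
    unfolding gt by (intro borel_measurable_prod measurable_compose[OF borel_measurable_gradient])
  have cos_meas: "(\<lambda>\<theta>. cos (\<theta> a - \<theta> b :: real)) \<in> borel_measurable (PiM (verts G) (\<lambda>_. borel))"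
  proof -
    have [measurable]: "(\<lambda>\<theta>. \<theta> a - \<theta> b :: real) \<in> borel_measurable (PiM (verts G) (\<lambda>_. borel))"
      using ab by (intro borel_measurable_diff measurable_component_singleton)
    show ?thesis by measurable
  qed
  have W_w: "?W (\<theta>(v0 := 0)) = ?w \<theta>" for \<theta> by (simp add: villain_weight_def[OF \<beta>0 ab])
  have expect: "prob_space.expectation (villain_law G v0 \<beta>) (\<lambda>\<theta>. cos (\<theta> a - \<theta> b))
    = (\<integral>\<theta>. ?w \<theta> * cos (height a b \<theta>) \<partial>torus) / Z"
    unfolding villain_law_eq[OF \<beta>0]
  proof (subst integral_normalized_density)
    show "integrable (distr torus (PiM (verts G) (\<lambda>_. borel)) (\<lambda>\<theta>. \<theta>(v0 := 0))) ?W"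
      using w_int by (subst integrable_distr_eq[OF pin_torus W_meas]) (simp only: W_w)
    show "0 < (\<integral>\<theta>. ?W \<theta> \<partial>distr torus (PiM (verts G) (\<lambda>_. borel)) (\<lambda>\<theta>. \<theta>(v0 := 0)))"
      using Z by (subst integral_distr[OF pin_torus W_meas]) (simp only: W_w Z_def)
    show "0 \<le> ?W \<theta>" for \<theta>
      using \<beta>0 by (intro prod_nonneg less_imp_le[OF gauss_total_pos]) simp
    show "(\<integral>\<theta>. ?W \<theta> * cos (\<theta> a - \<theta> b) \<partial>distr torus (PiM (verts G) (\<lambda>_. borel)) (\<lambda>\<theta>. \<theta>(v0 := 0)))
        / (\<integral>\<theta>. ?W \<theta> \<partial>distr torus (PiM (verts G) (\<lambda>_. borel)) (\<lambda>\<theta>. \<theta>(v0 := 0)))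
      = (\<integral>\<theta>. ?w \<theta> * cos (height a b \<theta>) \<partial>torus) / Z"
      by (subst integral_distr[OF pin_torus borel_measurable_times[OF W_meas cos_meas]],
          subst integral_distr[OF pin_torus W_meas]) (simp only: W_w Z_def height_def)
  qed (use cos_meas in simp)
  \<comment> \<open>The shift by \<open>f / \<beta>\<close> minimises the exponent
    \<open>- (y a - y b) + \<beta> / 2 * dirichlet y y\<close>; its minimum is
    \<open>- E / (2 * \<beta>)\<close>, the exponent of the Gaussian field.\<close>
  let ?y = "\<lambda>v. if v \<in> free_verts then f v / \<beta> else 0"
  let ?Fy = "\<lambda>\<theta>. ?F (\<lambda>v. of_real (\<theta> v) + \<i> * of_real (?y v))"
  have "(\<integral>\<theta>. ?w \<theta> * cos (height a b \<theta>) \<partial>torus) = Re (\<integral>\<theta>. ?F (\<lambda>v. of_real (\<theta> v)) \<partial>torus)"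
    by (subst integral_Re[OF F_int, symmetric]) (simp add: F_real mult.commute)
  also have "\<dots> \<le> cmod (\<integral>\<theta>. ?F (\<lambda>v. of_real (\<theta> v)) \<partial>torus)" by (rule complex_Re_le_cmod)
  also have "(\<integral>\<theta>. ?F (\<lambda>v. of_real (\<theta> v)) \<partial>torus) = (\<integral>\<theta>. ?Fy \<theta> \<partial>torus)"
  proof (rule torus_imaginary_shift[symmetric])
    show "finite free_verts" by simp
  qed (fact villain_integrand_holomorphic[OF \<beta>0 ab] villain_integrand_periodic[OF \<beta>0 ab]
        villain_integrand_measurable[OF \<beta>0 ab] villain_integrand_bounded[OF \<beta>0 ab])+
  also have "cmod (\<integral>\<theta>. ?Fy \<theta> \<partial>torus) \<le> (\<integral>\<theta>. cmod (?Fy \<theta>) \<partial>torus)"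
    by (rule integral_norm_bound)
  also have "\<dots> \<le> (\<integral>\<theta>. exp (- E / (2 * \<beta>)) * R * ?w \<theta> \<partial>torus)"
  proof (rule integral_mono)
    obtain C where C: "\<And>\<theta>. cmod (?Fy \<theta>) \<le> C"
      using villain_integrand_bounded[OF \<beta>0 ab, of ?y] by blast
    then show "integrable torus (\<lambda>\<theta>. cmod (?Fy \<theta>))"
      by (intro integrable_norm torus.integrable_const_bound[where B = C] villain_integrand_measurable[OF \<beta>0 ab]) auto
    show "integrable torus (\<lambda>\<theta>. exp (- E / (2 * \<beta>)) * R * ?w \<theta>)" using w_int by (intro integrable_mult_right)
    fix \<theta>
    have f0: "f v0 = 0" unfolding f_def by (rule green_pinned[OF ab])
    have y: "(?y(v0 := 0)) v = f v / \<beta>" if "v \<in> verts G" for v using that f0 by auto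
    have gy: "gradient G (?y(v0 := 0)) e = gradient G f e / \<beta>" if "e \<in> arcs G" for e
      unfolding gradient_def using that by (simp only: y head_in_verts tail_in_verts diff_divide_distrib)
    have "f a - f b = E" by (simp add: f_def E_def resistance_eq[OF ab])
    then have ya: "(?y(v0 := 0)) a - (?y(v0 := 0)) b = E / \<beta>"
      by (simp only: y[OF ab(1)] y[OF ab(2)] diff_divide_distrib[symmetric])
    have P: "(\<Prod>e\<in>arcs G. cmod (villain_fun \<beta> (Complex (gradient G (\<theta>(v0 := 0)) e) (gradient G (?y(v0 := 0)) e))))
      = (\<Prod>e\<in>arcs G. cmod (villain_fun \<beta> (Complex (gradient G (\<theta>(v0 := 0)) e) (gradient G f e / \<beta>))))"
      by (intro prod.cong refl) (simp only: gy)
    have "cmod (?F (\<lambda>v. of_real (\<theta> v) + \<i> * of_real (?y v)))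
      = exp (- (E / \<beta>)) * (\<Prod>e\<in>arcs G. cmod (villain_fun \<beta> (Complex (gradient G (\<theta>(v0 := 0)) e) (gradient G f e / \<beta>))))"
      unfolding villain_integrand_shifted[OF \<beta>0 ab] norm_mult norm_exp_eq_Re ya prod_norm[symmetric]
      unfolding P by simp
    also have "\<dots> \<le> exp (- (E / \<beta>)) * (\<Prod>e\<in>arcs G. exp ((gradient G f e)\<^sup>2 / (2 * \<beta>)) * edge_factor \<beta> (gradient G f e)
        * gauss_total ((2 * pi)\<^sup>2 * \<beta>) (- gradient G (\<theta>(v0 := 0)) e / (2 * pi)))"
      by (intro mult_left_mono prod_mono conjI norm_ge_zero norm_villain_fun_le_edge_factor[OF \<beta>] exp_ge_zero)
    also have "(\<Prod>e\<in>arcs G. exp ((gradient G f e)\<^sup>2 / (2 * \<beta>)) * edge_factor \<beta> (gradient G f e)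
        * gauss_total ((2 * pi)\<^sup>2 * \<beta>) (- gradient G (\<theta>(v0 := 0)) e / (2 * pi))) = exp (E / (2 * \<beta>)) * R * ?w \<theta>"
      by (simp only: prod.distrib exp_sum[OF finite_arcs, symmetric] sum_divide_distrib[symmetric] villain_weight_def[OF \<beta>0 ab] R_def
          E_def f_def resistance_def dirichlet_self)
    also have "exp (- (E / \<beta>)) * (exp (E / (2 * \<beta>)) * R * ?w \<theta>) = exp (- E / (2 * \<beta>)) * R * ?w \<theta>"
    proof -
      have "- (E / \<beta>) + E / (2 * \<beta>) = - E / (2 * \<beta>)" using \<beta>0 by (simp add: field_simps)
      then have "exp (- (E / \<beta>)) * exp (E / (2 * \<beta>)) = exp (- E / (2 * \<beta>))" by (simp only: exp_add[symmetric])
      then show ?thesis by (simp only: mult.assoc[symmetric])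
    qed
    finally show "cmod (?Fy \<theta>) \<le> exp (- E / (2 * \<beta>)) * R * ?w \<theta>" .
  qed
  also have "\<dots> = exp (- E / (2 * \<beta>)) * R * Z" unfolding Z_def by (rule integral_mult_right_zero)
  finally have "prob_space.expectation (villain_law G v0 \<beta>) (\<lambda>\<theta>. cos (\<theta> a - \<theta> b)) \<le> exp (- E / (2 * \<beta>)) * R"
    unfolding expect using Z by (simp only: pos_divide_le_eq)
  also have "\<dots> \<le> exp (- E / (2 * \<beta>)) * (exp (pi\<^sup>2 * real (card {e \<in> arcs G. 1 / 10 < \<bar>gradient G f e\<bar>})) * exp (- pi\<^sup>2 * min_variance \<beta> * E))"
    unfolding R_def f_def E_def by (intro mult_left_mono prod_edge_factor_le[OF \<beta> ab]) simp
  finally show ?thesis by (simp add: f_def E_def mult_ac)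
qed

section \<open>Rings in the square lattice\<close>

lemma abs_diff_le_sum_steps:
  fixes h :: "int \<Rightarrow> real"
  assumes "a \<le> b"
  shows "\<bar>h b - h a\<bar> \<le> (\<Sum>i\<in>{a..<b}. \<bar>h (i + 1) - h i\<bar>)"
  using assms
proof (induction b rule: int_ge_induct)
  case (step i)
  have "{a..<i + 1} = insert i {a..<i}" using step by auto
  then show ?case using step by simp
qed simp

definition sup_dist :: "int \<times> int \<Rightarrow> int \<times> int \<Rightarrow> int" where
  "sup_dist c p = max \<bar>fst p - fst c\<bar> \<bar>snd p - snd c\<bar>"

definition ring_edges :: "int set \<Rightarrow> int \<times> int \<Rightarrow> int \<Rightarrow> ((int \<times> int) \<times> (int \<times> int)) set" where
  "ring_edges J c r = {(p, q) \<in> nn_edges. p \<in> J \<times> J \<and> q \<in> J \<times> J \<and> sup_dist c p = r \<and> sup_dist c q = r}"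

lemma ring_edges_card:
  assumes "1 \<le> r"
  shows "finite (ring_edges J c r)" "int (card (ring_edges J c r)) \<le> 8 * r"
proof -
  obtain c1 c2 where c: "c = (c1, c2)" by (cases c)
  define A where "A = (\<lambda>i. ((i, c2 + r), (i + 1, c2 + r))) ` {c1 - r..<c1 + r}"
  define B where "B = (\<lambda>i. ((i, c2 - r), (i + 1, c2 - r))) ` {c1 - r..<c1 + r}"
  define C where "C = (\<lambda>i. ((c1 + r, i), (c1 + r, i + 1))) ` {c2 - r..<c2 + r}"
  define D where "D = (\<lambda>i. ((c1 - r, i), (c1 - r, i + 1))) ` {c2 - r..<c2 + r}"
  have sub: "ring_edges J c r \<subseteq> (A \<union> B) \<union> (C \<union> D)"
  proof
    fix e assume "e \<in> ring_edges J c r"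
    then obtain x y q where e: "e = ((x, y), q)" "q = (x + 1, y) \<or> q = (x, y + 1)"
      "sup_dist c (x, y) = r" "sup_dist c q = r"
      by (auto simp: ring_edges_def nn_edges_def)
    from e(2) show "e \<in> (A \<union> B) \<union> (C \<union> D)"
    proof
      assume q: "q = (x + 1, y)"
      with e(3,4) assms have "y = c2 + r \<or> y = c2 - r" "x \<in> {c1 - r..<c1 + r}"
        by (auto simp: sup_dist_def c max_def abs_if split: if_splits)
      then show ?thesis by (auto simp: e(1) q A_def B_def)
    next
      assume q: "q = (x, y + 1)"
      with e(3,4) assms have "x = c1 + r \<or> x = c1 - r" "y \<in> {c2 - r..<c2 + r}"
        by (auto simp: sup_dist_def c max_def abs_if split: if_splits)
      then show ?thesis by (auto simp: e(1) q C_def D_def)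
    qed
  qed
  have fin: "finite ((A \<union> B) \<union> (C \<union> D))" by (simp add: A_def B_def C_def D_def)
  then show "finite (ring_edges J c r)" using sub finite_subset by blast
  have k: "card A \<le> nat (2 * r)" "card B \<le> nat (2 * r)" "card C \<le> nat (2 * r)" "card D \<le> nat (2 * r)"
    unfolding A_def B_def C_def D_def by (rule order_trans[OF card_image_le]; simp)+
  have "card (ring_edges J c r) \<le> card ((A \<union> B) \<union> (C \<union> D))" by (rule card_mono[OF fin sub])
  also have "\<dots> \<le> nat (8 * r)"
    using k card_Un_le[of "A \<union> B" "C \<union> D"] card_Un_le[of A B] card_Un_le[of C D] by linarith
  finally show "int (card (ring_edges J c r)) \<le> 8 * r" using assms by linarith
qed

definition ring_variation :: "int set \<Rightarrow> int \<times> int \<Rightarrow> int \<Rightarrow> (int \<times> int \<Rightarrow> real) \<Rightarrow> real" where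
  "ring_variation J c r h = (\<Sum>(p, q)\<in>ring_edges J c r. \<bar>h q - h p\<bar>)"

text \<open>
  The part of a ring inside a square \<open>J \<times> J\<close> containing one of its corners is connected: every
  point of it is joined to that corner by at most two straight segments.
\<close>
lemma ring_oscillation:
  assumes J: "\<And>a b t. a \<in> J \<Longrightarrow> b \<in> J \<Longrightarrow> a \<le> t \<Longrightarrow> t \<le> b \<Longrightarrow> t \<in> J"
    and r: "1 \<le> r"
    and k: "k1 \<in> J" "k2 \<in> J" "\<bar>k1 - fst c\<bar> = r" "\<bar>k2 - snd c\<bar> = r"
    and p: "p \<in> J \<times> J" "sup_dist c p = r"
  shows "\<bar>h p - h (k1, k2)\<bar> \<le> 2 * ring_variation J c r h"
proof -
  let ?L = "ring_variation J c r h"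
  note fin = ring_edges_card(1)[OF r, of J c]
  \<comment> \<open>The steps of a straight segment are distinct ring edges, so their variation is a
    partial sum of the ring variation.\<close>
  have sub_le: "(\<Sum>i\<in>{a..<b}. \<bar>h (snd (e i)) - h (fst (e i))\<bar>) \<le> ?L"
    if "\<And>i. i \<in> {a..<b} \<Longrightarrow> e i \<in> ring_edges J c r" "inj e" for e :: "int \<Rightarrow> _" and a b
  proof -
    have "(\<Sum>i\<in>{a..<b}. \<bar>h (snd (e i)) - h (fst (e i))\<bar>) = (\<Sum>x\<in>e ` {a..<b}. \<bar>h (snd x) - h (fst x)\<bar>)"
      using that(2) by (subst sum.reindex) (auto intro: inj_on_subset)
    also have "\<dots> \<le> (\<Sum>x\<in>ring_edges J c r. \<bar>h (snd x) - h (fst x)\<bar>)"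
      using that(1) by (intro sum_mono2 fin) auto
    finally show ?thesis by (simp add: ring_variation_def case_prod_beta)
  qed
  have hor: "\<bar>h (b, y) - h (a, y)\<bar> \<le> ?L"
    if "a \<le> b" "a \<in> J" "b \<in> J" "y \<in> J" and R: "\<And>t. a \<le> t \<Longrightarrow> t \<le> b \<Longrightarrow> sup_dist c (t, y) = r" for a b y
  proof -
    have e: "((t, y), (t + 1, y)) \<in> ring_edges J c r" if t: "t \<in> {a..<b}" for t
    proof -
      have "t \<in> J" "t + 1 \<in> J" using J[OF \<open>a \<in> J\<close> \<open>b \<in> J\<close>] t by auto
      then show ?thesis using \<open>y \<in> J\<close> R[of t] R[of "t + 1"] t by (simp add: ring_edges_def nn_edges_def)
    qed
    show ?thesis
      using abs_diff_le_sum_steps[OF that(1), of "\<lambda>t. h (t, y)"] sub_le[of a b "\<lambda>t. ((t, y), (t + 1, y))", OF e]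
      by (simp add: inj_def)
  qed
  have ver: "\<bar>h (x, b) - h (x, a)\<bar> \<le> ?L"
    if "a \<le> b" "a \<in> J" "b \<in> J" "x \<in> J" and R: "\<And>t. a \<le> t \<Longrightarrow> t \<le> b \<Longrightarrow> sup_dist c (x, t) = r" for a b x
  proof -
    have e: "((x, t), (x, t + 1)) \<in> ring_edges J c r" if t: "t \<in> {a..<b}" for t
    proof -
      have "t \<in> J" "t + 1 \<in> J" using J[OF \<open>a \<in> J\<close> \<open>b \<in> J\<close>] t by auto
      then show ?thesis using \<open>x \<in> J\<close> R[of t] R[of "t + 1"] t by (simp add: ring_edges_def nn_edges_def)
    qed
    show ?thesis
      using abs_diff_le_sum_steps[OF that(1), of "\<lambda>t. h (x, t)"] sub_le[of a b "\<lambda>t. ((x, t), (x, t + 1))", OF e]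
      by (simp add: inj_def)
  qed
  have hor': "\<bar>h (a, y) - h (b, y)\<bar> \<le> ?L"
    if "a \<in> J" "b \<in> J" "y \<in> J" "\<bar>y - snd c\<bar> = r" "\<bar>a - fst c\<bar> \<le> r" "\<bar>b - fst c\<bar> \<le> r" for a b y
    using hor[of a b y] hor[of b a y] that by (cases "a \<le> b") (auto simp: sup_dist_def abs_minus_commute)
  have ver': "\<bar>h (x, a) - h (x, b)\<bar> \<le> ?L"
    if "a \<in> J" "b \<in> J" "x \<in> J" "\<bar>x - fst c\<bar> = r" "\<bar>a - snd c\<bar> \<le> r" "\<bar>b - snd c\<bar> \<le> r" for a b x
    using ver[of a b x] ver[of b a x] that by (cases "a \<le> b") (auto simp: sup_dist_def abs_minus_commute)
  obtain p1 p2 where p_eq: "p = (p1, p2)" by (cases p)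
  have p12: "p1 \<in> J" "p2 \<in> J" "\<bar>p1 - fst c\<bar> \<le> r" "\<bar>p2 - snd c\<bar> \<le> r" "\<bar>p1 - fst c\<bar> = r \<or> \<bar>p2 - snd c\<bar> = r"
    using p by (auto simp: p_eq sup_dist_def)
  from p12(5) show ?thesis
  proof
    assume "\<bar>p1 - fst c\<bar> = r"
    \<comment> \<open>Along the vertical side of \<open>p\<close> to the height of the corner, then
      along the horizontal side containing the corner.\<close>
    then have "\<bar>h (p1, p2) - h (p1, k2)\<bar> \<le> ?L" using p12 k by (intro ver') auto
    moreover have "\<bar>h (p1, k2) - h (k1, k2)\<bar> \<le> ?L" using p12 k by (intro hor') auto
    ultimately show ?thesis by (simp add: p_eq)
  next
    assume "\<bar>p2 - snd c\<bar> = r"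
    then have "\<bar>h (p1, p2) - h (k1, p2)\<bar> \<le> ?L" using p12 k by (intro hor') auto
    moreover have "\<bar>h (k1, p2) - h (k1, k2)\<bar> \<le> ?L" using p12 k by (intro ver') auto
    ultimately show ?thesis by (simp add: p_eq)
  qed
qed

text \<open>
  The Courant--Lebesgue argument: rings have length \<open>O(r)\<close> and \<open>\<Sum> 1 / r\<close> diverges, so bounded energy
  forces a small variation on one of the first \<open>R\<close> rings.
\<close>
lemma ex_ring_small_variation:
  fixes \<delta> :: real
  assumes "0 < \<delta>"
  shows "\<exists>R::nat. \<forall>J c h. (\<Sum>r\<in>{1..R}. \<Sum>(p, q)\<in>ring_edges J c (int r). (h q - h p)\<^sup>2) \<le> 1 \<longrightarrow>
      (\<exists>r\<in>{1..R}. ring_variation J c (int r) h \<le> \<delta>)"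
proof -
  have "\<not> summable (\<lambda>n. inverse (real (Suc n)))"
    using not_summable_harmonic summable_Suc_iff[of "\<lambda>n. inverse (real n)"] by blast
  \<comment> \<open>Ring \<open>r\<close> has at most \<open>8 * r\<close> edges, so by
    Cauchy--Schwarz a variation above \<delta> costs energy at least
    \<open>\<delta>\<^sup>2 / (8 * r)\<close>.\<close>
  then have "\<not> (\<forall>n. (\<Sum>i<n. inverse (real (Suc i))) \<le> 8 / \<delta>\<^sup>2)"
    using summableI_nonneg_bounded[of "\<lambda>n. inverse (real (Suc n))" "8 / \<delta>\<^sup>2"] by auto
  then obtain R where "8 / \<delta>\<^sup>2 < (\<Sum>i<R. inverse (real (Suc i)))" by (auto simp: not_le)
  also have "\<dots> = (\<Sum>r\<in>{1..R}. 1 / real r)"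
    by (rule sum.reindex_bij_witness[of _ "\<lambda>r. r - 1" Suc]) (auto simp: inverse_eq_divide)
  finally have R: "8 / \<delta>\<^sup>2 < (\<Sum>r\<in>{1..R}. 1 / real r)" .
  show ?thesis
  proof (intro exI[of _ R] allI impI)
    fix J c and h :: "int \<times> int \<Rightarrow> real"
    let ?D = "\<lambda>r. \<Sum>(p, q)\<in>ring_edges J c (int r). (h q - h p)\<^sup>2"
    let ?V = "\<lambda>r. ring_variation J c (int r) h"
    assume le1: "(\<Sum>r\<in>{1..R}. ?D r) \<le> 1"
    show "\<exists>r\<in>{1..R}. ?V r \<le> \<delta>"
    proof (rule ccontr)
      assume "\<not> (\<exists>r\<in>{1..R}. ?V r \<le> \<delta>)"
      then have V: "\<delta> < ?V r" if "r \<in> {1..R}" for r using that by (auto simp: not_le)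
      have "\<delta>\<^sup>2 / 8 * (1 / real r) \<le> ?D r" if r: "r \<in> {1..R}" for r
      proof -
        have r1: "1 \<le> int r" using r by auto
        have D0: "0 \<le> ?D r" by (intro sum_nonneg) auto
        have "\<delta>\<^sup>2 \<le> (?V r)\<^sup>2" using V[OF r] assms by (intro power_mono) auto
        also have "(?V r)\<^sup>2 \<le> real (card (ring_edges J c (int r))) * ?D r"
          unfolding ring_variation_def
          using sum_squared_le_sum_of_squares[of "\<lambda>(p, q). \<bar>h q - h p\<bar>" "ring_edges J c (int r)"]
          by (simp add: case_prod_beta mult.commute)
        also have "\<dots> \<le> (8 * real r) * ?D r"
        proof (rule mult_right_mono[OF _ D0])
          show "real (card (ring_edges J c (int r))) \<le> 8 * real r"
            using ring_edges_card(2)[OF r1, of J c] by linarith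
        qed
        finally show ?thesis using r by (simp add: field_simps)
      qed
      then have "(\<Sum>r\<in>{1..R}. \<delta>\<^sup>2 / 8 * (1 / real r)) \<le> (\<Sum>r\<in>{1..R}. ?D r)" by (rule sum_mono)
      moreover have "1 < \<delta>\<^sup>2 / 8 * (\<Sum>r\<in>{1..R}. 1 / real r)"
        using R assms by (simp add: field_simps)
      ultimately show False using le1 by (simp add: sum_distrib_left)
    qed
  qed
qed

section \<open>Lattice graphs as networks and the region outside a ring\<close>

lemma lattice_network: "pinned_network (lattice_graph b n) (marked_vertex b)"
proof -
  interpret fin_digraph "lattice_graph b n" by (rule fin_digraph_lattice_graph)
  show ?thesis
  proof
    show "marked_vertex b \<in> verts (lattice_graph b n)" by (rule marked_vertex_in_verts)
  next
    fix u :: "vertex \<Rightarrow> real" and v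
    assume grad: "\<And>e. e \<in> arcs (lattice_graph b n) \<Longrightarrow> gradient (lattice_graph b n) u e = 0"
      and v: "v \<in> verts (lattice_graph b n)"
    have arc: "u (head (lattice_graph b n) e) = u (tail (lattice_graph b n) e)" if "e \<in> arcs (lattice_graph b n)" for e
      using grad[OF that] by (simp add: gradient_def)
    have inner: "u (Some q) = u (Some p)" if "(p, q) \<in> nn_edges" "p \<in> lattice_box n" "q \<in> lattice_box n" for p q
      using arc[of "(p, q)"] that by (cases b) (auto simp: collapse_def)
    have const: "h y = h x" if "\<And>i. x \<le> i \<Longrightarrow> i < y \<Longrightarrow> h (i + 1) = h i" "x \<le> y" for h :: "int \<Rightarrow> real" and x y
    proof -
      have "(\<Sum>i\<in>{x..<y}. \<bar>h (i + 1) - h i\<bar>) = 0" using that(1) by (intro sum.neutral) auto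
      then show ?thesis using abs_diff_le_sum_steps[OF that(2), of h] by simp
    qed
    have hor: "u (Some (y, s)) = u (Some (x, s))" if "x \<le> y" "- int n \<le> x" "y \<le> int n" "\<bar>s\<bar> \<le> int n" for x y s
    proof (rule const[of x y "\<lambda>t. u (Some (t, s))", OF _ that(1)])
      fix i assume "x \<le> i" "i < y"
      then show "u (Some (i + 1, s)) = u (Some (i, s))"
        by (intro inner) (use that in \<open>auto simp: nn_edges_def lattice_box_def\<close>)
    qed
    have ver: "u (Some (s, y)) = u (Some (s, x))" if "x \<le> y" "- int n \<le> x" "y \<le> int n" "\<bar>s\<bar> \<le> int n" for x y s
    proof (rule const[of x y "\<lambda>t. u (Some (s, t))", OF _ that(1)])
      fix i assume "x \<le> i" "i < y"
      then show "u (Some (s, i + 1)) = u (Some (s, i))"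
        by (intro inner) (use that in \<open>auto simp: nn_edges_def lattice_box_def\<close>)
    qed
    \<comment> \<open>Every box point is joined to the upper right corner, first horizontally and
      then along the right side.\<close>
    have box: "u (Some (x, y)) = u (Some (int n, int n))" if "(x, y) \<in> lattice_box n" for x y
      using hor[of x "int n" y] ver[of y "int n" "int n"] that by (auto simp: lattice_box_def)
    show "u v = u (marked_vertex b)"
    proof (cases b)
      case Free
      then obtain x y where "v = Some (x, y)" "(x, y) \<in> lattice_box n" using v by auto
      moreover have "(0, 0) \<in> lattice_box n" by (simp add: lattice_box_def)
      ultimately show ?thesis using Free box[of x y] box[of 0 0] by (simp del: lattice_graph.simps)
    next
      case Zero
      \<comment> \<open>The lattice edge leaving the upper right corner to the right, which
        collapses to an edge to infinity.\<close>
      let ?e = "((int n, int n), (int n + 1, int n))"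
      have "u None = u (Some (int n, int n))"
        using arc[of ?e] Zero by (auto simp: collapse_def lattice_box_def nn_edges_def)
      moreover have "v = None \<or> (\<exists>x y. v = Some (x, y) \<and> (x, y) \<in> lattice_box n)" using Zero v by auto
      ultimately show ?thesis using Zero box by (metis marked_vertex.simps(2))
    qed
  qed
qed

text \<open>Rings live in the square over this range: the box itself for free boundary conditions,
  the whole lattice for zero ones, where a potential is extended through \<open>collapse\<close> by
  its value at infinity.\<close>

definition coord_range :: "boundary \<Rightarrow> nat \<Rightarrow> int set" where
  "coord_range b n = (case b of Free \<Rightarrow> {- int n..int n} | Zero \<Rightarrow> UNIV)"

text \<open>For zero boundary conditions a lattice edge outside the box is no arc, but both its ends
  collapse to infinity. Such edges add nothing to the energy or variation of a ring.\<close>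

lemma lattice_edge:
  assumes "(p, q) \<in> nn_edges" "p \<in> coord_range b n \<times> coord_range b n" "q \<in> coord_range b n \<times> coord_range b n"
  shows "(p, q) \<in> arcs (lattice_graph b n) \<or> collapse n p = collapse n q"
  using assms by (cases b) (auto simp: coord_range_def lattice_box_def collapse_def)

lemma lattice_arc:
  assumes "(p, q) \<in> arcs (lattice_graph b n)"
  shows "tail (lattice_graph b n) (p, q) = collapse n p" "head (lattice_graph b n) (p, q) = collapse n q"
    "(p, q) \<in> nn_edges" "p \<in> lattice_box n \<or> q \<in> lattice_box n"
    "p \<in> coord_range b n \<times> coord_range b n" "q \<in> coord_range b n \<times> coord_range b n"
  using assms by (cases b; auto simp: coord_range_def lattice_box_def collapse_def)+


lemma sup_dist_arc:
  "(p, q) \<in> nn_edges \<Longrightarrow> \<bar>sup_dist c p - sup_dist c q\<bar> \<le> 1"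
  by (cases p; cases q) (auto simp: nn_edges_def sup_dist_def; linarith)

text \<open>A point that is outside the box and within distance \<open>r\<close> of \<open>c\<close>
  forces one of the four axis directions from \<open>c\<close> to leave the box after
  \<open>r\<close> steps. This places infinity on the ring of radius exactly
  \<open>r\<close>.\<close>

lemma ring_outside_box:
  assumes "c \<in> lattice_box n" "q \<notin> lattice_box n" "sup_dist c q \<le> r"
  shows "\<exists>q'. q' \<notin> lattice_box n \<and> sup_dist c q' = r"
proof -
  obtain c1 c2 q1 q2 where [simp]: "c = (c1, c2)" "q = (q1, q2)" by (cases c; cases q)
  have "q1 > int n \<or> q1 < - int n \<or> q2 > int n \<or> q2 < - int n" "0 \<le> r"
    using assms by (auto simp: lattice_box_def sup_dist_def)
  then have "(c1 + r, c2) \<notin> lattice_box n \<or> (c1 - r, c2) \<notin> lattice_box n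
      \<or> (c1, c2 + r) \<notin> lattice_box n \<or> (c1, c2 - r) \<notin> lattice_box n"
    using assms by (auto simp: lattice_box_def sup_dist_def)
  moreover have "sup_dist c (c1 + r, c2) = r" "sup_dist c (c1 - r, c2) = r"
      "sup_dist c (c1, c2 + r) = r" "sup_dist c (c1, c2 - r) = r"
    using \<open>0 \<le> r\<close> by (auto simp: sup_dist_def)
  ultimately show ?thesis by blast
qed

text \<open>Rings of different radii share no edge, and ring edges that are not arcs have zero
  increment by \<open>lattice_edge\<close>.\<close>

lemma ring_energy_le:
  fixes b n
  defines "G \<equiv> lattice_graph b n"
  shows "(\<Sum>r\<in>{1..R}. \<Sum>(p, q)\<in>ring_edges (coord_range b n) c (int r). (g (collapse n q) - g (collapse n p))\<^sup>2)
    \<le> (\<Sum>e\<in>arcs G. (gradient G g e)\<^sup>2)"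
proof -
  interpret fin_digraph G unfolding G_def by (rule fin_digraph_lattice_graph)
  let ?E = "\<lambda>r::nat. ring_edges (coord_range b n) c (int r)"
  let ?d = "\<lambda>(p, q). (g (collapse n q) - g (collapse n p))\<^sup>2"
  have fin: "finite (?E r)" if "r \<in> {1..R}" for r using that by (intro ring_edges_card) auto
  have "(\<Sum>r\<in>{1..R}. sum ?d (?E r)) = sum ?d (\<Union>r\<in>{1..R}. ?E r)"
    by (rule sum.UNION_disjoint[symmetric]) (use fin in \<open>auto simp: ring_edges_def\<close>)
  also have "\<dots> = sum ?d ((\<Union>r\<in>{1..R}. ?E r) \<inter> arcs G)"
  proof (rule sum.mono_neutral_right)
    show "finite (\<Union>r\<in>{1..R}. ?E r)" using fin by auto
    show "\<forall>e\<in>(\<Union>r\<in>{1..R}. ?E r) - (\<Union>r\<in>{1..R}. ?E r) \<inter> arcs G. ?d e = 0"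
    proof
      fix e assume e: "e \<in> (\<Union>r\<in>{1..R}. ?E r) - (\<Union>r\<in>{1..R}. ?E r) \<inter> arcs G"
      obtain p q where pq: "e = (p, q)" by (cases e)
      from e have "(p, q) \<notin> arcs G" "(p, q) \<in> nn_edges" "p \<in> coord_range b n \<times> coord_range b n" "q \<in> coord_range b n \<times> coord_range b n"
        by (auto simp: pq ring_edges_def)
      then have "collapse n p = collapse n q" using lattice_edge unfolding G_def by blast
      then show "?d e = 0" by (simp add: pq)
    qed
  qed auto
  also have "\<dots> \<le> sum ?d (arcs G)" by (rule sum_mono2) auto
  also have "\<dots> = (\<Sum>e\<in>arcs G. (gradient G g e)\<^sup>2)"
  proof (rule sum.cong[OF refl])
    fix e assume "e \<in> arcs G"
    then show "?d e = (gradient G g e)\<^sup>2"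
      using lattice_arc(1,2)[of "fst e" "snd e" b n] by (simp add: G_def gradient_def case_prod_beta)
  qed
  finally show ?thesis .
qed

text \<open>Written as the complement of an open ball in the box so that infinity always belongs to
  it.\<close>

definition far :: "nat \<Rightarrow> int \<times> int \<Rightarrow> int \<Rightarrow> vertex set" where
  "far n c r = {v. \<not> (\<exists>p\<in>lattice_box n. v = Some p \<and> sup_dist c p < r)}"

text \<open>An edge leaving the ball ends on the ring or at infinity. In the second case
  \<open>q\<close> may be closer to \<open>c\<close> than \<open>r\<close>, and
  \<open>ring_outside_box\<close> replaces it by a ring point with the same image.\<close>

lemma far_boundary:
  assumes e: "(p, q) \<in> nn_edges \<or> (q, p) \<in> nn_edges" and c: "c \<in> lattice_box n"
    and q: "q \<in> coord_range b n \<times> coord_range b n"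
    and far: "collapse n p \<notin> far n c r" "collapse n q \<in> far n c r"
  shows "\<exists>q'\<in>coord_range b n \<times> coord_range b n. sup_dist c q' = r \<and> collapse n q' = collapse n q"
proof -
  have p: "p \<in> lattice_box n" "sup_dist c p < r"
    using far(1) by (auto simp: far_def collapse_def split: if_splits)
  then have le: "sup_dist c q \<le> r"
    using e sup_dist_arc[of p q c] sup_dist_arc[of q p c] by auto
  show ?thesis
  proof (cases "q \<in> lattice_box n")
    case True
    with far(2) have "\<not> sup_dist c q < r" by (auto simp: far_def collapse_def)
    with le q show ?thesis by (intro bexI[of _ q]) auto
  next
    case False
    with q have b: "coord_range b n = UNIV"
      by (cases b) (auto simp: coord_range_def lattice_box_def)
    from ring_outside_box[OF c False le] False show ?thesis
      by (auto simp: b collapse_def)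
  qed
qed

text \<open>The switch \<open>k\<close> exchanges the poles, so that the same statement serves the
  dipole potential and its negative.\<close>

lemma dipole_far_le:
  fixes b n
  defines "G \<equiv> lattice_graph b n"
  assumes x: "x = (if k then head G e else tail G e)" "y = (if k then tail G e else head G e)"
    and e: "e = (p, q)" "e \<in> arcs G" and c: "c \<in> {p, q}" "c \<in> lattice_box n" and r: "1 \<le> r"
    and weak: "\<And>u. (\<Sum>e\<in>arcs G. gradient G g e * gradient G u e) = u x - u y"
    and M: "\<And>q. q \<in> coord_range b n \<times> coord_range b n \<Longrightarrow> sup_dist c q = r \<Longrightarrow> g (collapse n q) \<le> M"
    and v: "v \<in> verts G" "v \<in> far n c r"
  shows "g v \<le> M"
proof -
  interpret pinned_network G "marked_vertex b" unfolding G_def by (rule lattice_network)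
  have ends: "head G e \<in> verts G" "tail G e \<in> verts G" using e(2) by auto
  have hd: "g (head G d) \<le> M" if "d \<in> arcs G" "head G d \<in> far n c r" "tail G d \<notin> far n c r" for d
  proof -
    obtain s t where d: "d = (s, t)" by (cases d)
    note A = lattice_arc[of s t b n, folded G_def, OF that(1)[unfolded d]]
    show ?thesis
      using far_boundary[of s t c n b r] A that(2,3) c(2) M unfolding d by metis
  qed
  have tl: "g (tail G d) \<le> M" if "d \<in> arcs G" "tail G d \<in> far n c r" "head G d \<notin> far n c r" for d
  proof -
    obtain s t where d: "d = (s, t)" by (cases d)
    note A = lattice_arc[of s t b n, folded G_def, OF that(1)[unfolded d]]
    show ?thesis
      using far_boundary[of t s c n b r] A that(2,3) c(2) M unfolding d by metis
  qed
  \<comment> \<open>One pole is \<open>c\<close>, inside the ring. If the other one is far, then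
    \<open>e\<close> itself crosses into the far region and its far end is already
    controlled.\<close>
  have "sup_dist c c = 0" by (simp add: sup_dist_def)
  then have "Some c \<notin> far n c r" using c(2) r by (auto simp: far_def)
  moreover have "head G e = Some c \<or> tail G e = Some c"
    using lattice_arc(1,2)[of p q b n] e c unfolding G_def by (auto simp: collapse_def)
  ultimately have poles: "x \<in> far n c r \<Longrightarrow> g x \<le> M" "y \<in> far n c r \<Longrightarrow> g y \<le> M"
    using hd[OF e(2)] tl[OF e(2)] x by (auto split: if_splits)
  show ?thesis
    by (rule maximum_principle[where a = x and b = y and W = "far n c r", OF _ _ _ hd tl poles v])
      (use x ends weak in \<open>auto simp: dirichlet_def\<close>)
qed

lemma card_edges_near:
  fixes z :: "int \<times> int" and m :: nat
  defines "A \<equiv> {(p, q) \<in> nn_edges. sup_dist z p \<le> int m}"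
  shows "finite A" "card A \<le> 2 * (2 * m + 1)\<^sup>2"
proof -
  obtain z1 z2 where z: "z = (z1, z2)" by (cases z)
  let ?P = "{z1 - int m..z1 + int m} \<times> {z2 - int m..z2 + int m}"
  let ?f = "\<lambda>(p, d). (p, p + d)"
  have sub: "A \<subseteq> ?f ` (?P \<times> {(1, 0), (0, 1)})"
    by (auto simp: A_def z sup_dist_def nn_edges_def image_iff)
  have fin: "finite (?f ` (?P \<times> {(1, 0), (0, 1)}))" by simp
  show "finite A" by (rule finite_subset[OF sub fin])
  have "card A \<le> card (?f ` (?P \<times> {(1, 0), (0, 1)}))" by (rule card_mono[OF fin sub])
  also have "\<dots> \<le> card (?P \<times> {(1 :: int, 0 :: int), (0, 1)})" by (rule card_image_le) simp
  also have "\<dots> = 2 * (2 * m + 1)\<^sup>2"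
    by (simp add: card_cartesian_product power2_eq_square nat_add_distrib nat_mult_distrib algebra_simps)
  finally show "card A \<le> 2 * (2 * m + 1)\<^sup>2" .
qed

section \<open>Counting the steep edges\<close>

definition steep_arcs :: "boundary \<Rightarrow> nat \<Rightarrow> vertex \<Rightarrow> vertex \<Rightarrow> ((int \<times> int) \<times> (int \<times> int)) set" where
  "steep_arcs b n v1 v2 = {e \<in> arcs (lattice_graph b n). 1 / 10 <
     \<bar>gradient (lattice_graph b n) (pinned_network.green (lattice_graph b n) (marked_vertex b) v1 v2) e\<bar>}"

lemma card_steep_arcs_bounded:
  "\<exists>N. \<forall>b n. \<forall>v1\<in>verts (lattice_graph b n). \<forall>v2\<in>verts (lattice_graph b n). card (steep_arcs b n v1 v2) \<le> N"
proof -
  \<comment> \<open>\<open>1 / 40\<close> because the oscillation from a corner is at most twice the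
    variation, and comparing two far vertices doubles it again, up to the threshold
    \<open>1 / 10\<close>.\<close>
  obtain R :: nat where ring: "\<And>J c h. (\<Sum>r\<in>{1..R}. \<Sum>(p, q)\<in>ring_edges J c (int r). (h q - h p)\<^sup>2) \<le> 1 \<Longrightarrow>
      \<exists>r\<in>{1..R}. ring_variation J c (int r) h \<le> 1 / 40"
    using ex_ring_small_variation[of "1 / 40"] by (metis zero_less_divide_1_iff zero_less_numeral)
  \<comment> \<open>The extra 1 allows for the tail of the edge being one step away from the centre
    \<open>c\<close> of the ring.\<close>
  define near where "near z = {(p, q) \<in> nn_edges. sup_dist z p \<le> int (R + 1)}" for z
  define N where "N = 2 * (2 * (R + 1) + 1)\<^sup>2"
  have near: "finite (near z)" "card (near z) \<le> N" for z
    unfolding near_def N_def by (rule card_edges_near)+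
  have "card (steep_arcs b n v1 v2) \<le> N + N"
    if v: "v1 \<in> verts (lattice_graph b n)" "v2 \<in> verts (lattice_graph b n)" for b n v1 v2
  proof (cases "b = Free \<and> n < R")
    \<comment> \<open>A free box smaller than \<open>R\<close> may contain no corner of the ring,
      but then all its edges are close to the origin.\<close>
    case True
    then have "steep_arcs b n v1 v2 \<subseteq> near (0, 0)"
      by (auto simp: steep_arcs_def near_def lattice_box_def sup_dist_def)
    then have "card (steep_arcs b n v1 v2) \<le> card (near (0, 0))" by (rule card_mono[OF near(1)])
    then show ?thesis using near(2)[of "(0, 0)"] by linarith
  next
    case False
    define G where "G = lattice_graph b n"
    interpret pinned_network G "marked_vertex b" unfolding G_def by (rule lattice_network)
    \<comment> \<open>Infinity lies in every far region, so it never accounts for a steep edge and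
      gets the empty set.\<close>
    define near' where "near' v = (case v of None \<Rightarrow> {} | Some z \<Rightarrow> near z)" for v :: vertex
    have near': "finite (near' v)" "card (near' v) \<le> N" for v
      using near by (auto simp: near'_def split: option.split)
    let ?J = "coord_range b n"
    have "steep_arcs b n v1 v2 \<subseteq> near' v1 \<union> near' v2"
    proof
      fix e assume "e \<in> steep_arcs b n v1 v2"
      then have e: "e \<in> arcs G" "1 / 10 < \<bar>gradient G (green v1 v2) e\<bar>" by (auto simp: steep_arcs_def G_def)
      obtain p q where pq: "e = (p, q)" by (cases e)
      note arc = lattice_arc[OF e(1)[unfolded pq G_def]]
      \<comment> \<open>The ring is centred at an end of \<open>e\<close> inside the box; the other
        end may be infinity.\<close>
      obtain c where c: "c \<in> {p, q}" "c \<in> lattice_box n" using arc(4) by blast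
      have ends: "head G e \<in> verts G" "tail G e \<in> verts G" using e(1) by auto
      define g where "g = green (head G e) (tail G e)"
      define h where "h x = g (collapse n x)" for x
      have weak: "(\<Sum>e\<in>arcs G. gradient G g e * gradient G u e) = u (head G e) - u (tail G e)" for u
        using dirichlet_green[OF ends, of u] by (simp add: g_def dirichlet_def)
      have weak': "(\<Sum>e\<in>arcs G. gradient G (\<lambda>v. - g v) e * gradient G u e) = u (tail G e) - u (head G e)" for u
      proof -
        have "gradient G (\<lambda>v. - g v) e = - gradient G g e" for e by (simp add: gradient_def)
        then show ?thesis using weak[of u] by (simp add: sum_negf)
      qed
      have "(\<Sum>e\<in>arcs G. (gradient G g e)\<^sup>2) \<le> 1"
        using arc_resistance_le_1[OF e(1)] by (simp add: g_def resistance_def dirichlet_self)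
      then have "(\<Sum>r\<in>{1..R}. \<Sum>(p, q)\<in>ring_edges ?J c (int r). (h q - h p)\<^sup>2) \<le> 1"
        unfolding h_def G_def by (rule order_trans[OF ring_energy_le])
      then obtain r where r: "r \<in> {1..R}" "ring_variation ?J c (int r) h \<le> 1 / 40" using ring by blast
      \<comment> \<open>In each coordinate the corner is chosen on the side of 0, so that
        \<open>r \<le> n\<close> keeps it in a free box.\<close>
      define k where "k = (if fst c \<le> 0 then fst c + int r else fst c - int r, if snd c \<le> 0 then snd c + int r else snd c - int r)"
      have k: "fst k \<in> ?J" "snd k \<in> ?J" "\<bar>fst k - fst c\<bar> = int r" "\<bar>snd k - snd c\<bar> = int r"
        using c(2) r(1) False by (cases b; auto simp: k_def coord_range_def lattice_box_def)+
      have osc: "\<bar>h x - h k\<bar> \<le> 1 / 20" if "x \<in> ?J \<times> ?J" "sup_dist c x = int r" for x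
      proof -
        have J: "t \<in> ?J" if "a \<in> ?J" "d \<in> ?J" "a \<le> t" "t \<le> d" for a d t
          using that by (cases b) (auto simp: coord_range_def)
        have "\<bar>h x - h (fst k, snd k)\<bar> \<le> 2 * ring_variation ?J c (int r) h"
        proof (rule ring_oscillation[OF _ _ k that])
          show "t \<in> ?J" if "a \<in> ?J" "d \<in> ?J" "a \<le> t" "t \<le> d" for a d t by (rule J[OF that])
          show "1 \<le> int r" using r(1) by simp
        qed
        then show ?thesis using r(2) by simp
      qed
      have osc': "g (collapse n x) \<le> h k + 1 / 20" "- g (collapse n x) \<le> - h k + 1 / 20"
        if "x \<in> ?J \<times> ?J" "sup_dist c x = int r" for x
        using osc[OF that] unfolding h_def abs_le_iff by linarith+
      have up: "g v \<le> h k + 1 / 20" if "v \<in> verts G" "v \<in> far n c (int r)" for v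
        by (rule dipole_far_le[where k = True and e = e and c = c and b = b and n = n and r = "int r", folded G_def, OF refl refl pq e(1) c _ _ _ that])
          (use r(1) in \<open>simp\<close>, simp only: if_True weak, rule osc'(1))
      have down: "- g v \<le> - h k + 1 / 20" if "v \<in> verts G" "v \<in> far n c (int r)" for v
        by (rule dipole_far_le[where k = False and e = e and c = c and b = b and n = n and r = "int r", folded G_def, OF refl refl pq e(1) c _ _ _ that])
          (use r(1) in \<open>simp\<close>, simp only: if_False weak', rule osc'(2))
      \<comment> \<open>If both vertices were far, the dipole potential would differ by at most
        \<open>1 / 10\<close> between them, and by \<open>reciprocity\<close> the edge would not be
        steep.\<close>
      have "\<not> (v1 \<in> far n c (int r) \<and> v2 \<in> far n c (int r))"
      proof
        assume *: "v1 \<in> far n c (int r) \<and> v2 \<in> far n c (int r)"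
        have v': "v1 \<in> verts G" "v2 \<in> verts G" using v by (simp_all add: G_def)
        have "\<bar>g v1 - g v2\<bar> \<le> 1 / 10"
          using up[OF v'(1)] up[OF v'(2)] down[OF v'(1)] down[OF v'(2)] * by linarith
        then show False
          using e(2) reciprocity[of v1 v2 e] v e(1) by (simp add: g_def G_def)
      qed
      moreover have "e \<in> near' w" if w: "w \<notin> far n c (int r)" for w
      proof -
        obtain z where z: "w = Some z" "sup_dist c z < int r" using w unfolding far_def by blast
        have "sup_dist z p \<le> sup_dist z c + 1"
          using sup_dist_arc[OF arc(3), of z] c(1) by auto
        moreover have "sup_dist z c = sup_dist c z" by (simp add: sup_dist_def abs_minus_commute)
        ultimately show ?thesis using z r(1) arc(3) by (auto simp: near'_def near_def pq)
      qed
      ultimately show "e \<in> near' v1 \<union> near' v2" by blast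
    qed
    then have "card (steep_arcs b n v1 v2) \<le> card (near' v1 \<union> near' v2)"
      using near' by (intro card_mono) auto
    then show ?thesis using card_Un_le[of "near' v1" "near' v2"] near'(2)[of v1] near'(2)[of v2] by linarith
  qed
  then show ?thesis by blast
qed

section \<open>Comparison with the Gaussian free field\<close>

lemma error_M_eq: "error_M \<beta> = (2 * pi)\<^sup>2 * \<beta> * min_variance \<beta>"
  by (simp add: error_M_def min_variance_def)

theorem theorem1p3:
  shows "\<exists>K::real. \<forall>n::nat. \<forall>\<beta>::real. \<forall>b::boundary.
    \<forall>v1\<in>verts (lattice_graph b n). \<forall>v2\<in>verts (lattice_graph b n).
    n \<ge> 1 \<longrightarrow> \<beta> \<ge> 1 / 3 \<longrightarrow>
    (let \<Lambda> = lattice_graph b n;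
         v0 = marked_vertex b;
         villain_cos =
           prob_space.expectation (villain_law \<Lambda> v0 \<beta>) (\<lambda>\<theta>. cos (\<theta> v1 - \<theta> v2));
         gff_char = (\<lambda>\<beta>'.
           prob_space.expectation (gff_law \<Lambda> v0 \<beta>')
             (\<lambda>\<phi>. exp (\<i> * complex_of_real (\<phi> v1 - \<phi> v2))))
     in complex_of_real villain_cos
          \<le> complex_of_real K * gff_char \<beta> powr complex_of_real (1 + error_M \<beta> / 2)
      \<and> complex_of_real K * gff_char \<beta> powr complex_of_real (1 + error_M \<beta> / 2)
          = complex_of_real K * gff_char (\<beta> / (1 + error_M \<beta> / 2)))"
proof -
  obtain N where N: "\<And>b n v1 v2. v1 \<in> verts (lattice_graph b n) \<Longrightarrow> v2 \<in> verts (lattice_graph b n) \<Longrightarrow>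
      card (steep_arcs b n v1 v2) \<le> N"
    using card_steep_arcs_bounded by blast
  define K where "K = exp (pi\<^sup>2 * real N)"
  show ?thesis
    unfolding Let_def
  proof (intro exI[of _ K] allI ballI impI)
    fix n :: nat and \<beta> :: real and b v1 v2
    assume v: "v1 \<in> verts (lattice_graph b n)" "v2 \<in> verts (lattice_graph b n)" and \<beta>: "1 / 3 \<le> \<beta>"
    define G where "G = lattice_graph b n"
    interpret pinned_network G "marked_vertex b" unfolding G_def by (rule lattice_network)
    note v = v[folded G_def]
    define E where "E = resistance v1 v2"
    define s where "s = 1 + error_M \<beta> / 2"
    let ?villain = "prob_space.expectation (villain_law G (marked_vertex b) \<beta>) (\<lambda>\<theta>. cos (\<theta> v1 - \<theta> v2))"
    let ?gff = "\<lambda>\<beta>'. prob_space.expectation (gff_law G (marked_vertex b) \<beta>') (\<lambda>\<phi>. exp (\<i> * complex_of_real (\<phi> v1 - \<phi> v2)))"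
    have \<beta>0: "0 < \<beta>" using \<beta> by simp
    have s: "1 \<le> s" using \<beta>0 min_variance_nonneg[of \<beta>] by (simp add: s_def error_M_eq)
    \<comment> \<open>The prefactor \<open>(2 * pi)\<^sup>2 * \<beta>\<close> in
      \<open>error_M\<close> turns \<open>E / (2 * \<beta>)\<close> times half of
      \<open>error_M \<beta>\<close> into the edge gain
      \<open>pi\<^sup>2 * min_variance \<beta> * E\<close>.\<close>
    have exponent: "s * (- E / (2 * \<beta>)) = - pi\<^sup>2 * min_variance \<beta> * E + - E / (2 * \<beta>)"
      using \<beta>0 by (simp add: s_def error_M_eq field_simps power2_eq_square)
    have "?gff \<beta> powr complex_of_real s = complex_of_real (exp (- E / (2 * \<beta>)) powr s)"
      unfolding gff_characteristic[OF v \<beta>0] E_def by (rule powr_of_real) (use s in auto)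
    also have "exp (- E / (2 * \<beta>)) powr s = exp (s * (- E / (2 * \<beta>)))" by (simp add: powr_def)
    finally have powr: "?gff \<beta> powr complex_of_real s = complex_of_real (exp (s * (- E / (2 * \<beta>))))" .
    have "?gff (\<beta> / s) = complex_of_real (exp (- E / (2 * (\<beta> / s))))"
      unfolding E_def using \<beta>0 s by (intro gff_characteristic v) simp
    then have eq: "?gff \<beta> powr complex_of_real s = ?gff (\<beta> / s)"
      unfolding powr using s by simp
    have "?villain \<le> exp (pi\<^sup>2 * real (card (steep_arcs b n v1 v2))) * exp (- pi\<^sup>2 * min_variance \<beta> * E) * exp (- E / (2 * \<beta>))"
      using villain_correlation_le[OF \<beta> v] by (simp add: steep_arcs_def G_def E_def)
    also have "\<dots> \<le> K * exp (- pi\<^sup>2 * min_variance \<beta> * E) * exp (- E / (2 * \<beta>))"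
      unfolding K_def using N v by (intro mult_right_mono) (auto simp: G_def)
    also have "\<dots> = K * exp (s * (- E / (2 * \<beta>)))"
      unfolding exponent by (simp only: exp_add mult.assoc)
    \<comment> \<open>Both sides are real numbers, where the order on the complex numbers is the
      usual one.\<close>
    finally have "complex_of_real ?villain \<le> complex_of_real K * ?gff \<beta> powr complex_of_real s"
      unfolding powr by (simp add: less_eq_complex_def)
    with eq show "complex_of_real (prob_space.expectation (villain_law (lattice_graph b n) (marked_vertex b) \<beta>) (\<lambda>\<theta>. cos (\<theta> v1 - \<theta> v2)))
        \<le> complex_of_real K * prob_space.expectation (gff_law (lattice_graph b n) (marked_vertex b) \<beta>) (\<lambda>\<phi>. exp (\<i> * complex_of_real (\<phi> v1 - \<phi> v2))) powr complex_of_real (1 + error_M \<beta> / 2)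
      \<and> complex_of_real K * prob_space.expectation (gff_law (lattice_graph b n) (marked_vertex b) \<beta>) (\<lambda>\<phi>. exp (\<i> * complex_of_real (\<phi> v1 - \<phi> v2))) powr complex_of_real (1 + error_M \<beta> / 2)
        = complex_of_real K * prob_space.expectation (gff_law (lattice_graph b n) (marked_vertex b) (\<beta> / (1 + error_M \<beta> / 2))) (\<lambda>\<phi>. exp (\<i> * complex_of_real (\<phi> v1 - \<phi> v2)))"
      unfolding G_def[symmetric] s_def[symmetric] by simp
  qed
qed

end
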